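(* Let $\{U(t)\}_{t\in\mathbb{R}}$ be a $C_0$-group on a complex Banach space $\mathfrak{X}$ with generator $iA$, satisfying the non-quasianalyticity condition $\int_{-\infty}^{\infty}\frac{\ln\|U(t)\|}{1+t^2}\,dt<\infty$. Then for all $\alpha>0$ $$\mathfrak{E}^{\alpha}(A)\subset\Xi^{\alpha}(A)=\mathcal{L}([-\alpha,\alpha]),$$ and moreover $\Xi^{\alpha}(A)$ is a closed subspace of $\mathfrak{X}$.
   Context: Setting: $(\mathfrak{X},\|\cdot\|)$ is a complex Banach space, $A$ is a closed densely defined linear operator with domain $\mathcal{D}(A)$, and $iA$ generates a strongly continuous group $\{U(t)\}_{t\in\mathbb{R}}$ of bounded linear operators with $\int_{-\infty}^{\infty}\frac{\ln\|U(t)\|}{1+t^2}dt<\infty$ (i.e. $\ln\|U(t)\|/(1+t^2)$ is Lebesgue integrable on $\mathbb{R}$). Here $\mathbb{N}_0=\mathbb{N}\cup\{0\}$. Entire vectors of exponential type: $C^\infty(A)=\bigcap_{n\in\mathbb{N}_0}\mathcal{D}(A^n)$; for $\alpha>0$, $\mathfrak{E}^{\alpha}(A)=\{x\in C^\infty(A): \exists c=c(x)>0\ \forall k\in\mathbb{N}_0\ \|A^kx\|\le c\alpha^k\}$; $\mathfrak{E}(A)=\bigcup_{\alpha>0}\mathfrak{E}^\alpha(A)$. For $x\in\mathfrak{E}(A)$ its type is $\sigma(x,A)=\inf\{\alpha>0: x\in\mathfrak{E}^\alpha(A)\}=\limsup_{n\to\infty}\|A^nx\|^{1/n}$. For $\alpha>0$,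 $\Xi^\alpha(A)=\{x\in\mathfrak{E}(A):\sigma(x,A)\le\alpha\}$ (equivalently $\bigcap_{\epsilon>0}\mathfrak{E}^{\alpha+\epsilon}(A)$). Spectral subspaces $\mathcal{L}(\Delta)$: It is known that there is an entire function of the form $\theta(t)=C\prod_{k=1}^\infty\left(1-\frac{t}{it_k}\right)$, with $C$ a constant, $0<t_1\le t_2\le\dots$ and $\sum_{k=1}^\infty\frac1{t_k}<\infty$, such that $\|U(t)\|\le|\theta(t)|$ for all $t\in\mathbb{R}$; fix such a $\theta$. Let $E_\theta^{(\infty)}$ be the class of entire functions $\phi$ of order 1 and finite type (i.e. of exponential type) such that $\int_{-\infty}^{\infty}|t^m\theta(at)\phi(t)|\,dt<\infty$ for all $m=0,1,2,\dots$ and all $a>0$. For $\phi\in E_\theta^{(\infty)}$ define the bounded operator $P_\phi=\int_{-\infty}^{\infty}\phi(t)U(t)\,dt$ (strong integral), and let $\tilde\phi(\lambda)=\int_{-\infty}^{\infty}\phi(t)e^{i\lambda t}dt$ be the Fourier transform. For a segment (compact interval) $\Delta\subset\mathbb{R}$, let $E_\theta^{(\infty)}(\Delta)$ be the set of $\phi\in E_\theta^{(\infty)}$ such that $\tilde\phi(\lambda)=1$ on some open interval containing $\Delta$. Then $$\mathcal{L}(\Delta)=\{x\in\mathfrak{X}: P_\phi x=x\ \text{ for all } \phi\in E_\theta^{(\infty)}(\Delta)\}.$$ *)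

theory Defs
  imports "HOL-Analysis.Analysis"
begin

text \<open>
  Complex Banach spaces. The type class \<open>banach\<close> of the library only provides real scalars.
\<close>

class complex_banach = banach +
  fixes scaleC :: "complex \<Rightarrow> 'a \<Rightarrow> 'a"  (infixr "*\<^sub>C" 75)
  assumes scaleC_add_right: "a *\<^sub>C (x + y) = a *\<^sub>C x + a *\<^sub>C y"
    and scaleC_add_left: "(a + b) *\<^sub>C x = a *\<^sub>C x + b *\<^sub>C x"
    and scaleC_scaleC: "a *\<^sub>C (b *\<^sub>C x) = (a * b) *\<^sub>C x"
    and scaleC_one: "1 *\<^sub>C x = x"
    and scaleR_scaleC: "r *\<^sub>R x = complex_of_real r *\<^sub>C x"
    and norm_scaleC: "norm (a *\<^sub>C x) = cmod a * norm x"

lemma vector_space_scaleC: "vector_space (scaleC :: complex \<Rightarrow> 'a \<Rightarrow> 'a::complex_banach)"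
  by unfold_locales (simp_all add: scaleC_add_right scaleC_add_left scaleC_scaleC scaleC_one)

instantiation complex :: complex_banach
begin

definition scaleC_complex :: "complex \<Rightarrow> complex \<Rightarrow> complex"
  where "scaleC_complex a x = a * x"

instance
  by standard (simp_all add: scaleC_complex_def algebra_simps norm_mult scaleR_conv_of_real)

end

abbreviation csubspace :: "'a::complex_banach set \<Rightarrow> bool"
  where "csubspace \<equiv> module.subspace scaleC"

text \<open>
  A (possibly unbounded) operator is given by its domain \<open>D\<close> together with a total function
  \<open>A\<close>; the values of \<open>A\<close> outside \<open>D\<close> are irrelevant.
\<close>

definition closed_densely_defined :: "'a::complex_banach set \<Rightarrow> ('a \<Rightarrow> 'a) \<Rightarrow> bool"
  where "closed_densely_defined D A \<longleftrightarrow>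
    csubspace D \<and>
    (\<forall>x\<in>D. \<forall>y\<in>D. A (x + y) = A x + A y) \<and>
    (\<forall>c. \<forall>x\<in>D. A (c *\<^sub>C x) = c *\<^sub>C A x) \<and>
    closure D = UNIV \<and>
    closed {(x, A x) |x. x \<in> D}"

definition C0_group :: "(real \<Rightarrow> 'a::complex_banach \<Rightarrow> 'a) \<Rightarrow> bool"
  where "C0_group U \<longleftrightarrow>
    (\<forall>t. bounded_linear (U t) \<and> Vector_Spaces.linear scaleC scaleC (U t)) \<and>
    U 0 = id \<and>
    (\<forall>s t. U (s + t) = U s \<circ> U t) \<and>
    (\<forall>x. continuous_on UNIV (\<lambda>t. U t x))"

definition generates :: "'a::complex_banach set \<Rightarrow> ('a \<Rightarrow> 'a) \<Rightarrow> (real \<Rightarrow> 'a \<Rightarrow> 'a) \<Rightarrow> bool"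
  where "generates D B U \<longleftrightarrow>
    D = {x. \<exists>y. ((\<lambda>t. (U t x - x) /\<^sub>R t) \<longlongrightarrow> y) (at 0)} \<and>
    (\<forall>x\<in>D. ((\<lambda>t. (U t x - x) /\<^sub>R t) \<longlongrightarrow> B x) (at 0))"

definition non_quasianalytic :: "(real \<Rightarrow> 'a::complex_banach \<Rightarrow> 'a) \<Rightarrow> bool"
  where "non_quasianalytic U \<longleftrightarrow> integrable lborel (\<lambda>t. ln (onorm (U t)) / (1 + t\<^sup>2))"

primrec dom_pow :: "'a set \<Rightarrow> ('a \<Rightarrow> 'a) \<Rightarrow> nat \<Rightarrow> 'a set"
  where
    "dom_pow D A 0 = UNIV"
  | "dom_pow D A (Suc n) = {x \<in> D. A x \<in> dom_pow D A n}"

definition C_infinity :: "'a set \<Rightarrow> ('a \<Rightarrow> 'a) \<Rightarrow> 'a set"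
  where "C_infinity D A = (\<Inter>n. dom_pow D A n)"

definition exp_vectors :: "'a::complex_banach set \<Rightarrow> ('a \<Rightarrow> 'a) \<Rightarrow> real \<Rightarrow> 'a set"
  where "exp_vectors D A \<alpha> =
    {x \<in> C_infinity D A. \<exists>c>0. \<forall>k. norm ((A ^^ k) x) \<le> c * \<alpha> ^ k}"

definition all_exp_vectors :: "'a::complex_banach set \<Rightarrow> ('a \<Rightarrow> 'a) \<Rightarrow> 'a set"
  where "all_exp_vectors D A = (\<Union>\<alpha>\<in>{0<..}. exp_vectors D A \<alpha>)"

definition vector_type :: "'a::complex_banach set \<Rightarrow> ('a \<Rightarrow> 'a) \<Rightarrow> 'a \<Rightarrow> real"
  where "vector_type D A x = Inf {\<alpha>. \<alpha> > 0 \<and> x \<in> exp_vectors D A \<alpha>}"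

definition Xi :: "'a::complex_banach set \<Rightarrow> ('a \<Rightarrow> 'a) \<Rightarrow> real \<Rightarrow> 'a set"
  where "Xi D A \<alpha> = {x \<in> all_exp_vectors D A. vector_type D A x \<le> \<alpha>}"

text \<open>
  The zeros of the majorant are indexed from \<open>0\<close>, so \<open>\<tau> k\<close> is $t_{k+1}$. The product converges for
  every \<open>z\<close> by summability of \<open>1 / \<tau> k\<close>, so \<open>\<theta>\<close> is automatically entire.
\<close>

definition theta_majorant :: "(real \<Rightarrow> 'a::complex_banach \<Rightarrow> 'a) \<Rightarrow> (complex \<Rightarrow> complex) \<Rightarrow> bool"
  where "theta_majorant U \<theta> \<longleftrightarrow>
    (\<exists>(C::complex) (\<tau>::nat \<Rightarrow> real).
      (\<forall>k. 0 < \<tau> k) \<and> incseq \<tau> \<and> summable (\<lambda>k. 1 / \<tau> k) \<and>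
      (\<forall>z. \<theta> z = C * (\<Prod>k. 1 - z / (\<i> * complex_of_real (\<tau> k))))) \<and>
    (\<forall>t::real. onorm (U t) \<le> cmod (\<theta> (complex_of_real t)))"

definition exponential_type :: "(complex \<Rightarrow> complex) \<Rightarrow> bool"
  where "exponential_type \<phi> \<longleftrightarrow>
    \<phi> holomorphic_on UNIV \<and> (\<exists>M B. \<forall>z. cmod (\<phi> z) \<le> M * exp (B * cmod z))"

definition E_theta :: "(complex \<Rightarrow> complex) \<Rightarrow> (complex \<Rightarrow> complex) set"
  where "E_theta \<theta> = {\<phi>. exponential_type \<phi> \<and>
    (\<forall>(m::nat) (a::real). a > 0 \<longrightarrow>
      integrable lborel (\<lambda>t::real.
        cmod (complex_of_real t ^ m * \<theta> (complex_of_real (a * t)) * \<phi> (complex_of_real t))))}"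

definition fourier :: "(complex \<Rightarrow> complex) \<Rightarrow> real \<Rightarrow> complex"
  where "fourier \<phi> l =
    (LINT t|lborel. \<phi> (complex_of_real t) * exp (\<i> * complex_of_real l * complex_of_real t))"

text \<open>
  The strong integral is a Henstock--Kurzweil integral, because the Bochner integral of the library
  is restricted to separable spaces. For \<open>\<phi> \<in> E_theta \<theta>\<close> with \<open>\<theta>\<close> a majorant of \<open>U\<close>, the integrand
  is continuous and absolutely integrable, so the integral exists and agrees with the Bochner and
  improper Riemann integrals.
\<close>

definition P_op :: "(real \<Rightarrow> 'a::complex_banach \<Rightarrow> 'a) \<Rightarrow> (complex \<Rightarrow> complex) \<Rightarrow> 'a \<Rightarrow> 'a"
  where "P_op U \<phi> x = integral UNIV (\<lambda>t::real. \<phi> (complex_of_real t) *\<^sub>C U t x)"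

definition E_theta_on :: "(complex \<Rightarrow> complex) \<Rightarrow> real set \<Rightarrow> (complex \<Rightarrow> complex) set"
  where "E_theta_on \<theta> \<Delta> =
    {\<phi> \<in> E_theta \<theta>. \<exists>a b. \<Delta> \<subseteq> {a<..<b} \<and> (\<forall>l\<in>{a<..<b}. fourier \<phi> l = 1)}"

definition spectral_subspace ::
    "(real \<Rightarrow> 'a::complex_banach \<Rightarrow> 'a) \<Rightarrow> (complex \<Rightarrow> complex) \<Rightarrow> real set \<Rightarrow> 'a set"
  where "spectral_subspace U \<theta> \<Delta> = {x. \<forall>\<phi>\<in>E_theta_on \<theta> \<Delta>. P_op U \<phi> x = x}"

end

theory Submission
  imports Defs "HOL-Complex_Analysis.Complex_Analysis" "HOL-Probability.Probability"
begin

text \<open>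
  An entire vector of type at most \<open>\<alpha>\<close> has an orbit \<open>t \<mapsto> U t x\<close> whose "frequencies" lie in \<open>[-\<alpha>, \<alpha>]\<close>,
  and \<open>P_op U \<phi>\<close> multiplies the frequency \<open>l\<close> by \<open>fourier \<phi> l\<close>. So the operators \<open>P_op U \<phi>\<close> with
  \<open>fourier \<phi> = 1\<close> near \<open>[-\<alpha>, \<alpha>]\<close> fix such vectors, and conversely a vector that is fixed by an
  operator with \<open>\<phi>\<close> of type slightly above \<open>\<alpha>\<close> inherits the type of \<open>\<phi>\<close>. Three arguments make this
  precise.

  \<^item> There are enough kernels \<open>\<phi>\<close> (\<open>band_limited_kernel\<close>). Since \<open>|sin z / z| \<le> e^|Im z| / sqrt (1 + (Re z)^2 / 4)\<close>,
  a product of functions \<open>sin (b z) / (b z)\<close> with summable frequencies \<open>b\<close> decays on the real line like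
  the reciprocal of a canonical product with purely imaginary zeros, and it has small exponential type.
  Multiplied by \<open>sin (\<beta> z) / (\<pi> z)\<close> it becomes a kernel whose Fourier transform equals \<open>1\<close> on a given
  interval.

  \<^item> Fixed vectors have small type (\<open>P_op_in_exp_vectors\<close>). For a kernel of type \<open>\<kappa>\<close> that decays faster
  than \<open>\<parallel>U t\<parallel>\<close> grows, \<open>A^n (P_op U \<phi> x)\<close> is \<open>P_op U (\<i>^n \<phi>^(n)) x\<close>, and Cauchy's estimate on circles of
  radius about \<open>n / \<kappa>\<close> bounds its norm by a multiple of \<open>\<gamma>^n\<close> for every \<open>\<gamma> > \<kappa>\<close>.

  \<^item> Vectors of small type are fixed (\<open>P_op_fixes_exp_vectors\<close>). Applying a functional reduces this to
  \<open>\<integral> \<phi> f = f 0\<close> for scalar functions \<open>f\<close> of exponential type \<open>\<beta>\<close> and subexponential growth on the real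
  line (\<open>band_limited_reproducing\<close>). As \<open>f\<close> may grow, it is damped first. The Fourier transform of
  \<open>f t e^(-\<eta> |t|)\<close> is the jump across the imaginary axis of the Laplace transform of \<open>f\<close>, and for \<open>|s| > \<beta>\<close>
  that transform is the series \<open>\<Sum> f^(n) 0 / s^(n+1)\<close> on both sides of the axis. The jump is therefore
  \<open>O(\<eta>)\<close> outside \<open>[-\<beta>, \<beta>]\<close>, while \<open>fourier \<phi> = 1\<close> inside, so that Fourier inversion gives the formula
  as \<open>\<eta>\<close> tends to \<open>0\<close>.

  Together these present \<open>Xi D A \<alpha>\<close> as an intersection of fixed spaces of bounded operators, which is
  closed. This argument needs a kernel even when no majorant \<open>\<theta>\<close> is given; for this purpose the
  integrability of \<open>ln \<parallel>U t\<parallel> / (1 + t^2)\<close> and the subadditivity of \<open>ln \<parallel>U t\<parallel>\<close> yield a majorant of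
  \<open>\<parallel>U t\<parallel>\<close> in product form (\<open>w_le_product\<close>).
\<close>

section \<open>Functionals separating points\<close>

text \<open>
  A partial linear functional of norm at most one is encoded as its graph, a subspace of the product with
  the reals, so that Zorn's lemma can be applied to plain inclusion of sets. The bound makes such a subspace
  single-valued, as it contains \<open>(0, r)\<close> and \<open>(0, -r)\<close> together.
\<close>

definition norm_dominated_graph :: "('a::real_normed_vector \<times> real) set \<Rightarrow> bool"
  where "norm_dominated_graph G \<longleftrightarrow> subspace G \<and> (\<forall>(x, r)\<in>G. r \<le> norm x)"

text \<open>
  The one-dimensional step of the Hahn--Banach theorem. The value \<open>c\<close> at \<open>x0\<close> has to lie above all
  \<open>s - \<parallel>y - x0\<parallel>\<close> and below all \<open>\<parallel>z + x0\<parallel> - r\<close>; the triangle inequality orders these two families.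
\<close>

lemma norm_dominated_graph_extend:
  fixes x0 :: "'a::real_normed_vector"
  assumes G: "norm_dominated_graph G"
  shows "\<exists>c. norm_dominated_graph {(y + t *\<^sub>R x0, s + t * c) | y s t. (y, s) \<in> G}"
proof -
  have sub: "subspace G" and le: "\<And>x r. (x, r) \<in> G \<Longrightarrow> r \<le> norm x"
    using G by (auto simp: norm_dominated_graph_def)
  have zero: "(0, 0) \<in> G" using subspace_0[OF sub] by (simp add: zero_prod_def)
  have add: "(x + y, r + s) \<in> G" if "(x, r) \<in> G" "(y, s) \<in> G" for x y r s
    using subspace_add[OF sub that] by simp
  have scale: "(a *\<^sub>R x, a * r) \<in> G" if "(x, r) \<in> G" for a x r
    using subspace_scale[OF sub that, of a] by simp
  have key: "s - norm (y - x0) \<le> norm (z + x0) - r" if "(y, s) \<in> G" "(z, r) \<in> G" for y s z r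
  proof -
    have "s + r \<le> norm (y + z)" using le[OF add[OF that]] .
    also have "\<dots> \<le> norm (y - x0) + norm (z + x0)"
      using norm_triangle_ineq[of "y - x0" "z + x0"] by simp
    finally show ?thesis by simp
  qed
  define S where "S = {s - norm (y - x0) | y s. (y, s) \<in> G}"
  define c where "c = Sup S"
  have S_ne: "S \<noteq> {}" using zero by (auto simp: S_def)
  have bdd: "bdd_above S"
    using key[OF _ zero] by (intro bdd_aboveI[of _ "norm (0 + x0) - 0"]) (auto simp: S_def)
  have lower: "s - norm (y - x0) \<le> c" if "(y, s) \<in> G" for y s
    unfolding c_def by (rule cSup_upper[OF _ bdd]) (use that in \<open>auto simp: S_def\<close>)
  have upper: "c \<le> norm (z + x0) - r" if "(z, r) \<in> G" for z r
    unfolding c_def by (rule cSup_least[OF S_ne]) (use that key in \<open>auto simp: S_def\<close>)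
  have bound: "s + t * c \<le> norm (y + t *\<^sub>R x0)" if ys: "(y, s) \<in> G" for y s t
  proof -
    consider "t = 0" | "t > 0" | "t < 0" by linarith
    then show ?thesis
    proof cases
      case 1 then show ?thesis using le[OF ys] by simp
    next
      case 2
      have "c \<le> norm ((1/t) *\<^sub>R y + x0) - (1/t) * s" using upper[OF scale[OF ys]] .
      then have "t * c \<le> t * norm ((1/t) *\<^sub>R y + x0) - s"
        using 2 by (simp add: field_simps)
      also have "t * norm ((1/t) *\<^sub>R y + x0) = norm (t *\<^sub>R ((1/t) *\<^sub>R y + x0))"
        using 2 by simp
      also have "t *\<^sub>R ((1/t) *\<^sub>R y + x0) = y + t *\<^sub>R x0" using 2 by (simp add: scaleR_add_right)
      finally show ?thesis by simp
    next
      case 3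
      define u where "u = - t"
      have u: "u > 0" using 3 by (simp add: u_def)
      have "(1/u) * s - norm ((1/u) *\<^sub>R y - x0) \<le> c" using lower[OF scale[OF ys]] .
      then have "s - u * norm ((1/u) *\<^sub>R y - x0) \<le> u * c"
        using u by (simp add: field_simps)
      moreover have "u *\<^sub>R ((1/u) *\<^sub>R y - x0) = y + t *\<^sub>R x0" using u by (simp add: u_def scaleR_diff_right)
      then have "norm (y + t *\<^sub>R x0) = u * norm ((1/u) *\<^sub>R y - x0)"
        using u by (metis abs_of_pos norm_scaleR)
      moreover have "u * c = - (t * c)" by (simp add: u_def)
      ultimately show ?thesis by linarith
    qed
  qed
  have "subspace {(y + t *\<^sub>R x0, s + t * c) | y s t. (y, s) \<in> G}"
  proof (rule subspaceI)
    show "0 \<in> {(y + t *\<^sub>R x0, s + t * c) | y s t. (y, s) \<in> G}"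
      using zero by (force simp: zero_prod_def)
  next
    fix p q assume "p \<in> {(y + t *\<^sub>R x0, s + t * c) | y s t. (y, s) \<in> G}"
      "q \<in> {(y + t *\<^sub>R x0, s + t * c) | y s t. (y, s) \<in> G}"
    then obtain y s t y' s' t' where h: "(y, s) \<in> G" "(y', s') \<in> G"
      "p = (y + t *\<^sub>R x0, s + t * c)" "q = (y' + t' *\<^sub>R x0, s' + t' * c)" by blast
    have "p + q = ((y + y') + (t + t') *\<^sub>R x0, (s + s') + (t + t') * c)"
      by (simp add: h algebra_simps)
    then show "p + q \<in> {(y + t *\<^sub>R x0, s + t * c) | y s t. (y, s) \<in> G}"
      using add[OF h(1,2)] by blast
  next
    fix a p assume "p \<in> {(y + t *\<^sub>R x0, s + t * c) | y s t. (y, s) \<in> G}"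
    then obtain y s t where h: "(y, s) \<in> G" "p = (y + t *\<^sub>R x0, s + t * c)" by blast
    have "a *\<^sub>R p = (a *\<^sub>R y + (a * t) *\<^sub>R x0, a * s + (a * t) * c)"
      by (simp add: h algebra_simps)
    then show "a *\<^sub>R p \<in> {(y + t *\<^sub>R x0, s + t * c) | y s t. (y, s) \<in> G}"
      using scale[OF h(1)] by blast
  qed
  then show ?thesis using bound by (auto simp: norm_dominated_graph_def)
qed

lemma subspace_Union_chain:
  assumes "C \<noteq> {}" "\<And>G. G \<in> C \<Longrightarrow> subspace G" "subset.chain UNIV C"
  shows "subspace (\<Union>C)"
proof (rule subspaceI)
  show "0 \<in> \<Union>C" using assms(1,2) subspace_0 by blast
next
  fix x y assume "x \<in> \<Union>C" "y \<in> \<Union>C"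
  then obtain G H where h: "G \<in> C" "x \<in> G" "H \<in> C" "y \<in> H" by auto
  then have "G \<subseteq> H \<or> H \<subseteq> G" using assms(3) by (auto simp: subset_chain_def)
  then show "x + y \<in> \<Union>C" using h assms(2) subspace_add by (metis UnionI subsetD)
next
  fix c x assume "x \<in> \<Union>C"
  then show "c *\<^sub>R x \<in> \<Union>C" using assms(2) subspace_scale by blast
qed

text \<open>
  A maximal graph containing \<open>(v, \<parallel>v\<parallel>)\<close> is defined everywhere, as otherwise it could be extended.
\<close>

lemma separating_functional:
  fixes v :: "'a::real_normed_vector"
  assumes "v \<noteq> 0"
  shows "\<exists>l::'a \<Rightarrow> real. bounded_linear l \<and> l v \<noteq> 0"
proof -
  define \<A> where "\<A> = {G :: ('a \<times> real) set. norm_dominated_graph G \<and> (v, norm v) \<in> G}"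
  have "span {(v, norm v)} \<in> \<A>"
  proof -
    have "r \<le> norm x" if "(x, r) \<in> span {(v, norm v)}" for x r
      using that by (auto simp: span_singleton abs_mult intro!: mult_right_mono)
    then show ?thesis by (auto simp: \<A>_def norm_dominated_graph_def span_base)
  qed
  then have ne: "\<A> \<noteq> {}" by auto
  have chain: "\<Union>C \<in> \<A>" if "C \<noteq> {}" "subset.chain \<A> C" for C
  proof -
    have C: "C \<subseteq> \<A>" using that(2) by (simp add: subset_chain_def)
    have "subspace (\<Union>C)"
      using that C by (intro subspace_Union_chain) (auto simp: subset_chain_def \<A>_def norm_dominated_graph_def)
    then show ?thesis using that(1) C by (fastforce simp: \<A>_def norm_dominated_graph_def)
  qed
  obtain M where M: "M \<in> \<A>" "\<And>X. X \<in> \<A> \<Longrightarrow> M \<subseteq> X \<Longrightarrow> X = M"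
    using subset_Zorn_nonempty[OF ne chain] by blast
  have G: "norm_dominated_graph M" and vM: "(v, norm v) \<in> M" using M(1) by (auto simp: \<A>_def)
  have sub: "subspace M" and le: "\<And>x r. (x, r) \<in> M \<Longrightarrow> r \<le> norm x"
    using G by (auto simp: norm_dominated_graph_def)
  have zero: "(0, 0) \<in> M" using subspace_0[OF sub] by (simp add: zero_prod_def)
  have add: "(x + y, r + s) \<in> M" if "(x, r) \<in> M" "(y, s) \<in> M" for x y r s
    using subspace_add[OF sub that] by simp
  have scale: "(a *\<^sub>R x, a * r) \<in> M" if "(x, r) \<in> M" for a x r
    using subspace_scale[OF sub that, of a] by simp
  have ex: "\<exists>r. (x, r) \<in> M" for x
  proof -
    obtain c where c: "norm_dominated_graph {(y + t *\<^sub>R x, s + t * c) | y s t. (y, s) \<in> M}"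
      (is "norm_dominated_graph ?N")
      using norm_dominated_graph_extend[OF G] by blast
    have "M \<subseteq> ?N"
    proof (safe)
      fix y s assume "(y, s) \<in> M"
      then show "\<exists>y' s' t. (y, s) = (y' + t *\<^sub>R x, s' + t * c) \<and> (y', s') \<in> M"
        by (intro exI[of _ y] exI[of _ s] exI[of _ 0]) simp
    qed
    moreover have "?N \<in> \<A>" using c vM \<open>M \<subseteq> ?N\<close> unfolding \<A>_def by blast
    ultimately have "?N = M" using M(2) by blast
    moreover have "(0 + 1 *\<^sub>R x, 0 + 1 * c) \<in> ?N" using zero by blast
    ultimately show ?thesis by auto
  qed
  have uniq: "r = s" if "(x, r) \<in> M" "(x, s) \<in> M" for x r s
  proof -
    have "r' \<le> s'" if "(x, r') \<in> M" "(x, s') \<in> M" for r' s'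
      using le[OF add[OF that(1) scale[OF that(2), of "-1"]]] by simp
    from this[OF that] this[OF that(2,1)] show ?thesis by simp
  qed
  define l where "l x = (THE r. (x, r) \<in> M)" for x
  have l: "(x, l x) \<in> M" for x
    unfolding l_def using ex[of x] uniq by (metis theI)
  have l_eq: "l x = r" if "(x, r) \<in> M" for x r using uniq[OF l that] .
  have "bounded_linear l"
  proof (rule bounded_linear_intro[of _ 1])
    show "l (x + y) = l x + l y" for x y by (rule l_eq[OF add[OF l l]])
    show "l (a *\<^sub>R x) = a *\<^sub>R l x" for a x using l_eq[OF scale[OF l]] by simp
    show "norm (l x) \<le> norm x * 1" for x
      using le[OF l, of x] le[OF scale[OF l, of "-1"], of x] by simp
  qed
  moreover have "l v \<noteq> 0" using l_eq[OF vM] assms by simp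
  ultimately show ?thesis by blast
qed

lemma bounded_linear_scaleC: "bounded_linear (\<lambda>x::'a::complex_banach. c *\<^sub>C x)"
proof (rule bounded_linear_intro[of _ "cmod c"])
  show "c *\<^sub>C (r *\<^sub>R x) = r *\<^sub>R (c *\<^sub>C x)" for r and x :: 'a
    by (simp add: scaleR_scaleC scaleC_scaleC mult.commute)
qed (simp_all add: scaleC_add_right norm_scaleC mult.commute)

text \<open>
  The usual complexification \<open>l x - \<i> l (\<i> x)\<close> of a real functional.
\<close>

lemma separating_complex_functional:
  fixes v :: "'a::complex_banach"
  assumes "v \<noteq> 0"
  shows "\<exists>\<Lambda>::'a \<Rightarrow> complex. bounded_linear \<Lambda> \<and> (\<forall>c x. \<Lambda> (c *\<^sub>C x) = c * \<Lambda> x) \<and> \<Lambda> v \<noteq> 0"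
proof -
  obtain l :: "'a \<Rightarrow> real" where l: "bounded_linear l" "l v \<noteq> 0"
    using separating_functional[OF assms] by blast
  interpret l: bounded_linear l by (rule l(1))
  define \<Lambda> where "\<Lambda> x = complex_of_real (l x) - \<i> * complex_of_real (l (\<i> *\<^sub>C x))" for x
  have "bounded_linear \<Lambda>"
    unfolding \<Lambda>_def
    by (intro bounded_linear_sub bounded_linear_compose[OF bounded_linear_mult_right]
        bounded_linear_compose[OF bounded_linear_of_real] l(1)
        bounded_linear_compose[OF l(1) bounded_linear_scaleC])
  moreover have "\<Lambda> (c *\<^sub>C x) = c * \<Lambda> x" for c x
  proof -
    have c: "c = of_real (Re c) + \<i> * of_real (Im c)" by (simp add: complex_eq)
    have l_i: "l ((of_real r * c) *\<^sub>C x) = r * l (c *\<^sub>C x)" for r c x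
      using l.scaleR[of r "c *\<^sub>C x"] by (simp add: scaleR_scaleC scaleC_scaleC)
    have a: "l (c *\<^sub>C x) = Re c * l x + Im c * l (\<i> *\<^sub>C x)"
      using l_i[of "Re c" 1 x] l_i[of "Im c" \<i> x]
      by (subst c) (simp add: scaleC_add_left l.add scaleC_one mult.commute)
    have b: "l (\<i> *\<^sub>C (c *\<^sub>C x)) = Re c * l (\<i> *\<^sub>C x) - Im c * l x"
    proof -
      have "\<i> * c = of_real (Re c) * \<i> + of_real (- Im c) * 1" by (simp add: complex_eq_iff)
      then have "l (\<i> *\<^sub>C (c *\<^sub>C x)) = l ((of_real (Re c) * \<i>) *\<^sub>C x) + l ((of_real (- Im c) * 1) *\<^sub>C x)"
        by (simp only: scaleC_scaleC scaleC_add_left l.add)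
      then show ?thesis
        unfolding l_i by (simp add: scaleC_one)
    qed
    show ?thesis unfolding \<Lambda>_def a b by (simp add: complex_eq_iff)
  qed
  moreover have "\<Lambda> v \<noteq> 0" using l(2) by (simp add: \<Lambda>_def complex_eq_iff)
  ultimately show ?thesis by blast
qed

section \<open>Fourier inversion\<close>

lemma integrable_mult_unimodular:
  fixes p :: "real \<Rightarrow> complex"
  assumes "integrable lborel p"
  shows "integrable lborel (\<lambda>t. p t * iexp (c * t))"
  by (rule Bochner_Integration.integrable_bound[OF assms])
     (use borel_measurable_integrable[OF assms] in \<open>auto simp: norm_mult intro!: borel_measurable_times\<close>)

text \<open>
  Fubini's theorem for \<open>p t q l e^(\<i> s l t)\<close>. The parameter \<open>s\<close> covers both sign conventions of the
  Fourier transform.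
\<close>

lemma fourier_multiplication_formula:
  fixes p q :: "real \<Rightarrow> complex"
  assumes p: "integrable lborel p" and q: "integrable lborel q"
  shows "(LBINT t. p t * (LBINT l. q l * iexp (s * l * t)))
       = (LBINT l. q l * (LBINT t. p t * iexp (s * l * t)))"
proof -
  have [measurable]: "p \<in> borel_measurable lborel" "q \<in> borel_measurable lborel"
    using p q by auto
  have int: "integrable (lborel \<Otimes>\<^sub>M lborel) (\<lambda>(t, l). p t * q l * iexp (s * l * t))"
  proof (rule lborel_pair.Fubini_integrable)
    show "(\<lambda>(t, l). p t * q l * iexp (s * l * t)) \<in> borel_measurable (lborel \<Otimes>\<^sub>M lborel)"
      by measurable
    show "integrable lborel (\<lambda>x. LBINT y. norm (case (x, y) of (t, l) \<Rightarrow> p t * q l * iexp (s * l * t)))"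
      using p q by (simp add: norm_mult)
    show "AE x in lborel. integrable lborel (\<lambda>y. case (x, y) of (t, l) \<Rightarrow> p t * q l * iexp (s * l * t))"
    proof (rule AE_I2)
      fix x
      have "integrable lborel (\<lambda>l. p x * (q l * iexp (s * x * l)))"
        by (intro integrable_mult_right integrable_mult_unimodular q)
      then show "integrable lborel (\<lambda>y. case (x, y) of (t, l) \<Rightarrow> p t * q l * iexp (s * l * t))"
        by (simp add: mult.assoc mult.commute[of x])
    qed
  qed
  have "(LBINT t. p t * (LBINT l. q l * iexp (s * l * t)))
      = (LBINT t. LBINT l. p t * q l * iexp (s * l * t))"
    by (simp add: mult.assoc)
  also have "\<dots> = (LBINT l. LBINT t. p t * q l * iexp (s * l * t))"
    by (rule lborel_pair.Fubini_integral[symmetric]) (use int in simp)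
  also have "\<dots> = (LBINT l. q l * (LBINT t. p t * iexp (s * l * t)))"
  proof (intro Bochner_Integration.integral_cong refl)
    fix l
    have "(LBINT t. p t * q l * iexp (s * l * t)) = (LBINT t. q l * (p t * iexp (s * l * t)))"
      by (intro Bochner_Integration.integral_cong) auto
    then show "(LBINT t. p t * q l * iexp (s * l * t)) = q l * (LBINT t. p t * iexp (s * l * t))"
      by simp
  qed
  finally show ?thesis .
qed

lemma gaussian_fourier_transform:
  "(LBINT x. complex_of_real (std_normal_density x) * iexp (t * x)) = complex_of_real (exp (- t\<^sup>2 / 2))"
proof -
  have "(LBINT x. complex_of_real (std_normal_density x) * iexp (t * x)) = char std_normal_distribution t"
    unfolding char_def by (subst integral_density) (auto simp: scaleR_conv_of_real)
  then show ?thesis by (simp add: char_std_normal_distribution)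
qed

text \<open>
  The integral of \<open>K\<close> is the limit of its integrals against wide Gaussians, and by the multiplication
  formula these are averages of \<open>k\<close> against narrow Gaussians centred at \<open>0\<close>.
\<close>

lemma fourier_inversion_at_zero:
  fixes k :: "real \<Rightarrow> complex"
  assumes k: "integrable lborel k" and cont: "continuous_on UNIV k" and bound: "\<And>t. cmod (k t) \<le> B"
  defines "K \<equiv> \<lambda>l. LBINT t. k t * iexp (- l * t)"
  assumes K: "integrable lborel K"
  shows "(LBINT l. K l) = complex_of_real (2 * pi) * k 0"
proof -
  define G where "G d l = complex_of_real (exp (- (d * l)\<^sup>2 / 2))" for d l :: real
  define N where "N x = complex_of_real (std_normal_density x)" for x
  have N_int: "integrable lborel N"
    unfolding N_def using integrable_normal_density[of 1 0] by simp
  have N_1: "(LBINT x. N x) = 1"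
    using gaussian_fourier_transform[of 0] by (simp add: N_def)
  have G_N: "G d l = complex_of_real (sqrt (2 * pi)) * N (d * l)" for d l
    by (simp add: G_def N_def std_normal_density_def)
  have G_int: "integrable lborel (G d)" if "d > 0" for d
    unfolding G_N using lborel_integrable_real_affine[OF N_int, of d 0] that by simp
  have G_hat: "(LBINT l. G d l * iexp (- 1 * l * t)) = complex_of_real (2 * pi / d) * N (t / d)"
    if "d > 0" for d t
  proof -
    have "(LBINT l. N l * iexp ((-t/d) * l))
        = \<bar>d\<bar> *\<^sub>R (LBINT l. N (0 + d * l) * iexp ((-t/d) * (0 + d * l)))"
      by (rule lborel_integral_real_affine) (use that in simp)
    also have "(LBINT l. N (0 + d * l) * iexp ((-t/d) * (0 + d * l))) = (LBINT l. N (d * l) * iexp (- 1 * l * t))"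
      using that by (intro Bochner_Integration.integral_cong) (auto simp: mult.commute)
    finally have 1: "(LBINT l. N (d * l) * iexp (- 1 * l * t)) = complex_of_real (1/d) * complex_of_real (exp (- (-t/d)\<^sup>2 / 2))"
      using that gaussian_fourier_transform[of "-t/d"] by (simp add: N_def scaleR_conv_of_real field_simps)
    have s: "complex_of_real (sqrt (2*pi)) * complex_of_real (sqrt (2*pi)) = complex_of_real (2 * pi)"
      by (simp flip: of_real_mult)
    have "(LBINT l. G d l * iexp (- 1 * l * t)) = complex_of_real (sqrt (2 * pi)) * (LBINT l. N (d * l) * iexp (- 1 * l * t))"
      unfolding G_N mult.assoc by simp
    also have "\<dots> = complex_of_real (1/d) * (complex_of_real (sqrt (2 * pi)) * G 1 (t/d))"
      unfolding 1 G_def by (simp add: mult_ac)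
    also have "\<dots> = complex_of_real (1/d) * (complex_of_real (2*pi) * N (t/d))"
      unfolding G_N mult.assoc[symmetric] s by simp
    finally show ?thesis by simp
  qed
  \<comment> \<open>The Gaussian \<open>G (d n)\<close> has width \<open>1 / d n\<close>; its transform has width \<open>d n\<close>.\<close>
  define d where "d n = 1 / real (Suc n)" for n
  have d: "d n > 0" for n by (simp add: d_def)
  have d_lim: "d \<longlonglongrightarrow> 0" unfolding d_def using LIMSEQ_inverse_real_of_nat by (simp add: inverse_eq_divide)
  have eq: "(LBINT l. G (d n) l * K l) = complex_of_real (2 * pi) * (LBINT u. k (d n * u) * N u)" for n
  proof -
    have "(LBINT l. G (d n) l * K l) = (LBINT t. k t * (LBINT l. G (d n) l * iexp (- 1 * l * t)))"
      unfolding fourier_multiplication_formula[OF k G_int[OF d]] by (simp add: K_def)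
    also have "\<dots> = (LBINT t. k t * (complex_of_real (2 * pi / d n) * N (t / d n)))"
      using G_hat[OF d] by simp
    also have "\<dots> = \<bar>d n\<bar> *\<^sub>R (LBINT u. k (0 + d n * u) * (complex_of_real (2 * pi / d n) * N ((0 + d n * u) / d n)))"
      by (rule lborel_integral_real_affine) (use d[of n] in simp)
    also have "\<dots> = (LBINT u. complex_of_real (2 * pi) * (k (d n * u) * N u))"
      unfolding integral_scaleR_right[symmetric]
      using d[of n] by (intro Bochner_Integration.integral_cong) (auto simp: scaleR_conv_of_real field_simps)
    finally show ?thesis by simp
  qed
  have [measurable]: "k \<in> borel_measurable borel" "K \<in> borel_measurable borel" "N \<in> borel_measurable borel"
    using k K N_int by auto
  have lim1: "(\<lambda>n. LBINT l. G (d n) l * K l) \<longlonglongrightarrow> (LBINT l. K l)"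
  proof (rule integral_dominated_convergence[where w="\<lambda>l. norm (K l)"])
    show "AE l in lborel. (\<lambda>n. G (d n) l * K l) \<longlonglongrightarrow> K l"
    proof (rule AE_I2)
      fix l
      have "(\<lambda>n. G (d n) l * K l) \<longlonglongrightarrow> complex_of_real (exp (- (0 * l)\<^sup>2 / 2)) * K l"
        unfolding G_def by (intro tendsto_intros d_lim) auto
      then show "(\<lambda>n. G (d n) l * K l) \<longlonglongrightarrow> K l" by simp
    qed
    show "AE l in lborel. norm (G (d n) l * K l) \<le> norm (K l)" for n
      by (rule AE_I2) (auto simp: G_def norm_mult intro!: mult_left_le_one_le)
  qed (use K in \<open>auto simp: G_def\<close>)
  have lim2: "(\<lambda>n. LBINT u. k (d n * u) * N u) \<longlonglongrightarrow> (LBINT u. k 0 * N u)"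
  proof (rule integral_dominated_convergence[where w="\<lambda>u. B * norm (N u)"])
    show "AE u in lborel. (\<lambda>n. k (d n * u) * N u) \<longlonglongrightarrow> k 0 * N u"
    proof (rule AE_I2)
      fix u
      have "(\<lambda>n. d n * u) \<longlonglongrightarrow> 0 * u" by (intro tendsto_intros d_lim)
      then have "(\<lambda>n. k (d n * u)) \<longlonglongrightarrow> k 0"
        by (intro continuous_on_tendsto_compose[OF cont]) auto
      then show "(\<lambda>n. k (d n * u) * N u) \<longlonglongrightarrow> k 0 * N u" by (intro tendsto_intros)
    qed
    show "AE u in lborel. norm (k (d n * u) * N u) \<le> B * norm (N u)" for n
      by (rule AE_I2) (auto simp: norm_mult intro!: mult_right_mono bound)
  qed (use N_int in auto)
  have "(\<lambda>n. LBINT l. G (d n) l * K l) \<longlonglongrightarrow> complex_of_real (2 * pi) * (LBINT u. k 0 * N u)"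
    unfolding eq by (intro tendsto_intros lim2)
  then have "(LBINT l. K l) = complex_of_real (2 * pi) * (LBINT u. k 0 * N u)"
    using LIMSEQ_unique[OF lim1] by blast
  then show ?thesis using N_1 by simp
qed

section \<open>Entire functions of small type with prescribed decay on the real line\<close>

definition csinc :: "complex \<Rightarrow> complex"
  where "csinc z = (if z = 0 then 1 else sin z / z)"

text \<open>
  This makes \<open>csinc\<close> continuous at the removable singularity and lets products of \<open>csinc (b k z)\<close> converge
  when the \<open>b k\<close> are summable.
\<close>

lemma norm_csinc_minus_1: "cmod (csinc z - 1) \<le> exp \<bar>Im z\<bar> * cmod z"
proof (cases "z = 0")
  case False
  have "cmod (sin z - z) \<le> exp \<bar>Im z\<bar> * cmod z ^ 2"
    using Taylor_sin[of z 1] by (simp add: sin_coeff_def numeral_2_eq_2)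
  moreover have "csinc z - 1 = (sin z - z) / z" using False by (simp add: csinc_def field_simps)
  ultimately show ?thesis
    using False by (simp add: norm_divide divide_le_eq power2_eq_square mult.assoc)
qed (simp add: csinc_def)

lemma holomorphic_csinc [holomorphic_intros]:
  assumes "f holomorphic_on A"
  shows "(\<lambda>z. csinc (f z)) holomorphic_on A"
proof -
  have hol: "csinc holomorphic_on (UNIV - {0})"
    by (rule holomorphic_transform[of "\<lambda>z. sin z / z"])
       (auto simp: csinc_def intro!: holomorphic_intros)
  have "isCont csinc z" for z
  proof (cases "z = 0")
    case True
    have "(csinc \<longlongrightarrow> 1) (at 0)"
    proof -
      have "((\<lambda>z::complex. exp \<bar>Im z\<bar> * cmod z) \<longlongrightarrow> exp \<bar>Im 0\<bar> * cmod 0) (at 0)"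
        by (intro tendsto_intros)
      then have "((\<lambda>z. exp \<bar>Im z\<bar> * cmod z) \<longlongrightarrow> 0) (at 0)" by simp
      then have "((\<lambda>z. csinc z - 1) \<longlongrightarrow> 0) (at 0)"
        by (rule Lim_null_comparison[rotated]) (simp add: norm_csinc_minus_1)
      then show ?thesis by (rule LIM_zero_cancel)
    qed
    then show ?thesis by (simp add: True isCont_def csinc_def)
  next
    case False
    have "csinc field_differentiable (at z)"
      by (rule holomorphic_on_imp_differentiable_at[OF hol]) (use False in auto)
    then show ?thesis by (rule field_differentiable_imp_continuous_at)
  qed
  then have "continuous_on UNIV csinc" by (simp add: continuous_on_eq_continuous_at)
  then have "csinc holomorphic_on UNIV"
    by (rule no_isolated_singularity[OF _ hol]) auto
  then show ?thesis
    using holomorphic_on_compose_gen[OF assms, of csinc UNIV] by (simp add: o_def)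
qed

text \<open>
  For small \<open>x\<close> the half-angle formula gives \<open>(sin x)^2 \<le> x^2 (1 - x^2 / 4)\<close>; for large \<open>x\<close> the trivial
  bound \<open>1\<close> suffices.
\<close>

lemma sin_squared_le: "(sin x)\<^sup>2 * (1 + x\<^sup>2 / 4) \<le> (x::real)\<^sup>2"
proof (cases "x\<^sup>2 \<le> 2")
  case True
  define s where "s = (sin (x / 2))\<^sup>2"
  have s0: "0 \<le> s" by (simp add: s_def)
  have "s \<le> (x / 2)\<^sup>2" unfolding s_def using abs_sin_x_le_abs_x[of "x/2"]
    by (simp add: abs_le_square_iff[symmetric])
  then have s: "s \<le> x\<^sup>2 / 4" by (simp add: power_divide)
  have "sin x = 2 * sin (x / 2) * cos (x / 2)" using sin_double[of "x/2"] by simp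
  then have "(sin x)\<^sup>2 = 4 * s * (1 - s)"
    by (simp add: s_def power_mult_distrib cos_squared_eq)
  moreover have "0 \<le> (x\<^sup>2 / 4 - s) * (1 - x\<^sup>2 / 4 - s)"
    using s True by (intro mult_nonneg_nonneg) auto
  then have "s * (1 - s) \<le> x\<^sup>2 / 4 * (1 - x\<^sup>2 / 4)" by (simp add: algebra_simps)
  ultimately have "(sin x)\<^sup>2 \<le> x\<^sup>2 * (1 - x\<^sup>2 / 4)" by simp
  then have "(sin x)\<^sup>2 * (1 + x\<^sup>2 / 4) \<le> x\<^sup>2 * (1 - x\<^sup>2 / 4) * (1 + x\<^sup>2 / 4)"
    by (rule mult_right_mono) simp
  also have "\<dots> = x\<^sup>2 * (1 - (x\<^sup>2 / 4)\<^sup>2)" by (simp add: power2_eq_square algebra_simps)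
  also have "\<dots> \<le> x\<^sup>2 * 1" by (intro mult_left_mono) auto
  finally show ?thesis by simp
next
  case False
  have "(sin x)\<^sup>2 * (1 + x\<^sup>2 / 4) \<le> 1 * (1 + x\<^sup>2 / 4)"
    by (intro mult_right_mono) (auto simp: sin_squared_eq)
  also have "\<dots> \<le> x\<^sup>2" using False by simp
  finally show ?thesis .
qed

text \<open>
  The estimate on which all kernels rest: one factor \<open>csinc\<close> pays for one factor \<open>sqrt (1 + x^2 / 4)\<close> of a
  product majorant, at the price of exponential type \<open>1\<close> and with constant exactly \<open>1\<close>, so that
  infinitely many factors can be multiplied. It follows from \<open>|sin z|^2 = (sin x)^2 + (sinh y)^2\<close>, where
  \<open>(sinh y)^2\<close> is at most \<open>(e^(2|y|) - 1) / 2\<close> and at most \<open>y^2 e^(2|y|)\<close>.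
\<close>

lemma csinc_decay: "cmod (csinc z) * sqrt (1 + (Re z)\<^sup>2 / 4) \<le> exp \<bar>Im z\<bar>"
proof (cases "z = 0")
  case False
  define x where "x = Re z"
  define y where "y = \<bar>Im z\<bar>"
  define E where "E = exp (2 * y)"
  define S where "S = (E + inverse E - 2) / 4"
  have y: "y \<ge> 0" by (simp add: y_def)
  have E1: "E \<ge> 1" using y by (simp add: E_def)
  have iE: "inverse E \<le> 1" "inverse E > 0" using E1 by (auto simp: field_simps)
  have "exp (2 * Im z) + inverse (exp (2 * Im z)) = E + inverse E"
    by (cases "Im z \<ge> 0") (auto simp: E_def y_def exp_minus)
  moreover have "cos (2 * x) = 1 - 2 * (sin x)\<^sup>2" by (rule cos_double_sin)
  ultimately have "(cmod (sin z))\<^sup>2 = (E + inverse E - 2 * (1 - 2 * (sin x)\<^sup>2)) / 4"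
    unfolding norm_sin_squared x_def by (simp only:)
  then have sin: "(cmod (sin z))\<^sup>2 = (sin x)\<^sup>2 + S"
    unfolding S_def by argo
  have S1: "S \<le> (E - 1) / 2" using iE E1 by (simp add: S_def)
  have S2: "S \<le> y\<^sup>2 * E"
  proof -
    have "1 + (- (2 * y)) \<le> exp (- (2 * y))" by (rule exp_ge_add_one_self)
    then have "1 - inverse E \<le> 2 * y" by (simp add: E_def exp_minus)
    then have "(1 - inverse E)\<^sup>2 \<le> (2 * y)\<^sup>2" using iE by (intro power_mono) auto
    then have "E * (1 - inverse E)\<^sup>2 \<le> E * (2 * y)\<^sup>2" using E1 by (intro mult_left_mono) auto
    moreover have "E * (1 - inverse E)\<^sup>2 = E + inverse E - 2"
      using E1 by (simp add: power2_eq_square field_simps)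
    ultimately show ?thesis by (simp add: S_def power_mult_distrib mult.commute)
  qed
  have "(cmod (sin z))\<^sup>2 * (1 + x\<^sup>2 / 4) = (sin x)\<^sup>2 * (1 + x\<^sup>2 / 4) + S + x\<^sup>2 / 4 * S"
    unfolding sin by (simp add: algebra_simps)
  also have "\<dots> \<le> x\<^sup>2 + y\<^sup>2 * E + x\<^sup>2 / 4 * ((E - 1) / 2)"
    by (intro add_mono sin_squared_le S2 mult_left_mono S1) auto
  also have "\<dots> \<le> x\<^sup>2 + y\<^sup>2 * E + x\<^sup>2 * (E - 1)"
  proof -
    have "x\<^sup>2 / 4 * ((E - 1) / 2) \<le> x\<^sup>2 * (E - 1)"
      using mult_nonneg_nonneg[of "x\<^sup>2" "E - 1"] E1 by simp
    then show ?thesis by simp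
  qed
  also have "\<dots> = (cmod z)\<^sup>2 * E" by (simp add: cmod_power2 x_def y_def algebra_simps)
  finally have main: "(cmod (sin z))\<^sup>2 * (1 + x\<^sup>2 / 4) \<le> (cmod z)\<^sup>2 * E" .
  have "(cmod (csinc z) * sqrt (1 + x\<^sup>2 / 4))\<^sup>2 = (cmod (sin z))\<^sup>2 * (1 + x\<^sup>2 / 4) / (cmod z)\<^sup>2"
    using False by (simp add: csinc_def norm_divide power_mult_distrib power_divide)
  also have "\<dots> \<le> E" using main False by (simp add: divide_le_eq mult.commute)
  also have "E = (exp y)\<^sup>2" by (simp add: E_def power2_eq_square flip: exp_add)
  finally show ?thesis
    unfolding x_def[symmetric] y_def[symmetric] by (rule power2_le_imp_le) simp
qed (simp add: csinc_def)

lemma norm_csinc_le: "cmod (csinc z) \<le> exp \<bar>Im z\<bar>"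
proof -
  have "cmod (csinc z) * 1 \<le> cmod (csinc z) * sqrt (1 + (Re z)\<^sup>2 / 4)"
    by (intro mult_left_mono) auto
  then show ?thesis using csinc_decay[of z] by simp
qed

lemma csinc_product_entire:
  fixes b :: "nat \<Rightarrow> real"
  assumes b: "\<And>k. 0 < b k" and sum: "summable b"
  obtains g where "g holomorphic_on UNIV" "g 0 = 1"
    "\<And>z. (\<lambda>N. \<Prod>k<N. csinc (of_real (b k) * z)) \<longlonglongrightarrow> g z"
proof -
  define p where "p N z = (\<Prod>k<N. csinc (of_real (b k) * z))" for N z
  define g where "g z = lim (\<lambda>N. p N z)" for z
  have ul: "uniform_limit (cball 0 R) p g sequentially" if R: "R \<ge> 0" for R
  proof -
    define M where "M = exp (suminf b * R) * R"
    have "uniformly_convergent_on (cball 0 R) p"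
      unfolding p_def[abs_def]
    proof (rule uniformly_convergent_on_prod')
      show "continuous_on (cball 0 R) (\<lambda>z. csinc (of_real (b n) * z))" for n
        by (intro holomorphic_on_imp_continuous_on holomorphic_intros)
      show "compact (cball 0 R :: complex set)" by simp
      show "uniformly_convergent_on (cball 0 R) (\<lambda>N z. \<Sum>n<N. norm (csinc (of_real (b n) * z) - 1))"
      proof (rule Weierstrass_m_test')
        show "summable (\<lambda>n. M * b n)" using sum by (rule summable_mult)
        show "norm (norm (csinc (of_real (b n) * z) - 1)) \<le> M * b n" if "z \<in> cball 0 R" for n z
        proof -
          have z: "cmod z \<le> R" using that by simp
          have bn: "b n \<le> suminf b"
            using sum_le_suminf[OF sum, of "{n}"] b by (simp add: less_imp_le)
          have "\<bar>b n * Im z\<bar> \<le> b n * R" using b[of n] z abs_Im_le_cmod[of z] by (simp add: abs_mult)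
          also have "\<dots> \<le> suminf b * R" using bn R by (rule mult_right_mono)
          finally have 1: "exp \<bar>Im (of_real (b n) * z)\<bar> \<le> exp (suminf b * R)" by simp
          have 2: "cmod (of_real (b n) * z) \<le> b n * R" using b[of n] z by (simp add: norm_mult)
          have "cmod (csinc (of_real (b n) * z) - 1) \<le> exp (suminf b * R) * (b n * R)"
            by (rule order_trans[OF norm_csinc_minus_1 mult_mono[OF 1 2]]) auto
          then show ?thesis by (simp add: M_def mult_ac)
        qed
      qed
    qed
    then show ?thesis unfolding g_def[abs_def] by (simp add: uniformly_convergent_uniform_limit_iff)
  qed
  have lim: "(\<lambda>N. p N z) \<longlonglongrightarrow> g z" for z
    by (rule tendsto_uniform_limitI[OF ul[of "cmod z"]]) auto
  have "g holomorphic_on UNIV"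
  proof (rule holomorphic_uniform_sequence)
    show "p n holomorphic_on UNIV" for n
      unfolding p_def[abs_def] by (intro holomorphic_intros)
    show "\<exists>d. 0 < d \<and> cball z d \<subseteq> UNIV \<and> uniform_limit (cball z d) p g sequentially" for z
    proof (intro exI[of _ 1] conjI)
      have "cball z 1 \<subseteq> cball 0 (cmod z + 1)"
        by (simp add: subset_iff dist_norm) (metis add.commute add_le_cancel_right norm_minus_commute norm_triangle_sub order_trans)
      then show "uniform_limit (cball z 1) p g sequentially"
        using ul[of "cmod z + 1"] uniform_limit_on_subset by fastforce
    qed auto
  qed auto
  moreover have "g 0 = 1"
  proof -
    have "p N 0 = 1" for N by (simp add: p_def csinc_def)
    then show ?thesis using LIMSEQ_unique[OF lim[of 0]] by simp
  qed
  ultimately show ?thesis using that[of g] lim by (simp add: p_def)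
qed

text \<open>
  Take for \<open>c k\<close> the reciprocal square root of the \<open>k\<close>-th tail: the products \<open>c k * a k\<close> are then bounded by
  twice the differences of the square roots of consecutive tails, which telescope.
\<close>

lemma summable_divide_sqrt_tail:
  fixes a :: "nat \<Rightarrow> real"
  assumes a: "\<And>k. 0 < a k" and sum: "summable a"
  shows "\<exists>c. (\<forall>k. 0 < c k) \<and> filterlim c at_top sequentially \<and> summable (\<lambda>k. c k * a k)"
proof -
  define r where "r k = suminf a - (\<Sum>j<k. a j)" for k
  have r_pos: "r k > 0" for k
    using sum_less_suminf[OF sum, of k] a by (simp add: r_def)
  have r_Suc: "r (Suc k) = r k - a k" for k by (simp add: r_def)
  have "r \<longlonglongrightarrow> suminf a - suminf a"
    unfolding r_def by (intro tendsto_intros summable_LIMSEQ sum)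
  then have r_lim: "r \<longlonglongrightarrow> 0" by simp
  then have sr_lim: "(\<lambda>k. sqrt (r k)) \<longlonglongrightarrow> 0" using tendsto_real_sqrt by fastforce
  define c where "c k = 1 / sqrt (r k)" for k
  have "filterlim (\<lambda>k. inverse (sqrt (r k))) at_top sequentially"
    by (rule filterlim_inverse_at_top[OF sr_lim]) (simp add: r_pos)
  then have "filterlim c at_top sequentially" by (simp add: c_def[abs_def] inverse_eq_divide)
  moreover have "summable (\<lambda>k. c k * a k)"
  proof (rule summable_comparison_test')
    have "summable (\<lambda>k. sqrt (r k) - sqrt (r (Suc k)))" by (rule telescope_summable'[OF sr_lim])
    then show "summable (\<lambda>k. 2 * (sqrt (r k) - sqrt (r (Suc k))))" by (rule summable_mult)
    show "norm (c k * a k) \<le> 2 * (sqrt (r k) - sqrt (r (Suc k)))" for k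
    proof -
      define u v where "u = sqrt (r k)" and "v = sqrt (r (Suc k))"
      have uv: "0 < u" "0 < v" "v \<le> u" using r_pos[of k] a[of k] r_pos[of "Suc k"] by (auto simp: u_def v_def r_Suc less_imp_le)
      have "a k = u\<^sup>2 - v\<^sup>2" using r_pos[of k] r_pos[of "Suc k"] by (simp add: u_def v_def r_Suc)
      also have "\<dots> = (u + v) * (u - v)" by (simp add: power2_eq_square algebra_simps)
      also have "\<dots> \<le> (2 * u) * (u - v)" using uv by (intro mult_right_mono) auto
      finally have "a k / u \<le> 2 * (u - v)" using uv by (simp add: divide_le_eq mult_ac)
      then show ?thesis using a[of k] uv(1) by (simp add: c_def u_def v_def)
    qed
  qed
  ultimately show ?thesis using r_pos by (intro exI[of _ c]) (auto simp: c_def)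
qed

text \<open>
  The parameters \<open>a k\<close> are the reciprocals of the moduli of the zeros of a canonical product. Finite partial products
  are used so that no infinite product has to be evaluated.
\<close>

definition beats_product :: "(nat \<Rightarrow> real) \<Rightarrow> real \<Rightarrow> (complex \<Rightarrow> complex) \<Rightarrow> bool"
  where "beats_product a \<kappa> g \<longleftrightarrow> (\<forall>s>0. \<forall>m. \<exists>C\<ge>0. \<forall>z N.
    (1 + (Re z)\<^sup>2) ^ m * (\<Prod>k<N. sqrt (1 + (s * a k * Re z)\<^sup>2)) * cmod (g z) \<le> C * exp (\<kappa> * \<bar>Im z\<bar>))"

lemma beats_productE:
  assumes "beats_product a \<kappa> g" "s > 0"
  obtains C where "C \<ge> 0"
    "\<And>z N. (1 + (Re z)\<^sup>2) ^ m * (\<Prod>k<N. sqrt (1 + (s * a k * Re z)\<^sup>2)) * cmod (g z) \<le> C * exp (\<kappa> * \<bar>Im z\<bar>)"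
  using assms unfolding beats_product_def by blast

text \<open>
  The frequencies \<open>b k = c k * a k\<close> with \<open>c k\<close> tending to infinity make one function \<open>g\<close> work for all scales
  \<open>s\<close>: eventually \<open>s * a k \<le> b k / 2\<close>, and the finitely many remaining factors only cost a power of
  \<open>1 + x^2\<close>. Any such power is absorbed by finitely many further factors. The function \<open>g\<close> is the square
  of the product, one copy for the product majorant and one copy for the powers.
\<close>

lemma entire_function_small_against_product:
  fixes a :: "nat \<Rightarrow> real"
  assumes a: "\<And>k. 0 < a k" and sum: "summable a"
  shows "\<exists>g \<sigma>. g holomorphic_on UNIV \<and> g 0 = 1 \<and> \<sigma> > 0 \<and> beats_product a \<sigma> g"
proof -
  obtain c where c: "\<And>k. 0 < c k" "filterlim c at_top sequentially" "summable (\<lambda>k. c k * a k)"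
    using summable_divide_sqrt_tail[OF a sum] by blast
  define b where "b k = c k * a k" for k
  have b: "0 < b k" for k using c(1) a by (simp add: b_def)
  have b_sum: "summable b" using c(3) by (simp add: b_def[abs_def])
  define \<sigma> where "\<sigma> = suminf b"
  have \<sigma>: "\<sigma> > 0" unfolding \<sigma>_def using suminf_pos[OF b_sum] b by blast
  obtain h where h: "h holomorphic_on UNIV" "h 0 = 1"
    and h_lim: "\<And>z. (\<lambda>N. \<Prod>k<N. csinc (of_real (b k) * z)) \<longlonglongrightarrow> h z"
    using csinc_product_entire[OF b b_sum] by blast
  define Q where "Q N x = (\<Prod>k<N. sqrt (1 + (b k * x)\<^sup>2 / 4))" for N and x :: real
  have Q_pos: "Q N x > 0" for N x unfolding Q_def by (intro prod_pos) (auto intro: add_pos_nonneg)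
  have base: "Q N (Re z) * cmod (h z) \<le> exp (\<sigma> * \<bar>Im z\<bar>)" for N z
  proof (rule LIMSEQ_le_const2)
    show "(\<lambda>M. Q N (Re z) * cmod (\<Prod>k<M. csinc (of_real (b k) * z))) \<longlonglongrightarrow> Q N (Re z) * cmod (h z)"
      by (intro tendsto_intros h_lim)
    \<comment> \<open>The first \<open>N\<close> factors use the decay of \<open>csinc\<close>, the others only its exponential type.\<close>
    show "\<exists>M0. \<forall>M\<ge>M0. Q N (Re z) * cmod (\<Prod>k<M. csinc (of_real (b k) * z)) \<le> exp (\<sigma> * \<bar>Im z\<bar>)"
    proof (intro exI[of _ N] allI impI)
      fix M assume M: "N \<le> M"
      define u where "u k = (if k < N then sqrt (1 + (b k * Re z)\<^sup>2 / 4) else 1)" for k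
      have "Q N (Re z) = (\<Prod>k<M. u k)"
        unfolding Q_def u_def using M
        by (subst prod.If_cases) (auto intro!: prod.cong)
      then have "Q N (Re z) * cmod (\<Prod>k<M. csinc (of_real (b k) * z)) = (\<Prod>k<M. u k * cmod (csinc (of_real (b k) * z)))"
        by (simp add: prod.distrib prod_norm)
      also have "\<dots> \<le> (\<Prod>k<M. exp (b k * \<bar>Im z\<bar>))"
      proof (intro prod_mono conjI)
        fix k
        show "0 \<le> u k * cmod (csinc (of_real (b k) * z))" by (simp add: u_def)
        show "u k * cmod (csinc (of_real (b k) * z)) \<le> exp (b k * \<bar>Im z\<bar>)"
          using csinc_decay[of "of_real (b k) * z"] norm_csinc_le[of "of_real (b k) * z"] b[of k]
          by (auto simp: u_def abs_mult mult.commute)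
      qed
      also have "\<dots> = exp ((\<Sum>k<M. b k) * \<bar>Im z\<bar>)" by (simp add: exp_sum sum_distrib_right)
      also have "\<dots> \<le> exp (\<sigma> * \<bar>Im z\<bar>)"
        unfolding \<sigma>_def exp_le_cancel_iff
        by (intro mult_right_mono sum_le_suminf b_sum) (auto simp: less_imp_le b)
      finally show "Q N (Re z) * cmod (\<Prod>k<M. csinc (of_real (b k) * z)) \<le> exp (\<sigma> * \<bar>Im z\<bar>)" .
    qed
  qed
  have poly: "\<exists>C\<ge>0. \<forall>z. (1 + (Re z)\<^sup>2) ^ m * cmod (h z) \<le> C * exp (\<sigma> * \<bar>Im z\<bar>)" for m
  proof -
    define q where "q k = min 1 (b k / 2)" for k
    have q: "q k > 0" for k using b[of k] by (simp add: q_def)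
    define C where "C = 1 / (\<Prod>k<2*m. q k)"
    have qp: "(\<Prod>k<2*m. q k) > 0" using q by (intro prod_pos) auto
    have "(1 + (Re z)\<^sup>2) ^ m * cmod (h z) \<le> C * exp (\<sigma> * \<bar>Im z\<bar>)" for z
    proof -
      have "q k * sqrt (1 + (Re z)\<^sup>2) \<le> sqrt (1 + (b k * Re z)\<^sup>2 / 4)" for k
      proof -
        have "(q k)\<^sup>2 \<le> 1" using q[of k] by (intro power_le_one) (auto simp: q_def)
        moreover have "(q k)\<^sup>2 \<le> (b k / 2)\<^sup>2" using q[of k] by (intro power_mono) (auto simp: q_def)
        then have "(q k)\<^sup>2 * (Re z)\<^sup>2 \<le> (b k / 2)\<^sup>2 * (Re z)\<^sup>2" by (intro mult_right_mono) auto
        ultimately have "(q k)\<^sup>2 * (1 + (Re z)\<^sup>2) \<le> 1 + (b k * Re z)\<^sup>2 / 4"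
          by (simp add: algebra_simps power_mult_distrib power_divide)
        then have "sqrt ((q k)\<^sup>2 * (1 + (Re z)\<^sup>2)) \<le> sqrt (1 + (b k * Re z)\<^sup>2 / 4)"
          by (rule real_sqrt_le_mono)
        then show ?thesis using q[of k] by (simp add: real_sqrt_mult)
      qed
      then have "(\<Prod>k<2*m. q k * sqrt (1 + (Re z)\<^sup>2)) \<le> Q (2*m) (Re z)"
        unfolding Q_def using q by (intro prod_mono) (auto intro!: mult_nonneg_nonneg simp: less_imp_le)
      moreover have "(\<Prod>k<2*m. q k * sqrt (1 + (Re z)\<^sup>2)) = (\<Prod>k<2*m. q k) * (1 + (Re z)\<^sup>2) ^ m"
        by (simp add: prod.distrib power_mult)
      ultimately have "(\<Prod>k<2*m. q k) * (1 + (Re z)\<^sup>2) ^ m * cmod (h z) \<le> Q (2*m) (Re z) * cmod (h z)"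
        by (intro mult_right_mono) auto
      also have "\<dots> \<le> exp (\<sigma> * \<bar>Im z\<bar>)" by (rule base)
      finally show ?thesis using qp by (simp add: C_def field_simps)
    qed
    then show ?thesis using qp by (intro exI[of _ C]) (auto simp: C_def)
  qed
  have compare: "\<exists>K C. C \<ge> 0 \<and> (\<forall>x N. (\<Prod>k<N. sqrt (1 + (s * a k * x)\<^sup>2)) \<le> C * (1 + x\<^sup>2) ^ K * Q N x)"
    if s: "s > 0" for s
  proof -
    obtain K where K: "\<And>k. k \<ge> K \<Longrightarrow> 2 * s \<le> c k"
      using c(2) by (auto simp: filterlim_at_top eventually_sequentially)
    define C where "C = (\<Prod>k<K. 1 + s * a k)"
    have C0: "C \<ge> 0" unfolding C_def using s a by (intro prod_nonneg) (auto intro: add_nonneg_nonneg simp: less_imp_le)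
    have "(\<Prod>k<N. sqrt (1 + (s * a k * x)\<^sup>2)) \<le> C * (1 + x\<^sup>2) ^ K * Q N x" for x N
    proof -
      define v where "v k = (if k < K then (1 + s * a k) * (1 + x\<^sup>2) else 1)" for k
      have v1: "v k \<ge> 1" for k
      proof -
        have "1 * 1 \<le> (1 + s * a k) * (1 + x\<^sup>2)" using s a[of k] by (intro mult_mono) auto
        then show ?thesis by (simp add: v_def)
      qed
      have "sqrt (1 + (s * a k * x)\<^sup>2) \<le> v k * sqrt (1 + (b k * x)\<^sup>2 / 4)" for k
      proof (cases "k < K")
        case True
        have sa: "s * a k > 0" using s a by simp
        have "sqrt (1 + (s * a k * x)\<^sup>2) \<le> sqrt (((1 + s * a k) * (1 + x\<^sup>2))\<^sup>2)"
        proof (rule real_sqrt_le_mono)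
          have 1: "(s * a k)\<^sup>2 \<le> (1 + s * a k)\<^sup>2" using sa by (intro power_mono) auto
          have 2: "1 \<le> (1 + s * a k)\<^sup>2" using sa by (intro one_le_power) auto
          have 3: "1 + x\<^sup>2 \<le> (1 + x\<^sup>2)\<^sup>2" by (rule self_le_power) auto
          have "1 + (s * a k * x)\<^sup>2 \<le> (1 + s * a k)\<^sup>2 + (1 + s * a k)\<^sup>2 * x\<^sup>2"
            unfolding power_mult_distrib[of "s * a k" x] using 2 1 by (intro add_mono mult_right_mono) auto
          also have "\<dots> = (1 + s * a k)\<^sup>2 * (1 + x\<^sup>2)" by (simp add: algebra_simps)
          also have "\<dots> \<le> (1 + s * a k)\<^sup>2 * (1 + x\<^sup>2)\<^sup>2" using 3 by (intro mult_left_mono) auto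
          finally show "1 + (s * a k * x)\<^sup>2 \<le> ((1 + s * a k) * (1 + x\<^sup>2))\<^sup>2"
            by (simp add: power_mult_distrib)
        qed
        also have "\<dots> = v k" using True sa by (simp add: v_def)
        also have "v k * 1 \<le> v k * sqrt (1 + (b k * x)\<^sup>2 / 4)"
          using v1[of k] by (intro mult_left_mono) auto
        finally show ?thesis by simp
      next
        case False
        have "2 * s * a k \<le> c k * a k" using K[of k] False a[of k] by (intro mult_right_mono) auto
        then have "s * a k \<le> b k / 2" by (simp add: b_def)
        then have "(s * a k)\<^sup>2 \<le> (b k / 2)\<^sup>2" using s a[of k] by (intro power_mono) auto
        then have "(s * a k)\<^sup>2 * x\<^sup>2 \<le> (b k / 2)\<^sup>2 * x\<^sup>2" by (intro mult_right_mono) auto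
        then have "1 + (s * a k * x)\<^sup>2 \<le> 1 + (b k * x)\<^sup>2 / 4"
          by (simp add: power_mult_distrib power_divide)
        then show ?thesis using False by (simp add: v_def real_sqrt_le_mono)
      qed
      then have "(\<Prod>k<N. sqrt (1 + (s * a k * x)\<^sup>2)) \<le> (\<Prod>k<N. v k * sqrt (1 + (b k * x)\<^sup>2 / 4))"
        by (intro prod_mono) auto
      also have "\<dots> = (\<Prod>k<N. v k) * Q N x" by (simp add: prod.distrib Q_def)
      also have "(\<Prod>k<N. v k) \<le> (\<Prod>k<max N K. v k)"
        using v1 by (intro prod_mono2) (auto intro: order_trans[OF zero_le_one])
      also have "(\<Prod>k<max N K. v k) = (\<Prod>k<K. v k)"
        by (rule prod.mono_neutral_right) (auto simp: v_def)
      also have "(\<Prod>k<K. v k) = C * (1 + x\<^sup>2) ^ K"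
        by (simp add: v_def C_def prod.distrib)
      finally show ?thesis using Q_pos[of N x] by (simp add: mult_right_mono less_imp_le)
    qed
    then show ?thesis using C0 by blast
  qed
  define g where "g z = (h z)\<^sup>2" for z
  have "beats_product a (2 * \<sigma>) g"
    unfolding beats_product_def
  proof (intro allI impI)
    fix s :: real and m :: nat assume s: "s > 0"
    obtain K C1 where C1: "C1 \<ge> 0" "\<And>x N. (\<Prod>k<N. sqrt (1 + (s * a k * x)\<^sup>2)) \<le> C1 * (1 + x\<^sup>2) ^ K * Q N x"
      using compare[OF s] by blast
    obtain C2 where C2: "C2 \<ge> 0" "\<And>z. (1 + (Re z)\<^sup>2) ^ (m + K) * cmod (h z) \<le> C2 * exp (\<sigma> * \<bar>Im z\<bar>)"
      using poly[of "m + K"] by blast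
    have "(1 + (Re z)\<^sup>2) ^ m * (\<Prod>k<N. sqrt (1 + (s * a k * Re z)\<^sup>2)) * cmod (g z)
        \<le> C1 * C2 * exp (2 * \<sigma> * \<bar>Im z\<bar>)" for z N
    proof -
      have "(1 + (Re z)\<^sup>2) ^ m * (\<Prod>k<N. sqrt (1 + (s * a k * Re z)\<^sup>2)) * cmod (g z)
          \<le> (1 + (Re z)\<^sup>2) ^ m * (C1 * (1 + (Re z)\<^sup>2) ^ K * Q N (Re z)) * cmod (g z)"
        by (intro mult_right_mono mult_left_mono C1) auto
      also have "\<dots> = C1 * ((1 + (Re z)\<^sup>2) ^ (m + K) * cmod (h z)) * (Q N (Re z) * cmod (h z))"
        by (simp add: g_def norm_power power_add power2_eq_square[of "cmod (h z)"] mult_ac)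
      also have "\<dots> \<le> C1 * (C2 * exp (\<sigma> * \<bar>Im z\<bar>)) * exp (\<sigma> * \<bar>Im z\<bar>)"
        using C1(1) C2(1) Q_pos[of N "Re z"]
        by (intro mult_mono mult_left_mono C2(2) base) (auto simp: less_imp_le)
      also have "\<dots> = C1 * C2 * exp (2 * \<sigma> * \<bar>Im z\<bar>)"
        by (simp add: mult_ac flip: exp_add)
      finally show ?thesis .
    qed
    moreover have "C1 * C2 \<ge> 0" using C1(1) C2(1) by simp
    ultimately show "\<exists>C\<ge>0. \<forall>z N. (1 + (Re z)\<^sup>2) ^ m * (\<Prod>k<N. sqrt (1 + (s * a k * Re z)\<^sup>2)) * cmod (g z)
      \<le> C * exp (2 * \<sigma> * \<bar>Im z\<bar>)" by blast
  qed
  moreover have "g holomorphic_on UNIV" unfolding g_def[abs_def] by (intro holomorphic_intros h)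
  moreover have "g 0 = 1" "2 * \<sigma> > 0" using h \<sigma> by (auto simp: g_def)
  ultimately show ?thesis by blast
qed

text \<open>
  Replacing \<open>g z\<close> by \<open>g (d z)\<close> changes the type to an arbitrary positive one; the bounds survive because
  they hold for all scales \<open>s\<close>.
\<close>

corollary entire_function_small_against_product_of_any_type:
  fixes a :: "nat \<Rightarrow> real"
  assumes a: "\<And>k. 0 < a k" and sum: "summable a" and \<kappa>: "\<kappa> > 0"
  shows "\<exists>g. g holomorphic_on UNIV \<and> g 0 = 1 \<and> beats_product a \<kappa> g"
proof -
  obtain g \<sigma> where g: "g holomorphic_on UNIV" "g 0 = 1" and \<sigma>: "\<sigma> > 0"
    and bound: "beats_product a \<sigma> g"
    using entire_function_small_against_product[OF a sum] by blast
  define d where "d = \<kappa> / \<sigma>"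
  have d: "d > 0" using \<kappa> \<sigma> by (simp add: d_def)
  define q where "q = min 1 (d\<^sup>2)"
  have q: "0 < q" "q \<le> 1" "q \<le> d\<^sup>2" using d by (auto simp: q_def)
  have "beats_product a \<kappa> (\<lambda>z. g (of_real d * z))"
    unfolding beats_product_def
  proof (intro allI impI)
    fix s :: real and m :: nat assume s: "s > 0"
    then have "s / d > 0" using d by simp
    then obtain C where C_nn: "C \<ge> 0" and C: "\<And>z N. (1 + (Re z)\<^sup>2) ^ m
        * (\<Prod>k<N. sqrt (1 + (s / d * a k * Re z)\<^sup>2)) * cmod (g z) \<le> C * exp (\<sigma> * \<bar>Im z\<bar>)"
      using beats_productE[OF bound] by blast
    have "(1 + (Re z)\<^sup>2) ^ m * (\<Prod>k<N. sqrt (1 + (s * a k * Re z)\<^sup>2)) * cmod (g (of_real d * z))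
        \<le> (C / q ^ m) * exp (\<kappa> * \<bar>Im z\<bar>)" for z N
    proof -
      have "q * (1 + (Re z)\<^sup>2) \<le> 1 + (d * Re z)\<^sup>2"
        using q mult_right_mono[OF q(3), of "(Re z)\<^sup>2"] by (simp add: distrib_left power_mult_distrib add_mono)
      then have "q ^ m * (1 + (Re z)\<^sup>2) ^ m \<le> (1 + (d * Re z)\<^sup>2) ^ m"
        using q by (subst power_mult_distrib[symmetric]) (intro power_mono, auto)
      then have "q ^ m * (1 + (Re z)\<^sup>2) ^ m * ((\<Prod>k<N. sqrt (1 + (s * a k * Re z)\<^sup>2)) * cmod (g (of_real d * z)))
          \<le> (1 + (d * Re z)\<^sup>2) ^ m * ((\<Prod>k<N. sqrt (1 + (s * a k * Re z)\<^sup>2)) * cmod (g (of_real d * z)))"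
        by (intro mult_right_mono mult_nonneg_nonneg prod_nonneg) auto
      also have "\<dots> \<le> C * exp (\<kappa> * \<bar>Im z\<bar>)"
        using C[of "of_real d * z" N] d \<sigma> \<kappa> by (simp add: d_def abs_mult mult_ac)
      finally show ?thesis using q by (simp add: field_simps)
    qed
    moreover have "C / q ^ m \<ge> 0" using C_nn q by simp
    ultimately show "\<exists>C\<ge>0. \<forall>z N. (1 + (Re z)\<^sup>2) ^ m * (\<Prod>k<N. sqrt (1 + (s * a k * Re z)\<^sup>2))
        * cmod (g (of_real d * z)) \<le> C * exp (\<kappa> * \<bar>Im z\<bar>)" by blast
  qed
  moreover have "(\<lambda>z. g (of_real d * z)) holomorphic_on UNIV"
    by (rule holomorphic_on_compose_gen[of "\<lambda>z. of_real d * z" UNIV g UNIV, unfolded o_def])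
       (auto intro!: g holomorphic_intros)
  ultimately show ?thesis using g by (intro exI[of _ "\<lambda>z. g (of_real d * z)"]) auto
qed

section \<open>Band-limited kernels\<close>

lemma integrable_inverse_1_plus_square_UNIV: "integrable lborel (\<lambda>x::real. C / (1 + x\<^sup>2))"
proof -
  have "set_integrable lborel (einterval (-\<infinity>) \<infinity>) (\<lambda>x. inverse (1 + x\<^sup>2))"
    by (rule integrable_inverse_1_plus_square)
  then have "integrable lborel (\<lambda>x::real. inverse (1 + x\<^sup>2))"
    by (simp add: set_integrable_def)
  then have "integrable lborel (\<lambda>x::real. C * inverse (1 + x\<^sup>2))" by (rule integrable_mult_right)
  then show ?thesis by (simp add: divide_inverse)
qed

lemma integral_Icc_tendsto:
  fixes f :: "real \<Rightarrow> complex"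
  assumes f: "integrable lborel f"
  shows "((\<lambda>T. LBINT t. indicator {-T..T} t *\<^sub>R f t) \<longlongrightarrow> (LBINT t. f t)) at_top"
proof (rule integral_dominated_convergence_at_top[where w="\<lambda>t. norm (f t)"])
  show "AE x in lborel. ((\<lambda>T. indicator {-T..T} x *\<^sub>R f x) \<longlongrightarrow> f x) at_top"
  proof (rule AE_I2, rule tendsto_eventually)
    fix x
    show "\<forall>\<^sub>F T in at_top. indicator {-T..T} x *\<^sub>R f x = f x"
      using eventually_ge_at_top[of "\<bar>x\<bar>"] by eventually_elim (auto simp: indicator_def)
  qed
qed (use f in \<open>auto simp: indicator_def\<close>)

text \<open>
  The line of integration can be pushed to infinity in the upper half plane. In terms of a primitive \<open>H\<close>
  of \<open>G\<close> the integral over \<open>[-T, T]\<close> is \<open>H T - H (-T)\<close>, and the increments of \<open>H\<close> along the other three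
  sides of a rectangle of height \<open>T\<close> tend to zero.
\<close>

lemma entire_integral_real_line_eq_0:
  assumes G: "G holomorphic_on UNIV" and eta: "\<eta> > 0"
    and bound: "\<And>z. Im z \<ge> 0 \<Longrightarrow> cmod (G z) * (1 + (Re z)\<^sup>2) \<le> C * exp (- \<eta> * Im z)"
  shows "(LBINT t. G (complex_of_real t)) = 0"
proof -
  have b1: "cmod (G z) \<le> C * exp (- \<eta> * Im z) / (1 + (Re z)\<^sup>2)" if "Im z \<ge> 0" for z
    using bound[OF that] by (subst pos_le_divide_eq) (auto intro: add_pos_nonneg)
  have C: "C \<ge> 0" using order_trans[OF _ bound[of 0]] by simp
  obtain H where H: "\<And>z. (H has_field_derivative G z) (at z)"
    using holomorphic_convex_primitive'[OF convex_UNIV open_UNIV G] by auto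
  have contG: "continuous_on UNIV G" using G by (rule holomorphic_on_imp_continuous_on)
  have cont: "continuous_on UNIV (\<lambda>t::real. G (complex_of_real t))"
    by (intro continuous_on_compose2[OF contG] continuous_intros) auto
  have int: "integrable lborel (\<lambda>t::real. G (complex_of_real t))"
  proof (rule Bochner_Integration.integrable_bound[OF integrable_inverse_1_plus_square_UNIV[of C]])
    show "(\<lambda>t::real. G (complex_of_real t)) \<in> borel_measurable lborel"
      using borel_measurable_continuous_onI[OF cont] by simp
    show "AE t in lborel. norm (G (complex_of_real t)) \<le> norm (C / (1 + t\<^sup>2))"
      using b1[of "complex_of_real _"] C by (intro AE_I2) simp
  qed
  have F: "(LBINT t. indicator {-T..T} t *\<^sub>R G (complex_of_real t)) = H (of_real T) - H (- of_real T)" if "T > 0" for T :: real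
  proof -
    have "(LBINT t. indicator {-T..T} t *\<^sub>R G (complex_of_real t)) = H (complex_of_real T) - H (complex_of_real (-T))"
    proof (rule integral_FTC_atLeastAtMost)
      show "((\<lambda>t. H (complex_of_real t)) has_vector_derivative G (complex_of_real x)) (at x within {-T..T})" for x
        using has_field_derivative_at_within[OF H[of "complex_of_real x"]]
        by (intro has_vector_derivative_real_field) (auto intro: H)
    qed (use that cont continuous_on_subset in auto)
    then show ?thesis by simp
  qed
  have seg: "cmod (H a - H b) \<le> B * cmod (a - b)"
    if "\<And>z. z \<in> closed_segment a b \<Longrightarrow> cmod (G z) \<le> B" for a b B
    by (rule field_differentiable_bound[of "closed_segment a b" H G])
       (use that in \<open>auto intro: has_field_derivative_at_within[OF H]\<close>)
  have est: "cmod (H (of_real T) - H (- of_real T)) \<le> 2 * (T * (C / (1 + T\<^sup>2))) + 2 * (C * (T * exp (- \<eta> * T)))"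
    if T: "T > 0" for T :: real
  proof -
    have side: "cmod (H (Complex c T) - H (Complex c 0)) \<le> T * (C / (1 + c\<^sup>2))" for c
    proof -
      have "cmod (H (Complex c T) - H (Complex c 0)) \<le> (C / (1 + c\<^sup>2)) * cmod (Complex c T - Complex c 0)"
      proof (rule seg)
        fix z assume "z \<in> closed_segment (Complex c T) (Complex c 0)"
        then have z: "Re z = c" "Im z \<ge> 0"
          using T by (auto simp: closed_segment_same_Re closed_segment_eq_real_ivl)
        have "C * exp (- \<eta> * Im z) / (1 + (Re z)\<^sup>2) \<le> C / (1 + c\<^sup>2)"
          unfolding z(1) using z(2) eta C by (intro divide_right_mono mult_right_le_one_le) auto
        then show "cmod (G z) \<le> C / (1 + c\<^sup>2)" using b1[OF z(2)] by linarith
      qed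
      moreover have "cmod (Complex c T - Complex c 0) = T" using T by (simp add: cmod_def)
      ultimately show ?thesis by (simp add: mult.commute)
    qed
    have top: "cmod (H (Complex T T) - H (Complex (-T) T)) \<le> 2 * (C * (T * exp (- \<eta> * T)))"
    proof -
      have "cmod (H (Complex T T) - H (Complex (-T) T)) \<le> (C * exp (- \<eta> * T)) * cmod (Complex T T - Complex (-T) T)"
      proof (rule seg)
        fix z assume "z \<in> closed_segment (Complex T T) (Complex (-T) T)"
        then have z: "Im z = T" by (auto simp: closed_segment_same_Im)
        have "C * exp (- \<eta> * T) / (1 + (Re z)\<^sup>2) \<le> C * exp (- \<eta> * T) / 1"
          using C by (intro divide_left_mono) (auto intro: add_pos_nonneg)
        then show "cmod (G z) \<le> C * exp (- \<eta> * T)" using b1[of z] z T by simp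
      qed
      moreover have "cmod (Complex T T - Complex (-T) T) = 2 * T" using T by (simp add: cmod_def real_sqrt_mult)
      ultimately show ?thesis by (simp add: mult_ac)
    qed
    have e: "H (of_real T) = H (Complex T 0)" "H (- of_real T) = H (Complex (-T) 0)"
      by (simp_all only: complex_of_real_def[symmetric] of_real_minus[symmetric])
    have "H (of_real T) - H (- of_real T) = - (H (Complex T T) - H (Complex T 0)) + (H (Complex T T) - H (Complex (-T) T))
        + (H (Complex (-T) T) - H (Complex (-T) 0))" by (simp add: e)
    also have "cmod \<dots> \<le> cmod (H (Complex T T) - H (Complex T 0)) + cmod (H (Complex T T) - H (Complex (-T) T))
        + cmod (H (Complex (-T) T) - H (Complex (-T) 0))"
      by (metis (no_types, lifting) norm_minus_cancel norm_triangle_mono norm_triangle_ineq order_refl)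
    finally have sum: "cmod (H (of_real T) - H (- of_real T)) \<le> cmod (H (Complex T T) - H (Complex T 0))
        + cmod (H (Complex T T) - H (Complex (-T) T)) + cmod (H (Complex (-T) T) - H (Complex (-T) 0))" .
    have "a \<le> 2 * s + t" if "a \<le> x + y + z" "x \<le> s" "y \<le> t" "z \<le> s" for a x y z s t :: real
      using that by linarith
    then show ?thesis using sum side[of T] top side[of "-T", unfolded power2_minus] .
  qed
  have "((\<lambda>T. 2 * (T * (C / (1 + T\<^sup>2))) + 2 * (C * (T * exp (- \<eta> * T)))) \<longlongrightarrow> 0) at_top"
    using eta by real_asymp
  then have "((\<lambda>T::real. H (of_real T) - H (- of_real T)) \<longlongrightarrow> 0) at_top"
    by (rule Lim_null_comparison[rotated]) (intro eventually_mono[OF eventually_gt_at_top[of 0]] est)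
  moreover have "((\<lambda>T::real. H (of_real T) - H (- of_real T)) \<longlongrightarrow> (LBINT t. G (complex_of_real t))) at_top"
    by (rule Lim_transform_eventually[OF integral_Icc_tendsto[OF int]])
       (intro eventually_mono[OF eventually_gt_at_top[of 0]] F)
  ultimately show ?thesis using tendsto_unique trivial_limit_at_top_linorder by blast
qed

text \<open>
  The easy half of the Paley--Wiener theorem: after multiplication by \<open>e^(\<i> l z)\<close> the function decays in the
  upper half plane if \<open>l > \<kappa>\<close>, and in the lower one if \<open>l < -\<kappa>\<close>.
\<close>

lemma fourier_support_of_exponential_type:
  assumes g: "g holomorphic_on UNIV"
    and bound: "\<And>z. cmod (g z) * (1 + (Re z)\<^sup>2) \<le> C * exp (\<kappa> * \<bar>Im z\<bar>)"
    and l: "\<bar>l\<bar> > \<kappa>"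
  shows "(LBINT t. g (complex_of_real t) * iexp (l * t)) = 0"
proof -
  have pos: "(LBINT t. h (complex_of_real t) * iexp (m * t)) = 0"
    if h: "h holomorphic_on UNIV" and hb: "\<And>z. cmod (h z) * (1 + (Re z)\<^sup>2) \<le> C * exp (\<kappa> * \<bar>Im z\<bar>)"
      and m: "m > \<kappa>" for h and m :: real
  proof -
    have "(LBINT t. (\<lambda>z. h z * exp (\<i> * of_real m * z)) (complex_of_real t)) = 0"
    proof (rule entire_integral_real_line_eq_0[where C=C and \<eta>="m - \<kappa>"])
      fix z :: complex assume z: "Im z \<ge> 0"
      have "cmod (h z * exp (\<i> * of_real m * z)) * (1 + (Re z)\<^sup>2)
          = (cmod (h z) * (1 + (Re z)\<^sup>2)) * exp (- m * Im z)"
        by (simp add: norm_mult)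
      also have "\<dots> \<le> (C * exp (\<kappa> * \<bar>Im z\<bar>)) * exp (- m * Im z)"
        by (intro mult_right_mono hb) auto
      also have "\<dots> = C * exp (- (m - \<kappa>) * Im z)"
        using z by (simp add: algebra_simps flip: exp_add)
      finally show "cmod (h z * exp (\<i> * of_real m * z)) * (1 + (Re z)\<^sup>2) \<le> C * exp (- (m - \<kappa>) * Im z)" .
    qed (use m h in \<open>auto intro!: holomorphic_intros\<close>)
    then show ?thesis by (simp add: mult.assoc)
  qed
  show ?thesis
  proof (cases "l > \<kappa>")
    case True
    then show ?thesis using pos[OF g bound] by blast
  next
    case False
    have "(LBINT t. (\<lambda>z. g (- z)) (complex_of_real t) * iexp (- l * t)) = 0"
    proof (rule pos)
      show "(\<lambda>z. g (- z)) holomorphic_on UNIV"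
        by (rule holomorphic_on_compose_gen[of "\<lambda>z. - z" UNIV g UNIV, unfolded o_def])
           (auto intro!: g holomorphic_intros)
      show "cmod (g (- z)) * (1 + (Re z)\<^sup>2) \<le> C * exp (\<kappa> * \<bar>Im z\<bar>)" for z using bound[of "-z"] by simp
    qed (use False l in auto)
    moreover have "(LBINT t. g (complex_of_real t) * iexp (l * t))
        = \<bar>-1\<bar> *\<^sub>R (LBINT t. g (complex_of_real (0 + (-1) * t)) * iexp (l * (0 + (-1) * t)))"
      by (rule lborel_integral_real_affine) simp
    ultimately show ?thesis by simp
  qed
qed

lemma csinc_as_fourier_integral:
  assumes "\<beta> > 0"
  shows "(LBINT \<xi>. (complex_of_real (indicator {-\<beta>..\<beta>} \<xi> / (2 * pi))) * iexp (\<xi> * t))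
    = complex_of_real (\<beta> / pi) * csinc (of_real (\<beta> * t))"
proof -
  have eq: "(LBINT \<xi>. (complex_of_real (indicator {-\<beta>..\<beta>} \<xi> / (2 * pi))) * iexp (\<xi> * t))
     = (LBINT \<xi>. indicator {-\<beta>..\<beta>} \<xi> *\<^sub>R (iexp (\<xi> * t) / (2 * pi)))"
    by (intro Bochner_Integration.integral_cong) (auto simp: indicator_def)
  show ?thesis
  proof (cases "t = 0")
    case True
    have "(LBINT \<xi>. indicator {-\<beta>..\<beta>} \<xi> *\<^sub>R (iexp (\<xi> * t) / (2 * pi)))
        = (\<lambda>\<xi>. complex_of_real (\<xi> / (2 * pi))) \<beta> - (\<lambda>\<xi>. complex_of_real (\<xi> / (2 * pi))) (-\<beta>)"
      by (rule integral_FTC_atLeastAtMost)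
         (use True assms in \<open>auto intro!: derivative_eq_intros continuous_intros\<close>)
    then show ?thesis unfolding eq using True by (simp add: csinc_def field_simps)
  next
    case False
    have "(LBINT \<xi>. indicator {-\<beta>..\<beta>} \<xi> *\<^sub>R (iexp (\<xi> * t) / (2 * pi)))
        = (\<lambda>\<xi>. iexp (\<xi> * t) / (2 * pi * (\<i> * t))) \<beta> - (\<lambda>\<xi>. iexp (\<xi> * t) / (2 * pi * (\<i> * t))) (-\<beta>)"
    proof (rule integral_FTC_atLeastAtMost)
      fix x
      have "((\<lambda>z. exp (\<i> * (z * of_real t)) / (2 * pi * (\<i> * t))) has_field_derivative iexp (x * t) / (2 * pi))
          (at (complex_of_real x))"
        using False by (auto intro!: derivative_eq_intros simp: field_simps)
      then have "((\<lambda>\<xi>. exp (\<i> * (of_real \<xi> * of_real t)) / (2 * pi * (\<i> * t))) has_vector_derivative iexp (x * t) / (2 * pi))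
          (at x within {-\<beta>..\<beta>})"
        by (rule has_vector_derivative_real_field)
      then show "((\<lambda>\<xi>. iexp (\<xi> * t) / (2 * pi * (\<i> * t))) has_vector_derivative iexp (x * t) / (2 * pi))
          (at x within {-\<beta>..\<beta>})" by simp
    qed (use assms in \<open>auto intro!: continuous_intros\<close>)
    moreover have "iexp (\<beta> * t) - iexp (- \<beta> * t) = 2 * \<i> * sin (complex_of_real (\<beta> * t))"
      by (simp add: sin_exp_eq)
    ultimately show ?thesis unfolding eq using False assms
      by (simp add: csinc_def diff_divide_distrib[symmetric] field_simps)
  qed
qed

text \<open>
  The Fourier transform of the product is the convolution of the transform of \<open>g\<close>, which vanishes outside
  \<open>[-\<kappa>, \<kappa>]\<close> and has integral \<open>2 \<pi> g 0\<close>, with the indicator function of \<open>[-\<beta>, \<beta>]\<close> divided by \<open>2 \<pi>\<close>. At a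
  point \<open>l\<close> with \<open>|l| < \<beta> - \<kappa>\<close> the window of the convolution contains the whole support.
\<close>

theorem fourier_band_limited_eq_1:
  assumes g: "g holomorphic_on UNIV" and g0: "g 0 = 1"
    and bound: "\<And>z. cmod (g z) * (1 + (Re z)\<^sup>2) \<le> C * exp (\<kappa> * \<bar>Im z\<bar>)"
    and l: "\<bar>l\<bar> < \<beta> - \<kappa>" and \<kappa>: "\<kappa> \<ge> 0"
  shows "fourier (\<lambda>z. g z * (of_real (\<beta> / pi) * csinc (of_real \<beta> * z))) l = 1"
proof -
  have \<beta>: "\<beta> > 0" using l \<kappa> by linarith
  define p where "p t = g (complex_of_real t)" for t :: real
  define q where "q \<xi> = complex_of_real (indicator {-\<beta>..\<beta>} \<xi> / (2 * pi))" for \<xi> :: real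
  define G where "G \<mu> = (LBINT t. p t * iexp (\<mu> * t))" for \<mu> :: real
  have contp: "continuous_on UNIV p"
    unfolding p_def
    by (intro continuous_on_compose2[OF holomorphic_on_imp_continuous_on[OF g]] continuous_intros) auto
  have pb: "cmod (p t) * (1 + t\<^sup>2) \<le> C" for t using bound[of "complex_of_real t"] by (simp add: p_def)
  have pb': "cmod (p t) \<le> C / (1 + t\<^sup>2)" for t
    using pb[of t] by (subst pos_le_divide_eq) (auto intro: add_pos_nonneg)
  have C: "C \<ge> 0" using order_trans[OF _ pb[of 0]] by simp
  have pB: "cmod (p t) \<le> C" for t
  proof -
    have "cmod (p t) * 1 \<le> cmod (p t) * (1 + t\<^sup>2)" by (intro mult_left_mono) auto
    then show ?thesis using pb[of t] by simp
  qed
  have p_int: "integrable lborel p"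
  proof (rule Bochner_Integration.integrable_bound[OF integrable_inverse_1_plus_square_UNIV[of C]])
    show "p \<in> borel_measurable lborel" using borel_measurable_continuous_onI[OF contp] by simp
    show "AE t in lborel. norm (p t) \<le> norm (C / (1 + t\<^sup>2))" using pb' C by (intro AE_I2) simp
  qed
  have [measurable]: "p \<in> borel_measurable borel" using p_int by auto
  have G0: "G \<mu> = 0" if "\<bar>\<mu>\<bar> > \<kappa>" for \<mu>
    unfolding G_def p_def by (rule fourier_support_of_exponential_type[OF g bound that])
  have G_meas [measurable]: "G \<in> borel_measurable borel" unfolding G_def by measurable
  have Gb: "cmod (G \<mu>) \<le> (LBINT t. cmod (p t))" for \<mu>
    unfolding G_def by (rule order_trans[OF integral_norm_bound]) (simp add: norm_mult)
  have G_int: "integrable lborel G"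
  proof (rule Bochner_Integration.integrable_bound)
    show "integrable lborel (\<lambda>\<mu>. (LBINT t. cmod (p t)) * indicator {-\<kappa>..\<kappa>} \<mu> :: real)"
      by (intro integrable_mult_right integrable_real_indicator) (auto simp: emeasure_lborel_Icc_eq)
    show "AE \<mu> in lborel. norm (G \<mu>) \<le> norm ((LBINT t. cmod (p t)) * indicator {-\<kappa>..\<kappa>} \<mu> :: real)"
    proof (rule AE_I2)
      fix \<mu>
      show "norm (G \<mu>) \<le> norm ((LBINT t. cmod (p t)) * indicator {-\<kappa>..\<kappa>} \<mu> :: real)"
        using G0[of \<mu>] Gb[of \<mu>] by (cases "\<bar>\<mu>\<bar> > \<kappa>") (auto simp: indicator_def)
    qed
  qed simp
  have q_int: "integrable lborel q"
  proof -
    have "integrable lborel (\<lambda>\<xi>. complex_of_real (indicator {-\<beta>..\<beta>} \<xi> *\<^sub>R (1 / (2 * pi))))"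
      by (intro integrable_of_real integrable_scaleR_left integrable_real_indicator)
         (auto simp: emeasure_lborel_Icc_eq)
    then show ?thesis by (simp add: q_def[abs_def])
  qed
  have pl_int: "integrable lborel (\<lambda>t. p t * iexp (l * t))" by (rule integrable_mult_unimodular[OF p_int])
  have "fourier (\<lambda>z. g z * (of_real (\<beta> / pi) * csinc (of_real \<beta> * z))) l
     = (LBINT t. p t * iexp (l * t) * (of_real (\<beta> / pi) * csinc (of_real (\<beta> * t))))"
    unfolding fourier_def by (intro Bochner_Integration.integral_cong) (auto simp: p_def mult_ac)
  also have "\<dots> = (LBINT t. p t * iexp (l * t) * (LBINT \<xi>. q \<xi> * iexp (1 * \<xi> * t)))"
    unfolding q_def mult_1 csinc_as_fourier_integral[OF \<beta>] ..
  also have "\<dots> = (LBINT \<xi>. q \<xi> * (LBINT t. p t * iexp (l * t) * iexp (1 * \<xi> * t)))"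
    by (rule fourier_multiplication_formula[OF pl_int q_int])
  also have "\<dots> = (LBINT \<xi>. q \<xi> * G (l + \<xi>))"
    unfolding G_def by (simp add: distrib_left distrib_right mult.assoc flip: exp_add)
  also have "\<dots> = (LBINT \<xi>. G (l + 1 * \<xi>) / (2 * pi))"
  proof (intro Bochner_Integration.integral_cong refl)
    fix \<xi>
    show "q \<xi> * G (l + \<xi>) = G (l + 1 * \<xi>) / complex_of_real (2 * pi)"
      using G0[of "l + \<xi>"] l by (cases "\<bar>l + \<xi>\<bar> > \<kappa>") (auto simp: q_def indicator_def)
  qed
  also have "\<dots> = (LBINT \<xi>. G (l + 1 * \<xi>)) / (2 * pi)" by simp
  also have "(LBINT \<xi>. G (l + 1 * \<xi>)) = (LBINT \<mu>. G \<mu>)"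
    using lborel_integral_real_affine[of 1 G l] by simp
  also have "(LBINT \<mu>. G \<mu>) = (LBINT \<mu>. G (0 + (-1) * \<mu>))"
    using lborel_integral_real_affine[of "-1" G 0] by simp
  also have "\<dots> = (LBINT \<mu>. LBINT t. p t * iexp (- \<mu> * t))"
    by (simp add: G_def)
  also have "\<dots> = complex_of_real (2 * pi) * p 0"
  proof (rule fourier_inversion_at_zero[OF p_int contp pB])
    have "integrable lborel (\<lambda>\<mu>. G (0 + (-1) * \<mu>))"
      by (rule lborel_integrable_real_affine[OF G_int]) simp
    then show "integrable lborel (\<lambda>l. LBINT t. p t * iexp (- l * t))" by (simp add: G_def)
  qed
  finally show ?thesis by (simp add: p_def g0)
qed

section \<open>A reproducing formula for functions of exponential type\<close>

lemma integrable_exp_neg_abs: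
  fixes c :: real assumes c: "c > 0"
  shows "integrable lborel (\<lambda>t. exp (- c * \<bar>t\<bar>))"
proof -
  define K where "K = max 1 (2 / c\<^sup>2)"
  have "exp (- c * \<bar>t\<bar>) \<le> K / (1 + t\<^sup>2)" for t
  proof -
    have "1 + t\<^sup>2 \<le> K * (1 + (c * \<bar>t\<bar>)\<^sup>2 / 2)"
    proof -
      have "2 / c\<^sup>2 \<le> K" by (simp add: K_def)
      then have "2 / c\<^sup>2 * ((c * \<bar>t\<bar>)\<^sup>2 / 2) \<le> K * ((c * \<bar>t\<bar>)\<^sup>2 / 2)" by (intro mult_right_mono) auto
      moreover have "2 / c\<^sup>2 * ((c * \<bar>t\<bar>)\<^sup>2 / 2) = t\<^sup>2" using c by (simp add: power_mult_distrib)
      moreover have "1 \<le> K" by (simp add: K_def)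
      ultimately have "1 + t\<^sup>2 \<le> K + K * ((c * \<bar>t\<bar>)\<^sup>2 / 2)" by linarith
      then show ?thesis by (simp only: distrib_left mult_1_right)
    qed
    also have "\<dots> \<le> K * exp (c * \<bar>t\<bar>)"
    proof (rule mult_left_mono)
      have "1 + c * \<bar>t\<bar> + (c * \<bar>t\<bar>)\<^sup>2 / 2 \<le> exp (c * \<bar>t\<bar>)"
        by (rule exp_lower_Taylor_quadratic) (use c in simp)
      moreover have "0 \<le> c * \<bar>t\<bar>" using c by simp
      ultimately show "1 + (c * \<bar>t\<bar>)\<^sup>2 / 2 \<le> exp (c * \<bar>t\<bar>)" by linarith
    qed (simp add: K_def)
    finally have "exp (- c * \<bar>t\<bar>) * (1 + t\<^sup>2) \<le> exp (- c * \<bar>t\<bar>) * (K * exp (c * \<bar>t\<bar>))"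
      by (intro mult_left_mono) auto
    also have "\<dots> = K" by (simp add: mult.left_commute flip: exp_add)
    finally show ?thesis by (subst pos_le_divide_eq) (auto intro: add_pos_nonneg)
  qed
  then show ?thesis
    by (intro Bochner_Integration.integrable_bound[OF integrable_inverse_1_plus_square_UNIV[of K]])
       (auto simp: K_def)
qed

lemma integral_halfline_FTC:
  fixes F f :: "real \<Rightarrow> complex"
  assumes F: "\<And>t. (F has_vector_derivative f t) (at t)" and cont: "continuous_on UNIV f"
    and int: "integrable lborel (\<lambda>t. indicator {0..} t *\<^sub>R f t)" and lim: "(F \<longlongrightarrow> 0) at_top"
  shows "(LBINT t. indicator {0..} t *\<^sub>R f t) = - F 0"
proof -
  have "(LBINT t. indicator {-T..T} t *\<^sub>R (indicator {0..} t *\<^sub>R f t)) = F T - F 0" if "T > 0" for T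
  proof -
    have "(LBINT t. indicator {-T..T} t *\<^sub>R (indicator {0..} t *\<^sub>R f t))
        = (LBINT t. indicator {0..T} t *\<^sub>R f t)"
      using that by (intro Bochner_Integration.integral_cong) (auto simp: indicator_def)
    also have "\<dots> = F T - F 0"
      by (rule integral_FTC_atLeastAtMost)
         (use that in \<open>auto intro: has_vector_derivative_at_within F continuous_on_subset[OF cont]\<close>)
    finally show ?thesis .
  qed
  then have "((\<lambda>T. F T - F 0) \<longlongrightarrow> (LBINT t. indicator {0..} t *\<^sub>R f t)) at_top"
    by (intro Lim_transform_eventually[OF integral_Icc_tendsto[OF int]]
        eventually_mono[OF eventually_gt_at_top[of 0]])
  moreover have "((\<lambda>T. F T - F 0) \<longlongrightarrow> 0 - F 0) at_top" by (intro tendsto_intros lim)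
  ultimately show ?thesis using tendsto_unique[OF trivial_limit_at_top_linorder] by fastforce
qed

lemma continuous_on_UNIV_of_vector_derivative:
  assumes "\<And>t. (f has_vector_derivative f' t) (at t)"
  shows "continuous_on UNIV f"
  by (simp add: continuous_at_imp_continuous_on has_vector_derivative_continuous[OF assms])

text \<open>
  In this section \<open>f n\<close> is the \<open>n\<close>-th derivative of \<open>f 0\<close> up to the factor \<open>\<i>^n\<close>. Integrating by parts
  \<open>N\<close> times gives the partial sums, and the remainder is \<open>O((\<beta> / |s|)^N)\<close> because all
  derivatives share the growth of \<open>f 0\<close> up to the factor \<open>\<beta>^n\<close>.
\<close>

lemma laplace_transform_sums:
  fixes f :: "nat \<Rightarrow> real \<Rightarrow> complex"
  assumes deriv: "\<And>n t. (f n has_vector_derivative \<i> * f (Suc n) t) (at t)"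
    and growth: "\<And>n t. cmod (f n t) \<le> C * \<beta> ^ n * exp (Re s / 2 * \<bar>t\<bar>)"
    and s: "Re s > 0" "cmod s > \<beta>" and \<beta>: "\<beta> \<ge> 0"
  shows "(\<lambda>n. \<i> ^ n * f n 0 / s ^ Suc n) sums (LBINT t. indicator {0..} t *\<^sub>R (f 0 t * exp (- s * of_real t)))"
proof -
  define \<eta> where "\<eta> = Re s / 2"
  have \<eta>: "\<eta> > 0" using s by (simp add: \<eta>_def)
  have C: "C \<ge> 0" using order_trans[OF norm_ge_zero growth[of 0 0]] by simp
  have s0: "s \<noteq> 0" using s by auto
  define I where "I n = (LBINT t. indicator {0..} t *\<^sub>R (f n t * exp (- s * of_real t)))" for n
  define J where "J = (LBINT t. exp (- \<eta> * \<bar>t\<bar>))"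
  have contf: "continuous_on UNIV (f n)" for n
    by (rule continuous_on_UNIV_of_vector_derivative[OF deriv])
  have contg: "continuous_on UNIV (\<lambda>t. f n t * exp (- s * of_real t))" for n
    by (intro continuous_intros contf)
  have gb: "cmod (f n t * exp (- s * of_real t)) \<le> C * \<beta> ^ n * exp (- \<eta> * \<bar>t\<bar>)" if "t \<ge> 0" for n t
  proof -
    have "cmod (f n t * exp (- s * of_real t)) \<le> C * \<beta> ^ n * exp (\<eta> * \<bar>t\<bar>) * exp (- Re s * t)"
      using growth[of n t] by (simp add: norm_mult \<eta>_def)
    also have "\<dots> = C * \<beta> ^ n * exp (- \<eta> * \<bar>t\<bar>)"
      using that by (simp add: mult.assoc \<eta>_def flip: exp_add)
    finally show ?thesis .
  qed
  have gb': "cmod (indicator {0..} t *\<^sub>R (f n t * exp (- s * of_real t))) \<le> C * \<beta> ^ n * exp (- \<eta> * \<bar>t\<bar>)" for n t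
    using gb[of t n] C \<beta> by (cases "t \<ge> 0") auto
  have [measurable]: "(\<lambda>t. f n t * exp (- s * of_real t)) \<in> borel_measurable borel" for n
    by (rule borel_measurable_continuous_onI[OF contg])
  have int: "integrable lborel (\<lambda>t. indicator {0..} t *\<^sub>R (f n t * exp (- s * of_real t)))" for n
  proof (rule Bochner_Integration.integrable_bound)
    show "integrable lborel (\<lambda>t. C * \<beta> ^ n * exp (- \<eta> * \<bar>t\<bar>))"
      by (intro integrable_mult_right integrable_exp_neg_abs \<eta>)
    show "AE t in lborel. norm (indicator {0..} t *\<^sub>R (f n t * exp (- s * of_real t))) \<le> norm (C * \<beta> ^ n * exp (- \<eta> * \<bar>t\<bar>))"
      by (rule AE_I2) (metis gb' abs_of_nonneg norm_ge_zero order_trans real_norm_def)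
  qed measurable
  have I_bound: "cmod (I n) \<le> C * \<beta> ^ n * J" for n
  proof -
    have "cmod (I n) \<le> (LBINT t. C * \<beta> ^ n * exp (- \<eta> * \<bar>t\<bar>))"
      unfolding I_def
      by (intro Bochner_Integration.integral_norm_bound_integral int integrable_mult_right integrable_exp_neg_abs \<eta> gb')
    then show ?thesis by (simp add: J_def)
  qed
  have step: "I n = f n 0 / s + (\<i> / s) * I (Suc n)" for n
  proof -
    have "(LBINT t. indicator {0..} t *\<^sub>R (\<i> * (f (Suc n) t * exp (- s * of_real t)) - s * (f n t * exp (- s * of_real t))))
        = - (f n 0 * exp (- s * of_real 0))"
    proof (rule integral_halfline_FTC)
      fix t
      have "((\<lambda>z. exp (- s * z)) has_field_derivative - s * exp (- s * of_real t)) (at (complex_of_real t))"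
        by (auto intro!: derivative_eq_intros)
      then have "((\<lambda>t. exp (- s * of_real t)) has_vector_derivative - s * exp (- s * of_real t)) (at t)"
        by (rule has_vector_derivative_real_field)
      from has_vector_derivative_mult[OF deriv[of n t] this]
      show "((\<lambda>t. f n t * exp (- s * of_real t)) has_vector_derivative
          \<i> * (f (Suc n) t * exp (- s * of_real t)) - s * (f n t * exp (- s * of_real t))) (at t)"
        by (simp add: algebra_simps)
    next
      show "continuous_on UNIV (\<lambda>t. \<i> * (f (Suc n) t * exp (- s * of_real t)) - s * (f n t * exp (- s * of_real t)))"
        by (intro continuous_intros contf)
      have "integrable lborel (\<lambda>t. \<i> * (indicator {0..} t *\<^sub>R (f (Suc n) t * exp (- s * of_real t)))
          - s * (indicator {0..} t *\<^sub>R (f n t * exp (- s * of_real t))))"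
        by (intro Bochner_Integration.integrable_diff integrable_mult_right int)
      then show "integrable lborel (\<lambda>t. indicator {0..} t *\<^sub>R (\<i> * (f (Suc n) t * exp (- s * of_real t)) - s * (f n t * exp (- s * of_real t))))"
        by (simp add: scaleR_diff_right)
      have "((\<lambda>t. C * \<beta> ^ n * exp (- \<eta> * t)) \<longlongrightarrow> 0) at_top" using \<eta> by real_asymp
      then show "((\<lambda>t. f n t * exp (- s * of_real t)) \<longlongrightarrow> 0) at_top"
        by (rule Lim_null_comparison[rotated])
           (use eventually_ge_at_top[of 0] gb[of _ n] in \<open>fastforce elim!: eventually_mono\<close>)
    qed
    moreover have "(LBINT t. indicator {0..} t *\<^sub>R (\<i> * (f (Suc n) t * exp (- s * of_real t)) - s * (f n t * exp (- s * of_real t))))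
        = \<i> * I (Suc n) - s * I n"
    proof -
      have "(LBINT t. indicator {0..} t *\<^sub>R (\<i> * (f (Suc n) t * exp (- s * of_real t)) - s * (f n t * exp (- s * of_real t))))
         = (LBINT t. \<i> * (indicator {0..} t *\<^sub>R (f (Suc n) t * exp (- s * of_real t))) - s * (indicator {0..} t *\<^sub>R (f n t * exp (- s * of_real t))))"
        by (simp add: scaleR_diff_right)
      also have "\<dots> = \<i> * I (Suc n) - s * I n"
        unfolding I_def integral_mult_right_zero[symmetric]
        by (rule Bochner_Integration.integral_diff) (intro integrable_mult_right int)+
      finally show ?thesis .
    qed
    ultimately have "\<i> * I (Suc n) - s * I n = - f n 0" by simp
    then show ?thesis using s0 by (simp add: field_simps)
  qed
  have partial: "I 0 = (\<Sum>n<N. \<i> ^ n * f n 0 / s ^ Suc n) + (\<i> / s) ^ N * I N" for N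
  proof (induction N)
    case (Suc N)
    show ?case unfolding Suc.IH by (subst step[of N]) (simp add: field_simps power_divide s0)
  qed simp
  have "(\<lambda>N. (\<i> / s) ^ N * I N) \<longlonglongrightarrow> 0"
  proof (rule Lim_null_comparison)
    show "\<forall>\<^sub>F N in sequentially. norm ((\<i> / s) ^ N * I N) \<le> C * J * (\<beta> / cmod s) ^ N"
    proof (intro always_eventually allI)
      fix N
      have "norm ((\<i> / s) ^ N * I N) \<le> (1 / cmod s ^ N) * (C * \<beta> ^ N * J)"
        unfolding norm_mult using I_bound[of N]
        by (intro mult_mono) (auto simp: norm_power norm_divide power_divide)
      then show "norm ((\<i> / s) ^ N * I N) \<le> C * J * (\<beta> / cmod s) ^ N"
        by (simp add: power_divide mult_ac)
    qed
    have "(\<lambda>N. (\<beta> / cmod s) ^ N) \<longlonglongrightarrow> 0" using s \<beta> by (intro LIMSEQ_realpow_zero) (auto simp: divide_less_eq)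
    then show "(\<lambda>N. C * J * (\<beta> / cmod s) ^ N) \<longlonglongrightarrow> 0" by (rule tendsto_mult_right_zero)
  qed
  then have "(\<lambda>N. I 0 - (\<i> / s) ^ N * I N) \<longlonglongrightarrow> I 0 - 0" by (intro tendsto_intros)
  moreover have "I 0 - (\<i> / s) ^ N * I N = (\<Sum>n<N. \<i> ^ n * f n 0 / s ^ Suc n)" for N
    using partial[of N] by simp
  ultimately show ?thesis by (simp add: sums_def I_def)
qed

text \<open>
  The two half-line integrals are Laplace transforms at \<open>\<eta> + \<i> l\<close> and, after reflection, at \<open>\<eta> - \<i> l\<close>.
  Their series in powers of \<open>1 / p\<close> and \<open>1 / q\<close> with \<open>p - q = 2 \<eta>\<close> cancel up to \<open>O(\<eta>)\<close>.
\<close>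

lemma carleman_transform_bound:
  fixes f :: "nat \<Rightarrow> real \<Rightarrow> complex"
  assumes deriv: "\<And>n t. (f n has_vector_derivative \<i> * f (Suc n) t) (at t)"
    and growth: "\<And>n t. cmod (f n t) \<le> C * \<beta> ^ n * exp (\<eta> / 2 * \<bar>t\<bar>)"
    and at0: "\<And>n. cmod (f n 0) \<le> C0 * \<beta> ^ n"
    and \<eta>: "\<eta> > 0" and l: "\<bar>l\<bar> > \<beta>" and \<beta>: "\<beta> \<ge> 0"
    and int: "integrable lborel (\<lambda>t. f 0 t * exp (- \<eta> * \<bar>t\<bar>))"
  shows "cmod (LBINT t. f 0 t * exp (- \<eta> * \<bar>t\<bar>) * iexp (- l * t)) \<le> 2 * C0 * \<eta> / (\<bar>l\<bar> - \<beta>)\<^sup>2"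
proof -
  define F where "F t = f 0 t * exp (- \<eta> * \<bar>t\<bar>) * iexp (- l * t)" for t
  define p where "p = Complex \<eta> l"
  define q where "q = Complex (- \<eta>) l"
  have F_int: "integrable lborel F" unfolding F_def by (rule integrable_mult_unimodular[OF int])
  have l0: "\<bar>l\<bar> > 0" using l \<beta> by linarith
  have pq: "cmod p \<ge> \<bar>l\<bar>" "cmod q \<ge> \<bar>l\<bar>" by (auto simp: p_def q_def cmod_def)
  have pq0: "p \<noteq> 0" "q \<noteq> 0" using pq l0 by auto
  have S1: "(\<lambda>n. \<i> ^ n * f n 0 / p ^ Suc n) sums (LBINT t. indicator {0..} t *\<^sub>R (f 0 t * exp (- p * of_real t)))"
    by (rule laplace_transform_sums[where f=f and C=C and \<beta>=\<beta>, OF deriv])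
       (use growth \<eta> l pq(1) \<beta> in \<open>auto simp: p_def\<close>)
  define g where "g n t = (- 1) ^ n * f n (- t)" for n t
  have S2: "(\<lambda>n. \<i> ^ n * g n 0 / (- q) ^ Suc n) sums (LBINT t. indicator {0..} t *\<^sub>R (g 0 t * exp (- (- q) * of_real t)))"
  proof (rule laplace_transform_sums[where C=C and \<beta>=\<beta>])
    fix n t
    have "((f n \<circ> (\<lambda>t. - t)) has_vector_derivative (- 1) *\<^sub>R (\<i> * f (Suc n) (- t))) (at t)"
      by (rule vector_diff_chain_at) (auto intro!: derivative_eq_intros deriv)
    then have "((\<lambda>t. (- 1) ^ n * f n (- t)) has_vector_derivative (- 1) ^ n * ((- 1) *\<^sub>R (\<i> * f (Suc n) (- t)))) (at t)"
      unfolding o_def by (rule has_vector_derivative_mult_right)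
    then show "(g n has_vector_derivative \<i> * g (Suc n) t) (at t)"
      by (simp add: g_def[abs_def] mult_ac)
    show "cmod (g n t) \<le> C * \<beta> ^ n * exp (Re (- q) / 2 * \<bar>t\<bar>)"
      using growth[of n "-t"] by (simp add: g_def norm_mult norm_power q_def)
  qed (use \<eta> l pq(2) \<beta> in \<open>auto simp: q_def\<close>)
  have i1: "(LBINT t. indicator {0..} t *\<^sub>R F t) = (LBINT t. indicator {0..} t *\<^sub>R (f 0 t * exp (- p * of_real t)))"
  proof (intro Bochner_Integration.integral_cong refl)
    fix t :: real
    show "indicator {0..} t *\<^sub>R F t = indicator {0..} t *\<^sub>R (f 0 t * exp (- p * of_real t))"
    proof (cases "t \<ge> 0")
      case True
      have "- p * of_real t = of_real (- \<eta> * \<bar>t\<bar>) + \<i> * of_real (- l * t)"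
        using True by (simp add: p_def complex_eq_iff)
      then have "exp (- p * of_real t) = of_real (exp (- \<eta> * \<bar>t\<bar>)) * iexp (- l * t)"
        by (simp only: exp_add exp_of_real)
      then show ?thesis by (simp add: F_def mult.assoc)
    qed simp
  qed
  have i2: "(LBINT t. indicator {..<0} t *\<^sub>R F t) = (LBINT t. indicator {0..} t *\<^sub>R (g 0 t * exp (- (- q) * of_real t)))"
  proof -
    have "(LBINT t. indicator {..<0} t *\<^sub>R F t)
        = \<bar>-1\<bar> *\<^sub>R (LBINT t. indicator {..<0} (0 + (-1) * t) *\<^sub>R F (0 + (-1) * t))"
      by (rule lborel_integral_real_affine) simp
    also have "\<dots> = (LBINT t. indicator {..<0} (- t) *\<^sub>R F (- t))" by simp
    also have "\<dots> = (LBINT t. indicator {0..} t *\<^sub>R (g 0 t * exp (- (- q) * of_real t)))"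
    proof (rule integral_cong_AE)
      have F_meas [measurable]: "F \<in> borel_measurable borel" using F_int by auto
      show "(\<lambda>t. indicator {..<0} (- t) *\<^sub>R F (- t)) \<in> borel_measurable lborel" by measurable
      have "continuous_on UNIV (f 0)"
        by (rule continuous_on_UNIV_of_vector_derivative[OF deriv])
      then have "continuous_on UNIV (g 0)" unfolding g_def by (auto intro!: continuous_intros continuous_on_compose2[of UNIV "f 0"])
      then have [measurable]: "g 0 \<in> borel_measurable borel" by (rule borel_measurable_continuous_onI)
      show "(\<lambda>t. indicator {0..} t *\<^sub>R (g 0 t * exp (- (- q) * of_real t))) \<in> borel_measurable lborel" by measurable
      show "AE t in lborel. indicator {..<0} (- t) *\<^sub>R F (- t) = indicator {0..} t *\<^sub>R (g 0 t * exp (- (- q) * of_real t))"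
        using AE_lborel_singleton[of 0]
      proof eventually_elim
        case (elim t)
        show ?case
        proof (cases "t > 0")
          case True
          have "- (- q) * of_real t = of_real (- \<eta> * \<bar>t\<bar>) + \<i> * of_real (- l * (- t))"
            using True by (simp add: q_def complex_eq_iff)
          then have "exp (- (- q) * of_real t) = of_real (exp (- \<eta> * \<bar>t\<bar>)) * iexp (- l * (- t))"
            by (simp only: exp_add exp_of_real)
          then show ?thesis using True by (simp add: F_def g_def mult.assoc)
        qed (use elim in auto)
      qed
    qed
    finally show ?thesis .
  qed
  have [measurable]: "F \<in> borel_measurable borel" using F_int by auto
  have half: "integrable lborel (\<lambda>t. indicator A t *\<^sub>R F t)" if [measurable]: "A \<in> sets borel" for A
    by (rule Bochner_Integration.integrable_bound[OF F_int]) (auto simp: indicator_def)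
  have split: "(LBINT t. F t) = (LBINT t. indicator {0..} t *\<^sub>R F t) + (LBINT t. indicator {..<0} t *\<^sub>R F t)"
  proof -
    have "(LBINT t. F t) = (LBINT t. indicator {0..} t *\<^sub>R F t + indicator {..<0} t *\<^sub>R F t)"
      by (intro Bochner_Integration.integral_cong) (auto simp: indicator_def)
    then show ?thesis by (simp add: half)
  qed
  define T where "T n = \<i> ^ n * f n 0 * (1 / p ^ Suc n - 1 / q ^ Suc n)" for n
  have S: "T sums (LBINT t. F t)"
  proof -
    have "(\<lambda>n. \<i> ^ n * f n 0 / p ^ Suc n + \<i> ^ n * g n 0 / (- q) ^ Suc n) sums (LBINT t. F t)"
      unfolding split i1 i2 by (intro sums_add S1 S2)
    moreover have "\<i> ^ n * f n 0 / p ^ Suc n + \<i> ^ n * g n 0 / (- q) ^ Suc n = T n" for n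
    proof -
      have "(-1) ^ n / (- q) ^ Suc n = - (1 / q ^ Suc n)"
        using pq0 by (simp add: power_minus[of q n] field_simps)
      then have "\<i> ^ n * g n 0 / (- q) ^ Suc n = \<i> ^ n * f n 0 * (- (1 / q ^ Suc n))"
        by (simp add: g_def mult.commute[of "(-1) ^ n"] mult.assoc flip: times_divide_eq_right)
      then show ?thesis by (simp add: T_def right_diff_distrib)
    qed
    ultimately show ?thesis by simp
  qed
  define r where "r = \<beta> / \<bar>l\<bar>"
  have r: "0 \<le> r" "r < 1" using l \<beta> by (auto simp: r_def)
  define R where "R n = 2 * C0 * \<eta> / l\<^sup>2 * (of_nat (Suc n) * r ^ n)" for n
  have Tb: "cmod (T n) \<le> R n" for n
  proof -
    define u v where "u = of_real l / p" and "v = of_real l / q"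
    have uv: "cmod u \<le> 1" "cmod v \<le> 1" using pq pq0 by (auto simp: u_def v_def norm_divide)
    have "cmod (u - v) = \<bar>l\<bar> * (2 * \<eta>) / (cmod p * cmod q)"
    proof -
      have "u - v = of_real l * (q - p) / (p * q)" using pq0 by (simp add: u_def v_def field_simps)
      moreover have "cmod (q - p) = 2 * \<eta>" using \<eta> by (simp add: p_def q_def cmod_def real_sqrt_mult)
      ultimately show ?thesis by (simp add: norm_mult norm_divide)
    qed
    also have "\<dots> \<le> \<bar>l\<bar> * (2 * \<eta>) / (\<bar>l\<bar> * \<bar>l\<bar>)"
    proof -
      have pos: "0 < \<bar>l\<bar> * \<bar>l\<bar>" by (rule mult_pos_pos[OF l0 l0])
      have le: "\<bar>l\<bar> * \<bar>l\<bar> \<le> cmod p * cmod q" by (rule mult_mono[OF pq]) auto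
      show ?thesis
        by (rule divide_left_mono[OF le _ mult_pos_pos[OF less_le_trans[OF pos le] pos]]) (use \<eta> in auto)
    qed
    also have "\<dots> = 2 * \<eta> / \<bar>l\<bar>" by (rule mult_divide_mult_cancel_left) (use l0 in simp)
    finally have uv': "cmod (u - v) \<le> 2 * \<eta> / \<bar>l\<bar>" .
    have "cmod (u ^ Suc n - v ^ Suc n) \<le> real (Suc n) * cmod (u - v)"
      by (rule norm_power_diff[OF uv])
    also have "\<dots> \<le> real (Suc n) * (2 * \<eta> / \<bar>l\<bar>)" by (intro mult_left_mono uv') auto
    finally have d: "cmod (u ^ Suc n - v ^ Suc n) \<le> real (Suc n) * (2 * \<eta> / \<bar>l\<bar>)" .
    have "1 / p ^ Suc n - 1 / q ^ Suc n = (u ^ Suc n - v ^ Suc n) / of_real l ^ Suc n"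
      using l0 by (simp add: u_def v_def power_divide diff_divide_distrib del: power_Suc)
    then have e: "cmod (1 / p ^ Suc n - 1 / q ^ Suc n) \<le> real (Suc n) * (2 * \<eta> / \<bar>l\<bar>) / \<bar>l\<bar> ^ Suc n"
      using divide_right_mono[OF d, of "\<bar>l\<bar> ^ Suc n"] by (simp only: norm_divide norm_power norm_of_real) simp
    have "cmod (T n) = cmod (f n 0) * cmod (1 / p ^ Suc n - 1 / q ^ Suc n)"
      by (simp add: T_def norm_mult norm_power)
    also have "\<dots> \<le> C0 * \<beta> ^ n * (real (Suc n) * (2 * \<eta> / \<bar>l\<bar>) / \<bar>l\<bar> ^ Suc n)"
      by (intro mult_mono at0 e) (auto intro: order_trans[OF norm_ge_zero at0])
    also have "\<dots> = R n"
      using l0 by (simp add: R_def r_def power_divide power2_eq_square mult_ac flip: abs_mult)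
    finally show ?thesis .
  qed
  have RS: "R sums (2 * C0 * \<eta> / l\<^sup>2 * (1 / (1 - r)\<^sup>2))"
    unfolding R_def by (intro sums_mult geometric_deriv_sums) (use r in simp)
  have "cmod (LBINT t. F t) \<le> 2 * C0 * \<eta> / l\<^sup>2 * (1 / (1 - r)\<^sup>2)"
    using S Tb RS by (metis norm_suminf_le sums_iff)
  also have "\<dots> = 2 * C0 * \<eta> / (\<bar>l\<bar> * (1 - r))\<^sup>2" by (simp add: power_mult_distrib)
  also have "\<bar>l\<bar> * (1 - r) = \<bar>l\<bar> - \<beta>" using l0 by (simp add: r_def right_diff_distrib)
  finally show ?thesis by (simp add: F_def)
qed

text \<open>
  After damping \<open>f 0\<close> by \<open>e^(-\<eta> |t|)\<close>, inversion and the multiplication formula give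
  \<open>2 \<pi> (\<integral> \<psi> k - k 0) = \<integral> K (h - 1)\<close> with the transforms \<open>K\<close> of the damped function \<open>k\<close> and \<open>h\<close> of \<open>\<psi>\<close>. The
  factor \<open>h - 1\<close> vanishes on \<open>(-b, b)\<close>, and outside \<open>K\<close> is \<open>O(\<eta> / (1 + l^2))\<close>.
\<close>

theorem band_limited_reproducing:
  fixes f :: "nat \<Rightarrow> real \<Rightarrow> complex" and \<psi> :: "real \<Rightarrow> complex"
  assumes deriv: "\<And>n t. (f n has_vector_derivative \<i> * f (Suc n) t) (at t)"
    and growth: "\<And>\<eta>. \<eta> > 0 \<Longrightarrow> \<exists>C. \<forall>n t. cmod (f n t) \<le> C * \<beta> ^ n * exp (\<eta> * \<bar>t\<bar>)"
    and \<beta>: "0 \<le> \<beta>" "\<beta> < b"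
    and \<psi>: "integrable lborel \<psi>" and \<psi>f: "integrable lborel (\<lambda>t. \<psi> t * f 0 t)"
    and hat: "\<And>l. \<bar>l\<bar> < b \<Longrightarrow> (LBINT t. \<psi> t * iexp (l * t)) = 1"
  shows "(LBINT t. \<psi> t * f 0 t) = f 0 0"
proof -
  obtain C0 where C0: "\<And>n. cmod (f n 0) \<le> C0 * \<beta> ^ n"
  proof -
    obtain C where "\<And>n t. cmod (f n t) \<le> C * \<beta> ^ n * exp (1 * \<bar>t\<bar>)"
      using growth[OF zero_less_one] by blast
    from this[of _ 0] show ?thesis by (intro that[of C]) simp
  qed
  have C0_nn: "C0 \<ge> 0" using order_trans[OF norm_ge_zero C0[of 0]] by simp
  have contf: "continuous_on UNIV (f 0)"
    by (rule continuous_on_UNIV_of_vector_derivative[OF deriv])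
  define B where "B = (LBINT t. cmod (\<psi> t))"
  define h where "h l = (LBINT t. \<psi> t * iexp (l * t))" for l
  have hB: "cmod (h l) \<le> B" for l
    unfolding h_def B_def by (rule order_trans[OF integral_norm_bound]) (simp add: norm_mult)
  have B_nn: "B \<ge> 0" unfolding B_def by simp
  define D where "D = 2 * C0 * (1 + b\<^sup>2) / (b - \<beta>)\<^sup>2"
  have D_nn: "D \<ge> 0" using C0_nn by (auto simp: D_def intro!: divide_nonneg_nonneg mult_nonneg_nonneg add_nonneg_nonneg)
  define E where "E = (LBINT l. 1 / (1 + l\<^sup>2)) * D * (B + 1)"
  have main: "2 * pi * cmod ((LBINT t. \<psi> t * (f 0 t * exp (- \<eta> * \<bar>t\<bar>))) - f 0 0) \<le> \<eta> * E"
    if \<eta>: "\<eta> > 0" for \<eta> :: real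
  proof -
    obtain C where C: "\<And>n t. cmod (f n t) \<le> C * \<beta> ^ n * exp (\<eta> / 2 * \<bar>t\<bar>)"
      using growth[of "\<eta> / 2"] \<eta> by (meson half_gt_zero)
    have C_nn: "C \<ge> 0" using order_trans[OF norm_ge_zero C[of 0 0]] by simp
    define k where "k t = f 0 t * exp (- \<eta> * \<bar>t\<bar>)" for t
    define K where "K l = (LBINT t. k t * iexp (- l * t))" for l
    have contk: "continuous_on UNIV k" unfolding k_def by (intro continuous_intros contf)
    have [measurable]: "k \<in> borel_measurable borel" by (rule borel_measurable_continuous_onI[OF contk])
    have kb: "cmod (k t) \<le> C * exp (- (\<eta> / 2) * \<bar>t\<bar>)" for t
    proof -
      have "cmod (k t) \<le> C * exp (\<eta> / 2 * \<bar>t\<bar>) * exp (- \<eta> * \<bar>t\<bar>)"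
        using C[of 0 t] by (simp add: k_def norm_mult)
      also have "\<dots> = C * exp (- (\<eta> / 2) * \<bar>t\<bar>)" by (simp add: mult.assoc flip: exp_add)
      finally show ?thesis .
    qed
    have kB: "cmod (k t) \<le> C" for t
    proof -
      have "C * exp (- (\<eta> / 2) * \<bar>t\<bar>) \<le> C" using C_nn \<eta> by (intro mult_right_le_one_le) auto
      then show ?thesis using kb[of t] by linarith
    qed
    have k_int: "integrable lborel k"
      by (rule Bochner_Integration.integrable_bound[where f="\<lambda>t. C * exp (- (\<eta> / 2) * \<bar>t\<bar>)", OF integrable_mult_right[OF integrable_exp_neg_abs]])
         (use \<eta> kb C_nn in auto)
    have [measurable]: "K \<in> borel_measurable borel" unfolding K_def by measurable
    have Kb: "cmod (K l) \<le> \<eta> * D / (1 + l\<^sup>2)" if l: "\<bar>l\<bar> \<ge> b" for l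
    proof -
      have "cmod (K l) \<le> 2 * C0 * \<eta> / (\<bar>l\<bar> - \<beta>)\<^sup>2"
        unfolding K_def k_def
        by (rule carleman_transform_bound[where f=f, OF deriv C C0 \<eta>]) (use l \<beta> k_int in \<open>auto simp: k_def[abs_def]\<close>)
      also have "\<dots> \<le> \<eta> * D / (1 + l\<^sup>2)"
      proof -
        have "(b - \<beta>) * \<bar>l\<bar> \<le> (\<bar>l\<bar> - \<beta>) * b"
          using mult_left_mono[OF l \<beta>(1)] by (simp add: algebra_simps)
        then have a: "((b - \<beta>) * \<bar>l\<bar>)\<^sup>2 \<le> ((\<bar>l\<bar> - \<beta>) * b)\<^sup>2"
          using \<beta> by (intro power_mono) auto
        have a': "(b - \<beta>)\<^sup>2 \<le> (\<bar>l\<bar> - \<beta>)\<^sup>2" using \<beta> l by (intro power_mono) auto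
        have "(b - \<beta>)\<^sup>2 * (1 + l\<^sup>2) \<le> (\<bar>l\<bar> - \<beta>)\<^sup>2 * (1 + b\<^sup>2)"
          using a a' by (simp add: power_mult_distrib distrib_left)
        then have "1 / (\<bar>l\<bar> - \<beta>)\<^sup>2 \<le> (1 + b\<^sup>2) / ((b - \<beta>)\<^sup>2 * (1 + l\<^sup>2))"
          using \<beta> l by (simp add: divide_simps add_pos_nonneg mult.commute sum_power2_eq_zero_iff)
        then have "2 * C0 * \<eta> * (1 / (\<bar>l\<bar> - \<beta>)\<^sup>2) \<le> 2 * C0 * \<eta> * ((1 + b\<^sup>2) / ((b - \<beta>)\<^sup>2 * (1 + l\<^sup>2)))"
          using C0_nn \<eta> by (intro mult_left_mono) auto
        then show ?thesis by (simp add: D_def mult_ac)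
      qed
      finally show ?thesis .
    qed
    have K_int: "integrable lborel K"
    proof (rule Bochner_Integration.integrable_bound)
      show "integrable lborel (\<lambda>l. (LBINT t. cmod (k t)) * indicator {-b..b} l + \<eta> * D / (1 + l\<^sup>2))"
        by (intro Bochner_Integration.integrable_add integrable_mult_right integrable_real_indicator integrable_inverse_1_plus_square_UNIV)
           (auto simp: emeasure_lborel_Icc_eq)
      show "AE l in lborel. norm (K l) \<le> norm ((LBINT t. cmod (k t)) * indicator {-b..b} l + \<eta> * D / (1 + l\<^sup>2))"
      proof (rule AE_I2)
        fix l
        have 0: "0 \<le> \<eta> * D / (1 + l\<^sup>2)" using \<eta> D_nn by (intro divide_nonneg_nonneg) auto
        have 1: "cmod (K l) \<le> (LBINT t. cmod (k t))"
          unfolding K_def by (rule order_trans[OF integral_norm_bound]) (simp add: norm_mult)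
        have 2: "0 \<le> (LBINT t. cmod (k t))" by simp
        show "norm (K l) \<le> norm ((LBINT t. cmod (k t)) * indicator {-b..b} l + \<eta> * D / (1 + l\<^sup>2))"
          using 0 1 2 Kb[of l] by (cases "\<bar>l\<bar> \<le> b") (auto simp: indicator_def abs_le_iff)
      qed
    qed simp
    have inv: "(LBINT l. K l * iexp (1 * l * t)) = complex_of_real (2 * pi) * k t" for t
    proof -
      define k' where "k' u = k (t + 1 * u)" for u
      have eq: "(LBINT u. k' u * iexp (- l * u)) = K l * iexp (1 * l * t)" for l
      proof -
        have "(LBINT u. k u * iexp (- l * u) * iexp (l * t))
            = \<bar>1\<bar> *\<^sub>R (LBINT u. k (t + 1 * u) * iexp (- l * (t + 1 * u)) * iexp (l * t))"
          by (rule lborel_integral_real_affine) simp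
        also have "\<dots> = (LBINT u. k' u * iexp (- l * u))"
          by (simp add: k'_def mult.assoc algebra_simps flip: exp_add)
        finally show ?thesis by (simp add: K_def)
      qed
      have "(LBINT l. LBINT u. k' u * iexp (- l * u)) = complex_of_real (2 * pi) * k' 0"
      proof (rule fourier_inversion_at_zero)
        show "integrable lborel k'" unfolding k'_def by (rule lborel_integrable_real_affine[OF k_int]) simp
        show "continuous_on UNIV k'" unfolding k'_def
          by (intro continuous_on_compose2[OF contk] continuous_intros) auto
        show "cmod (k' u) \<le> C" for u by (simp add: k'_def kB)
        show "integrable lborel (\<lambda>l. LBINT t. k' t * iexp (- l * t))"
          unfolding eq using integrable_mult_unimodular[OF K_int, of t] by (simp add: mult.commute)
      qed
      then show ?thesis unfolding eq by (simp add: k'_def)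
    qed
    have "complex_of_real (2 * pi) * (LBINT t. \<psi> t * k t) = (LBINT t. \<psi> t * (LBINT l. K l * iexp (1 * l * t)))"
    proof -
      have "(LBINT t. \<psi> t * (complex_of_real (2 * pi) * k t)) = (LBINT t. complex_of_real (2 * pi) * (\<psi> t * k t))"
        by (intro Bochner_Integration.integral_cong refl) (rule mult.left_commute)
      then show ?thesis unfolding inv by simp
    qed
    also have "\<dots> = (LBINT l. K l * (LBINT t. \<psi> t * iexp (1 * l * t)))"
      by (rule fourier_multiplication_formula[OF \<psi> K_int])
    also have "\<dots> = (LBINT l. K l * h l)" by (simp add: h_def)
    finally have e1: "complex_of_real (2 * pi) * (LBINT t. \<psi> t * k t) = (LBINT l. K l * h l)" .
    have e2: "complex_of_real (2 * pi) * f 0 0 = (LBINT l. K l)"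
      using inv[of 0] by (simp add: k_def)
    have [measurable]: "\<psi> \<in> borel_measurable borel" using \<psi> by auto
    have [measurable]: "h \<in> borel_measurable borel" unfolding h_def by measurable
    have Kh_int: "integrable lborel (\<lambda>l. K l * h l)"
      by (rule Bochner_Integration.integrable_bound[OF integrable_mult_right[OF K_int, of "of_real B"]])
         (auto simp: norm_mult B_nn mult.commute[of B] intro!: mult_left_mono hB)
    have "complex_of_real (2 * pi) * ((LBINT t. \<psi> t * k t) - f 0 0) = (LBINT l. K l * h l - K l)"
      unfolding right_diff_distrib e1 e2 using Kh_int K_int by simp
    also have "cmod \<dots> \<le> (LBINT l. \<eta> * D / (1 + l\<^sup>2) * (B + 1))"
    proof (rule Bochner_Integration.integral_norm_bound_integral)
      show "integrable lborel (\<lambda>l. K l * h l - K l)" using Kh_int K_int by simp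
      show "integrable lborel (\<lambda>l. \<eta> * D / (1 + l\<^sup>2) * (B + 1))"
        by (intro integrable_mult_left integrable_inverse_1_plus_square_UNIV)
      fix l
      have 0: "0 \<le> \<eta> * D / (1 + l\<^sup>2)" using \<eta> D_nn by (intro divide_nonneg_nonneg) auto
      show "norm (K l * h l - K l) \<le> \<eta> * D / (1 + l\<^sup>2) * (B + 1)"
      proof (cases "\<bar>l\<bar> < b")
        case True
        then have "h l = 1" unfolding h_def by (rule hat)
        then show ?thesis using mult_nonneg_nonneg[OF 0, of "B + 1"] B_nn by simp
      next
        case False
        have "norm (K l * h l - K l) = cmod (K l) * cmod (h l - 1)"
          by (simp add: right_diff_distrib flip: norm_mult)
        also have "\<dots> \<le> \<eta> * D / (1 + l\<^sup>2) * (B + 1)"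
          using Kb[of l] False 0 hB[of l] norm_triangle_ineq4[of "h l" 1]
          by (intro mult_mono) auto
        finally show ?thesis .
      qed
    qed
    also have "\<dots> = \<eta> * E"
    proof -
      have "(LBINT l. \<eta> * D / (1 + l\<^sup>2) * (B + 1)) = (LBINT l. (\<eta> * D * (B + 1)) * (1 / (1 + l\<^sup>2)))"
        by (intro Bochner_Integration.integral_cong) auto
      also have "\<dots> = \<eta> * E" unfolding E_def by (subst integral_mult_right_zero) simp
      finally show ?thesis .
    qed
    finally show ?thesis unfolding k_def[symmetric] by (simp add: norm_mult)
  qed
  define d where "d n = 1 / real (Suc n)" for n
  have d: "d n > 0" for n by (simp add: d_def)
  have d_lim: "d \<longlonglongrightarrow> 0" unfolding d_def using LIMSEQ_inverse_real_of_nat by (simp add: inverse_eq_divide)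
  have [measurable]: "\<psi> \<in> borel_measurable borel" "f 0 \<in> borel_measurable borel"
    using \<psi> borel_measurable_continuous_onI[OF contf] by auto
  have "(\<lambda>n. LBINT t. \<psi> t * (f 0 t * exp (- d n * \<bar>t\<bar>))) \<longlonglongrightarrow> (LBINT t. \<psi> t * f 0 t)"
  proof (rule integral_dominated_convergence[where w="\<lambda>t. norm (\<psi> t * f 0 t)"])
    show "AE t in lborel. (\<lambda>n. \<psi> t * (f 0 t * exp (- d n * \<bar>t\<bar>))) \<longlonglongrightarrow> \<psi> t * f 0 t"
    proof (rule AE_I2)
      fix t
      have "(\<lambda>n. \<psi> t * (f 0 t * exp (- d n * \<bar>t\<bar>))) \<longlonglongrightarrow> \<psi> t * (f 0 t * complex_of_real (exp (- 0 * \<bar>t\<bar>)))"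
        by (intro tendsto_intros d_lim)
      then show "(\<lambda>n. \<psi> t * (f 0 t * exp (- d n * \<bar>t\<bar>))) \<longlonglongrightarrow> \<psi> t * f 0 t" by simp
    qed
    show "AE t in lborel. norm (\<psi> t * (f 0 t * exp (- d n * \<bar>t\<bar>))) \<le> norm (\<psi> t * f 0 t)" for n
    proof (rule AE_I2)
      fix t
      have "exp (- d n * \<bar>t\<bar>) \<le> 1" using d[of n] by simp
      then show "norm (\<psi> t * (f 0 t * exp (- d n * \<bar>t\<bar>))) \<le> norm (\<psi> t * f 0 t)"
        by (simp add: norm_mult mult_left_le mult_left_mono)
    qed
  qed (use \<psi>f in auto)
  moreover have "(\<lambda>n. LBINT t. \<psi> t * (f 0 t * exp (- d n * \<bar>t\<bar>))) \<longlonglongrightarrow> f 0 0"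
  proof (rule LIM_zero_cancel, rule Lim_null_comparison)
    show "\<forall>\<^sub>F n in sequentially. norm ((LBINT t. \<psi> t * (f 0 t * exp (- d n * \<bar>t\<bar>))) - f 0 0) \<le> d n * E / (2 * pi)"
      using main[OF d] by (intro always_eventually allI) (simp add: field_simps)
    have "(\<lambda>n. d n * E / (2 * pi)) \<longlonglongrightarrow> 0 * E / (2 * pi)" by (intro tendsto_intros d_lim) simp
    then show "(\<lambda>n. d n * E / (2 * pi)) \<longlonglongrightarrow> 0" by simp
  qed
  ultimately show ?thesis by (rule LIMSEQ_unique)
qed

section \<open>Dyadic majorants of subadditive functions\<close>

lemma sum_quarter_powers_le: "(\<Sum>k\<in>{m..<n}. (1/4::real) ^ k) \<le> 4/3 * (1/4) ^ m"
proof (cases "m \<le> n")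
  case True
  then have "(\<Sum>k\<in>{m..<n}. (1/4::real) ^ k) = 4/3 * ((1/4) ^ m - (1/4) ^ n)"
    by (induction n rule: dec_induct) (simp_all add: algebra_simps)
  then show ?thesis by simp
qed simp

lemma exists_le_power_2: "\<exists>k. (x::real) \<le> 2 ^ k"
  using real_arch_pow[of 2 x] by (auto intro: less_imp_le)

text \<open>
  Averaging \<open>\<omega> s \<le> \<omega> u + \<omega> (s - u)\<close> over \<open>u \<in> [0, T]\<close> bounds \<open>\<omega>\<close> on \<open>[-T, T]\<close> by a multiple of its mean over
  \<open>[-2 T, 2 T]\<close>. For \<open>T = 2^k\<close> these means, divided by \<open>2^k\<close>, have a finite sum because
  \<open>\<Sum> 4^(-k)\<close> over all \<open>k\<close> with \<open>|t| \<le> 2^(k+1)\<close> is \<open>O(1 / (1 + t^2))\<close>.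
\<close>

lemma subadditive_dyadic_majorant:
  fixes \<omega> :: "real \<Rightarrow> real"
  assumes nonneg: "\<And>t. 0 \<le> \<omega> t" and subadd: "\<And>s t. \<omega> (s + t) \<le> \<omega> s + \<omega> t"
    and int: "integrable lborel (\<lambda>t. \<omega> t / (1 + t\<^sup>2))"
  shows "\<exists>A. (\<forall>k s. \<bar>s\<bar> \<le> 2 ^ k \<longrightarrow> \<omega> s \<le> A k) \<and> summable (\<lambda>k. A k / 2 ^ k)"
proof -
  have "(\<lambda>t. \<omega> t / (1 + t\<^sup>2) * (1 + t\<^sup>2)) \<in> borel_measurable borel"
    using borel_measurable_integrable[OF int] by (intro borel_measurable_times) auto
  moreover have "(\<lambda>t. \<omega> t / (1 + t\<^sup>2) * (1 + t\<^sup>2)) = \<omega>"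
    by (auto simp: fun_eq_iff add_nonneg_eq_0_iff)
  ultimately have [measurable]: "\<omega> \<in> borel_measurable borel" by simp
  define W where "W T = (LBINT t. indicator {-T..T} t * \<omega> t)" for T
  have loc: "integrable lborel (\<lambda>t. indicator {-T..T} t * \<omega> t)" for T
  proof (rule Bochner_Integration.integrable_bound)
    show "integrable lborel (\<lambda>t. (1 + T\<^sup>2) * (\<omega> t / (1 + t\<^sup>2)))" by (intro integrable_mult_right int)
    show "AE t in lborel. norm (indicator {-T..T} t * \<omega> t) \<le> norm ((1 + T\<^sup>2) * (\<omega> t / (1 + t\<^sup>2)))"
    proof (rule AE_I2)
      fix t
      show "norm (indicator {-T..T} t * \<omega> t) \<le> norm ((1 + T\<^sup>2) * (\<omega> t / (1 + t\<^sup>2)))"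
      proof (cases "t \<in> {-T..T}")
        case True
        then have "t\<^sup>2 \<le> T\<^sup>2" by (intro power2_le_iff_abs_le[THEN iffD2]) auto
        then have "\<omega> t * (1 + t\<^sup>2) \<le> (1 + T\<^sup>2) * \<omega> t"
          using nonneg[of t] by (subst mult.commute) (intro mult_right_mono, auto)
        then have "\<omega> t \<le> (1 + T\<^sup>2) * \<omega> t / (1 + t\<^sup>2)"
          by (subst pos_le_divide_eq) (auto intro: add_pos_nonneg)
        then show ?thesis using True nonneg[of t] by simp
      qed simp
    qed
  qed measurable
  have bound: "T * \<omega> s \<le> 2 * W (2 * T)" if T: "T > 0" and s: "\<bar>s\<bar> \<le> T" for s T
  proof -
    have refl_eq: "(LBINT u. indicator {0..T} u * \<omega> (s - u)) = (LBINT v. indicator {0..T} (s - v) * \<omega> v)"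
      using lborel_integral_real_affine[of "-1" "\<lambda>v. indicator {0..T} (s - v) * \<omega> v" s] by simp
    have i1: "integrable lborel (\<lambda>u. indicator {0..T} u * \<omega> u)"
      by (rule Bochner_Integration.integrable_bound[OF loc[of "T"]]) (auto simp: indicator_def)
    have i2': "integrable lborel (\<lambda>v. indicator {0..T} (s - v) * \<omega> v)"
      by (rule Bochner_Integration.integrable_bound[OF loc[of "2 * T"]]) (use s in \<open>auto simp: indicator_def\<close>)
    have i2: "integrable lborel (\<lambda>u. indicator {0..T} u * \<omega> (s - u))"
      using lborel_integrable_real_affine[OF i2', of "-1" s] by simp
    have "T * \<omega> s = (LBINT u. indicator {0..T} u * \<omega> s)"
      using T by simp
    also have "\<dots> \<le> (LBINT u. indicator {0..T} u * \<omega> u + indicator {0..T} u * \<omega> (s - u))"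
    proof (rule integral_mono)
      show "integrable lborel (\<lambda>u. indicator {0..T} u * \<omega> s)"
        by (intro integrable_mult_left integrable_real_indicator) (auto simp: emeasure_lborel_Icc_eq)
      show "integrable lborel (\<lambda>u. indicator {0..T} u * \<omega> u + indicator {0..T} u * \<omega> (s - u))"
        by (intro Bochner_Integration.integrable_add i1 i2)
      show "indicator {0..T} u * \<omega> s \<le> indicator {0..T} u * \<omega> u + indicator {0..T} u * \<omega> (s - u)" for u
        using subadd[of u "s - u"] by (auto simp: indicator_def)
    qed
    also have "\<dots> = (LBINT u. indicator {0..T} u * \<omega> u) + (LBINT v. indicator {0..T} (s - v) * \<omega> v)"
      using i1 i2 by (simp add: refl_eq)
    also have "\<dots> \<le> W (2 * T) + W (2 * T)"
      unfolding W_def using T s nonneg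
      by (intro add_mono integral_mono i1 i2' loc) (auto simp: indicator_def)
    finally show ?thesis by simp
  qed
  define A where "A k = 2 * W (2 * 2 ^ k) / 2 ^ k" for k :: nat
  have A: "\<omega> s \<le> A k" if "\<bar>s\<bar> \<le> 2 ^ k" for k s
    using bound[OF _ that] by (simp add: A_def field_simps)
  have "summable (\<lambda>k. A k / 2 ^ k)"
  proof (rule summableI_nonneg_bounded)
    show "0 \<le> A k / 2 ^ k" for k
      using order_trans[OF nonneg A[of 0 k]] by simp
    fix n
    define c :: "real \<Rightarrow> real" where "c t = (\<Sum>k<n. (1/4) ^ k * indicator {-(2 * 2 ^ k)..2 * 2 ^ k} t)" for t :: real
    have c: "c t * (1 + t\<^sup>2) \<le> 20 / 3" for t
    proof -
      \<comment> \<open>Only the indices \<open>k \<ge> m\<close> contribute to \<open>c t\<close>, and \<open>|t|\<close> is at most \<open>2 * 2^m\<close>.\<close>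
      define m where "m = (LEAST k. \<bar>t\<bar> / 2 \<le> 2 ^ k)"
      have m: "\<bar>t\<bar> / 2 \<le> 2 ^ m" unfolding m_def by (rule LeastI_ex) (rule exists_le_power_2)
      have small: "\<not> \<bar>t\<bar> / 2 \<le> 2 ^ k" if "k < m" for k using that not_less_Least unfolding m_def by blast
      have "c t \<le> (\<Sum>k\<in>{m..<n}. (1/4) ^ k)"
      proof -
        have "c t = (\<Sum>k\<in>{m..<n}. (1/4) ^ k * indicator {-(2 * 2 ^ k)..2 * 2 ^ k} t)"
          unfolding c_def
        proof (rule sum.mono_neutral_right)
          show "\<forall>k\<in>{..<n} - {m..<n}. (1/4) ^ k * indicator {-(2 * 2 ^ k)..2 * 2 ^ k} t = (0::real)"
          proof
            fix k assume "k \<in> {..<n} - {m..<n}"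
            then have "\<not> \<bar>t\<bar> / 2 \<le> 2 ^ k" by (intro small) auto
            then have "t \<notin> {-(2 * 2 ^ k)..2 * 2 ^ k}" by auto
            then show "(1/4) ^ k * indicator {-(2 * 2 ^ k)..2 * 2 ^ k} t = (0::real)" by simp
          qed
        qed auto
        also have "\<dots> \<le> (\<Sum>k\<in>{m..<n}. (1/4) ^ k)" by (intro sum_mono) (auto simp: indicator_def)
        finally show ?thesis .
      qed
      also have "\<dots> \<le> 4/3 * (1/4) ^ m" by (rule sum_quarter_powers_le)
      finally have ct: "c t \<le> 4/3 * (1/4) ^ m" .
      have "t\<^sup>2 \<le> (2 * 2 ^ m)\<^sup>2" using m by (intro power2_le_iff_abs_le[THEN iffD2]) auto
      also have "\<dots> = 4 * 4 ^ m" by (simp add: power2_eq_square flip: power_mult_distrib)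
      finally have "1 + t\<^sup>2 \<le> 5 * 4 ^ m" using one_le_power[of "4::real" m] by linarith
      then have "c t * (1 + t\<^sup>2) \<le> (4/3 * (1/4) ^ m) * (5 * 4 ^ m)"
        using ct by (intro mult_mono) auto
      also have "\<dots> = 20 / 3" by (simp add: power_one_over)
      finally show ?thesis .
    qed
    have "(\<Sum>k<n. A k / 2 ^ k) = (\<Sum>k<n. LBINT t. 2 * (1/4) ^ k * (indicator {-(2 * 2 ^ k)..2 * 2 ^ k} t * \<omega> t))"
    proof (intro sum.cong refl)
      fix k
      have "(2::real) ^ k * 2 ^ k = 4 ^ k" by (simp flip: power_mult_distrib)
      then show "A k / 2 ^ k = (LBINT t. 2 * (1/4) ^ k * (indicator {-(2 * 2 ^ k)..2 * 2 ^ k} t * \<omega> t))"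
        by (simp add: A_def W_def power_one_over)
    qed
    also have "\<dots> = (LBINT t. (\<Sum>k<n. 2 * (1/4) ^ k * (indicator {-(2 * 2 ^ k)..2 * 2 ^ k} t * \<omega> t)))"
      by (rule Bochner_Integration.integral_sum[symmetric]) (intro integrable_mult_right loc)
    also have "\<dots> \<le> (LBINT t. 40 / 3 * (\<omega> t / (1 + t\<^sup>2)))"
    proof (rule integral_mono)
      show "integrable lborel (\<lambda>t. \<Sum>k<n. 2 * (1/4) ^ k * (indicator {-(2 * 2 ^ k)..2 * 2 ^ k} t * \<omega> t))"
        by (intro Bochner_Integration.integrable_sum integrable_mult_right loc)
      show "integrable lborel (\<lambda>t. 40 / 3 * (\<omega> t / (1 + t\<^sup>2)))" by (intro integrable_mult_right int)
      fix t
      have "(\<Sum>k<n. 2 * (1/4) ^ k * (indicator {-(2 * 2 ^ k)..2 * 2 ^ k} t * \<omega> t)) = 2 * \<omega> t * c t"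
        unfolding c_def sum_distrib_left by (intro sum.cong refl) (simp only: mult_ac)
      also have "\<dots> \<le> 2 * \<omega> t * (20 / 3 / (1 + t\<^sup>2))"
      proof (rule mult_left_mono)
        show "c t \<le> 20 / 3 / (1 + t\<^sup>2)"
          using c[of t] by (subst pos_le_divide_eq) (auto intro: add_pos_nonneg)
      qed (use nonneg[of t] in simp)
      finally show "(\<Sum>k<n. 2 * (1/4) ^ k * (indicator {-(2 * 2 ^ k)..2 * 2 ^ k} t * \<omega> t)) \<le> 40 / 3 * (\<omega> t / (1 + t\<^sup>2))"
        by simp
    qed
    finally show "(\<Sum>k<n. A k / 2 ^ k) \<le> (LBINT t. 40 / 3 * (\<omega> t / (1 + t\<^sup>2)))" .
  qed
  then show ?thesis using A by blast
qed

lemma dyadic_majorant_sublinear: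
  fixes \<omega> A :: "_ \<Rightarrow> real"
  assumes A: "\<And>k s. \<bar>s\<bar> \<le> 2 ^ k \<Longrightarrow> \<omega> s \<le> A k" and sum: "summable (\<lambda>k. A k / 2 ^ k)" and \<eta>: "\<eta> > 0"
  shows "\<exists>C. \<forall>t. \<omega> t \<le> C + \<eta> * \<bar>t\<bar>"
proof -
  have "(\<lambda>k. A k / 2 ^ k) \<longlonglongrightarrow> 0" by (rule summable_LIMSEQ_zero[OF sum])
  then have "\<forall>\<^sub>F k in sequentially. A k / 2 ^ k < \<eta> / 2" by (rule order_tendstoD) (use \<eta> in simp)
  then obtain K where K: "\<And>k. k \<ge> K \<Longrightarrow> A k / 2 ^ k < \<eta> / 2" by (auto simp: eventually_sequentially)
  have "\<omega> t \<le> \<bar>A K\<bar> + \<eta> * \<bar>t\<bar>" for t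
  proof (cases "\<bar>t\<bar> \<le> 2 ^ K")
    case True
    have "\<omega> t \<le> A K" by (rule A[OF True])
    moreover have "0 \<le> \<eta> * \<bar>t\<bar>" using \<eta> by simp
    ultimately show ?thesis by linarith
  next
    case False
    define m where "m = (LEAST k. \<bar>t\<bar> \<le> 2 ^ k)"
    have m: "\<bar>t\<bar> \<le> 2 ^ m" unfolding m_def by (rule LeastI_ex) (rule exists_le_power_2)
    have Km: "K < m"
    proof (rule ccontr)
      assume "\<not> K < m"
      then have "(2::real) ^ m \<le> 2 ^ K" by (intro power_increasing) auto
      then show False using m False by linarith
    qed
    then obtain j where j: "m = Suc j" by (cases m) auto
    have "\<not> \<bar>t\<bar> \<le> 2 ^ j" using j not_less_Least[of j "\<lambda>k. \<bar>t\<bar> \<le> 2 ^ k"] by (simp add: m_def)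
    then have "2 ^ m \<le> 2 * \<bar>t\<bar>" by (simp add: j)
    have "\<omega> t \<le> A m" by (rule A[OF m])
    also have "A m \<le> \<eta> / 2 * 2 ^ m" using K[of m] Km by (simp add: field_simps)
    also have "\<dots> \<le> \<eta> / 2 * (2 * \<bar>t\<bar>)" using \<eta> \<open>2 ^ m \<le> 2 * \<bar>t\<bar>\<close> by (intro mult_left_mono) auto
    finally show ?thesis by simp
  qed
  then show ?thesis by blast
qed

text \<open>
  For \<open>2^k \<le> |x| \<le> 2^(k+1)\<close> each factor \<open>sqrt (1 + (x / 2^k)^2)\<close> is at least \<open>sqrt 2\<close>, so that about
  \<open>2 A (k+1) / ln 2\<close> copies of the parameter \<open>2^(-k)\<close> suffice; the parameters stay summable because
  \<open>A k / 2^k\<close> is summable.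
\<close>

lemma dyadic_majorant_product:
  fixes \<omega> A :: "_ \<Rightarrow> real"
  assumes A: "\<And>k s. \<bar>s\<bar> \<le> 2 ^ k \<Longrightarrow> \<omega> s \<le> A k" and sum: "summable (\<lambda>k. A k / 2 ^ k)"
    and nonneg: "\<And>t. 0 \<le> \<omega> t"
  shows "\<exists>(a::nat \<Rightarrow> real) C. (\<forall>k. 0 < a k) \<and> summable a \<and> C \<ge> 0 \<and>
    (\<forall>x. \<exists>N. exp (\<omega> x) \<le> C * (\<Prod>k<N. sqrt (1 + (a k * x)\<^sup>2)))"
proof -
  have A_nn: "A k \<ge> 0" for k using order_trans[OF nonneg A[of 0 k]] by simp
  define n where "n k = nat \<lceil>2 * A (Suc k) / ln 2\<rceil>" for k
  have n: "2 * A (Suc k) / ln 2 \<le> real (n k)" "real (n k) \<le> 2 * A (Suc k) / ln 2 + 1" for k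
  proof -
    have "0 \<le> 2 * A (Suc k) / ln 2" using A_nn[of "Suc k"] by simp
    then show "2 * A (Suc k) / ln 2 \<le> real (n k)" "real (n k) \<le> 2 * A (Suc k) / ln 2 + 1"
      unfolding n_def by linarith+
  qed
  \<comment> \<open>The pair \<open>(k, j)\<close> stands for the \<open>j\<close>-th copy of \<open>2^(-k)\<close>; pairs beyond the multiplicity \<open>n k\<close> get tiny positive values.\<close>
  define e where "e p = (case p of (k, j) \<Rightarrow> if j < n k then (1/2) ^ k else (1/2) ^ k * (1/2::real) ^ j)" for p
  define a where "a m = e (prod_decode m)" for m
  have e_pos: "e p > 0" for p by (auto simp: e_def split: prod.splits)
  have row: "(\<Sum>j<J. e (k, j)) \<le> (1/2) ^ k * (real (n k) + 2)" for k J
  proof -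
    have "(\<Sum>j<J. e (k, j)) \<le> (\<Sum>j<J. (1/2) ^ k * (of_bool (j < n k) + (1/2::real) ^ j))"
      by (intro sum_mono) (auto simp: e_def)
    also have "\<dots> = (1/2) ^ k * ((\<Sum>j<J. of_bool (j < n k)) + (\<Sum>j<J. (1/2::real) ^ j))"
      by (simp add: sum_distrib_left sum.distrib distrib_left)
    also have "\<dots> \<le> (1/2) ^ k * (real (n k) + 2)"
    proof (intro mult_left_mono add_mono)
      have "(\<Sum>j<J. of_bool (j < n k) :: real) = real (card ({..<J} \<inter> {j. j < n k}))"
        by (subst sum_of_bool_eq) (auto simp: Int_def)
      also have "card ({..<J} \<inter> {j. j < n k}) \<le> card {..<n k}" by (intro card_mono) auto
      finally show "(\<Sum>j<J. of_bool (j < n k) :: real) \<le> real (n k)" by simp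
      show "(\<Sum>j<J. (1/2::real) ^ j) \<le> 2"
        using sum_le_suminf[OF summable_geometric[of "1/2::real"], of "{..<J}"] by (simp add: suminf_geometric)
    qed simp
    finally show ?thesis .
  qed
  have rows: "summable (\<lambda>k. (1/2) ^ k * (real (n k) + 2))"
  proof (rule summable_comparison_test')
    have "summable (\<lambda>k. A (Suc k) / 2 ^ Suc k)" using sum by (subst summable_Suc_iff)
    then show "summable (\<lambda>k. 4 / ln 2 * (A (Suc k) / 2 ^ Suc k) + 3 * (1/2) ^ k)"
      by (intro summable_add summable_mult summable_geometric) auto
    fix k
    have "(1/2) ^ k * (real (n k) + 2) \<le> (1/2) ^ k * (2 * A (Suc k) / ln 2 + 3)"
      using n(2)[of k] by (intro mult_left_mono) auto
    also have "\<dots> = 4 / ln 2 * (A (Suc k) / 2 ^ Suc k) + 3 * (1/2) ^ k"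
      by (simp add: power_one_over field_simps)
    finally show "norm ((1/2) ^ k * (real (n k) + 2)) \<le> 4 / ln 2 * (A (Suc k) / 2 ^ Suc k) + 3 * (1/2) ^ k"
      by simp
  qed
  have "summable a"
  proof (rule summableI_nonneg_bounded)
    show "0 \<le> a m" for m using e_pos by (simp add: a_def less_imp_le)
    fix N
    define F where "F = prod_decode ` {..<N}"
    have finF: "finite F" by (simp add: F_def)
    obtain K J where KJ: "F \<subseteq> {..<K} \<times> {..<J}"
    proof -
      have "F \<subseteq> {..<Suc (Max (insert 0 (fst ` F)))} \<times> {..<Suc (Max (insert 0 (snd ` F)))}"
      proof
        fix p assume "p \<in> F"
        then have "fst p \<le> Max (insert 0 (fst ` F))" "snd p \<le> Max (insert 0 (snd ` F))"
          using finF by (auto intro!: Max_ge)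
        then show "p \<in> {..<Suc (Max (insert 0 (fst ` F)))} \<times> {..<Suc (Max (insert 0 (snd ` F)))}"
          by (cases p) (simp add: less_Suc_eq_le)
      qed
      then show ?thesis by (rule that)
    qed
    have "(\<Sum>m<N. a m) = sum e F"
      unfolding F_def a_def by (subst sum.reindex) (auto intro: inj_on_subset[OF inj_prod_decode])
    also have "\<dots> \<le> sum e ({..<K} \<times> {..<J})"
      using KJ e_pos by (intro sum_mono2) (auto simp: less_imp_le)
    also have "\<dots> = (\<Sum>k<K. \<Sum>j<J. e (k, j))" by (simp add: sum.cartesian_product)
    also have "\<dots> \<le> (\<Sum>k<K. (1/2) ^ k * (real (n k) + 2))" by (intro sum_mono row)
    also have "\<dots> \<le> (\<Sum>k. (1/2) ^ k * (real (n k) + 2))"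
      by (intro sum_le_suminf rows) auto
    finally show "(\<Sum>m<N. a m) \<le> (\<Sum>k. (1/2) ^ k * (real (n k) + 2))" .
  qed
  moreover have "\<exists>N. exp (\<omega> x) \<le> exp (A 0) * (\<Prod>m<N. sqrt (1 + (a m * x)\<^sup>2))" for x
  proof (cases "\<bar>x\<bar> \<le> 1")
    case True
    then show ?thesis using A[of x 0] by (intro exI[of _ 0]) simp
  next
    case False
    define m where "m = (LEAST k. \<bar>x\<bar> \<le> 2 ^ k)"
    have m: "\<bar>x\<bar> \<le> 2 ^ m" unfolding m_def by (rule LeastI_ex) (rule exists_le_power_2)
    with False have "m \<noteq> 0" by (intro notI) simp
    then obtain k where k: "m = Suc k" by (cases m) auto
    have "\<not> \<bar>x\<bar> \<le> 2 ^ k" using k not_less_Least[of k "\<lambda>k. \<bar>x\<bar> \<le> 2 ^ k"] by (simp add: m_def)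
    then have xk: "2 ^ k \<le> \<bar>x\<bar>" by simp
    define S where "S = (\<lambda>j. prod_encode (k, j)) ` {..<n k}"
    have finS: "finite S" by (simp add: S_def)
    have cardS: "card S = n k" unfolding S_def by (subst card_image) (auto simp: inj_on_def)
    obtain N where N: "S \<subseteq> {..<N}" using finite_nat_iff_bounded finS by blast
    have big: "sqrt 2 \<le> sqrt (1 + (a i * x)\<^sup>2)" if "i \<in> S" for i
    proof -
      have "a i = (1/2) ^ k" using that by (auto simp: S_def a_def e_def)
      then have "\<bar>a i * x\<bar> = \<bar>x\<bar> / 2 ^ k" by (simp add: abs_mult power_one_over)
      then have "1 \<le> \<bar>a i * x\<bar>" using xk by (simp add: le_divide_eq)
      then have "1\<^sup>2 \<le> (a i * x)\<^sup>2" by (intro power2_le_iff_abs_le[THEN iffD2] abs_le_square_iff[THEN iffD1]) auto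
      then show ?thesis by simp
    qed
    have "exp (\<omega> x) \<le> exp (A (Suc k))" using A[OF m] by (simp add: k)
    also have "\<dots> \<le> exp (real (n k) * (ln 2 / 2))" using n(1)[of k] by (simp add: field_simps)
    also have "\<dots> = sqrt 2 ^ n k"
    proof -
      have "ln (sqrt 2) = ln 2 / (2::real)" by (rule ln_sqrt) simp
      then have "exp (ln 2 / 2) = exp (ln (sqrt (2::real)))" by (simp only:)
      then have "exp (ln 2 / 2) = sqrt (2::real)" by simp
      then show ?thesis by (simp only: exp_of_nat_mult)
    qed
    also have "\<dots> = (\<Prod>i\<in>S. sqrt 2)" by (simp add: cardS)
    also have "\<dots> \<le> (\<Prod>i\<in>S. sqrt (1 + (a i * x)\<^sup>2))" using big by (intro prod_mono) auto
    also have "\<dots> \<le> (\<Prod>i<N. sqrt (1 + (a i * x)\<^sup>2))" using N by (intro prod_mono2) auto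
    also have "\<dots> \<le> exp (A 0) * (\<Prod>i<N. sqrt (1 + (a i * x)\<^sup>2))"
      using A_nn[of 0] by (intro mult_right_mono[of 1 "exp (A 0)", simplified] prod_nonneg) auto
    finally show ?thesis by blast
  qed
  moreover have "0 < a k" for k by (simp add: a_def e_pos)
  ultimately show ?thesis by (intro exI[of _ a] exI[of _ "exp (A 0)"]) auto
qed

section \<open>Vector-valued integrals over the real line\<close>

lemma has_integral_real_line_shift:
  fixes f :: "real \<Rightarrow> 'b::banach"
  assumes "(f has_integral I) UNIV"
  shows "((\<lambda>t. f (t + c)) has_integral I) UNIV"
  unfolding has_integral_alt'
proof (intro conjI allI impI)
  have f: "\<And>a b. f integrable_on cbox a b"
    "\<And>e. e > 0 \<Longrightarrow> \<exists>B>0. \<forall>a b. ball 0 B \<subseteq> cbox a b \<longrightarrow> norm (integral (cbox a b) f - I) < e"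
    using assms unfolding has_integral_alt' by auto
  have box: "((\<lambda>t. f (t + c)) has_integral integral {a + c..b + c} f) {a..b}" for a b
    using has_integral_shift_real_ivl[of f "integral {a + c..b + c} f" "a + c" "b + c" c] f(1)[of "a + c" "b + c"]
    by (simp add: has_integral_integral)
  show "(\<lambda>x. if x \<in> UNIV then f (x + c) else 0) integrable_on cbox a b" for a b
    using box[of a b] by (auto simp: integrable_on_def)
  fix e :: real assume "e > 0"
  then obtain B where B: "B > 0" "\<And>a b. ball 0 B \<subseteq> cbox a b \<Longrightarrow> norm (integral (cbox a b) f - I) < e"
    using f(2) by blast
  show "\<exists>B>0. \<forall>a b. ball 0 B \<subseteq> cbox a b \<longrightarrow>
      norm (integral (cbox a b) (\<lambda>x. if x \<in> UNIV then f (x + c) else 0) - I) < e"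
  proof (intro exI[of _ "B + \<bar>c\<bar>"] conjI allI impI)
    show "0 < B + \<bar>c\<bar>" using B(1) by linarith
    fix a b :: real assume sub: "ball 0 (B + \<bar>c\<bar>) \<subseteq> cbox a b"
    have "ball 0 B \<subseteq> cbox (a + c) (b + c)"
    proof
      fix x :: real assume "x \<in> ball 0 B"
      then have "x - c \<in> ball 0 (B + \<bar>c\<bar>)" by (auto simp: dist_real_def)
      then have "x - c \<in> cbox a b" using sub by blast
      then show "x \<in> cbox (a + c) (b + c)" by auto
    qed
    then show "norm (integral (cbox a b) (\<lambda>x. if x \<in> UNIV then f (x + c) else 0) - I) < e"
      using B(2) integral_unique[OF box[of a b]] by simp
  qed
qed

text \<open>
  Existence follows from the Cauchy criterion, as the integrals of \<open>h\<close> outside large intervals are small.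
\<close>

lemma dominated_integral_real_line:
  fixes F :: "real \<Rightarrow> 'b::banach"
  assumes cont: "continuous_on UNIV F" and h: "integrable lborel h" and le: "\<And>t. norm (F t) \<le> h t"
  shows "F integrable_on UNIV" and "norm (integral UNIV F) \<le> (LBINT t. h t)"
proof -
  define I where "I = (LBINT t. h t)"
  have h_nn: "0 \<le> h t" for t using order_trans[OF norm_ge_zero le] .
  have h_I: "(h has_integral I) UNIV" unfolding I_def by (rule has_integral_integral_lborel[OF h])
  have h_on: "h integrable_on {a..b}" for a b
    using h_I by (intro integrable_on_subinterval[of h UNIV]) auto
  have F_on: "F integrable_on {a..b}" for a b
    by (intro integrable_continuous_real continuous_on_subset[OF cont]) auto
  have F_le: "norm (integral {a..b} F) \<le> integral {a..b} h" for a b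
    by (intro integral_norm_bound_integral F_on h_on le)
  have h_le: "integral {a..b} h \<le> I" for a b
    using integral_subset_le[of "{a..b}" UNIV h] h_on h_nn h_I by (simp add: integral_unique has_integral_integrable)
  have diff: "norm (integral {a..b} F - integral {-B..B} F) \<le> I - integral {-B..B} h"
    if "a \<le> -B" "B \<le> b" "0 \<le> B" for a b B
  proof -
    have split: "integral {a..b} G = integral {a..-B} G + integral {-B..B} G + integral {B..b} G"
      if "\<And>a b. G integrable_on {a..b}" for G :: "real \<Rightarrow> 'c::banach"
      using Henstock_Kurzweil_Integration.integral_combine[of a "-B" b G]
        Henstock_Kurzweil_Integration.integral_combine[of "-B" B b G] that \<open>a \<le> -B\<close> \<open>B \<le> b\<close> \<open>0 \<le> B\<close>
      by (simp add: add.assoc)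
    have "norm (integral {a..b} F - integral {-B..B} F) = norm (integral {a..-B} F + integral {B..b} F)"
      by (simp add: split[OF F_on])
    also have "\<dots> \<le> integral {a..-B} h + integral {B..b} h"
      by (rule order_trans[OF norm_triangle_ineq add_mono[OF F_le F_le]])
    also have "\<dots> = integral {a..b} h - integral {-B..B} h" by (simp add: split[OF h_on])
    finally show ?thesis using h_le[of a b] by linarith
  qed
  have sym: "\<exists>B>0. I - integral {-B..B} h < e" if e: "e > 0" for e
  proof -
    obtain B where B: "B > 0" "\<And>a b. ball 0 B \<subseteq> cbox a b \<Longrightarrow> norm (integral (cbox a b) h - I) < e"
      using h_I e unfolding has_integral_alt' by auto
    have "ball 0 B \<subseteq> cbox (-B) B" by (auto simp: dist_real_def)
    from B(2)[OF this] have "I - integral {-B..B} h < e" by (simp add: abs_real_def split: if_splits)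
    with B(1) show ?thesis by blast
  qed
  have sub: "a \<le> -B \<and> B \<le> b" if B: "B > 0" and "ball 0 B \<subseteq> cbox a b" for a b B :: real
  proof -
    have "{-B<..<B} \<subseteq> {a..b}" using that(2) by (simp add: ball_eq_greaterThanLessThan)
    then show ?thesis using B greaterThanLessThan_subseteq_atLeastAtMost_iff[of "-B" B a b] by simp
  qed
  show int: "F integrable_on UNIV"
  proof (subst integrable_alt, intro conjI allI impI)
    show "(\<lambda>x. if x \<in> UNIV then F x else 0) integrable_on cbox a b" for a b using F_on by simp
    fix e :: real assume "e > 0"
    then obtain B where B: "B > 0" "I - integral {-B..B} h < e / 2" using sym[of "e/2"] by auto
    show "\<exists>B>0. \<forall>a b c d. ball 0 B \<subseteq> cbox a b \<and> ball 0 B \<subseteq> cbox c d \<longrightarrow>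
      norm (integral (cbox a b) (\<lambda>x. if x \<in> UNIV then F x else 0) - integral (cbox c d) (\<lambda>x. if x \<in> UNIV then F x else 0)) < e"
    proof (intro exI[of _ B] conjI allI impI)
      fix a b c d :: real assume "ball 0 B \<subseteq> cbox a b \<and> ball 0 B \<subseteq> cbox c d"
      then have ab: "a \<le> -B" "B \<le> b" and cd: "c \<le> -B" "B \<le> d" using sub[OF B(1)] by blast+
      have "norm (integral {a..b} F - integral {c..d} F) \<le>
          norm (integral {a..b} F - integral {-B..B} F) + norm (integral {c..d} F - integral {-B..B} F)"
        using norm_triangle_ineq4[of "integral {a..b} F - integral {-B..B} F" "integral {c..d} F - integral {-B..B} F"] by simp
      then show "norm (integral (cbox a b) (\<lambda>x. if x \<in> UNIV then F x else 0) - integral (cbox c d) (\<lambda>x. if x \<in> UNIV then F x else 0)) < e"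
        using diff[OF ab] diff[OF cd] B by simp
    qed (rule B(1))
  qed
  show "norm (integral UNIV F) \<le> I"
  proof (rule field_le_epsilon)
    fix e :: real assume e: "e > 0"
    have "(F has_integral integral UNIV F) UNIV" using int by (rule integrable_integral)
    then obtain B where B: "B > 0" "\<And>a b. ball 0 B \<subseteq> cbox a b \<Longrightarrow> norm (integral (cbox a b) F - integral UNIV F) < e"
      using e unfolding has_integral_alt' by auto
    have "ball 0 B \<subseteq> cbox (-B) B" by (auto simp: dist_real_def)
    from B(2)[OF this] have "norm (integral {-B..B} F - integral UNIV F) < e" by simp
    moreover have "norm (integral UNIV F) \<le> norm (integral {-B..B} F) + norm (integral {-B..B} F - integral UNIV F)"
      using norm_triangle_sub[of "integral UNIV F" "integral {-B..B} F"] by (simp add: norm_minus_commute)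
    ultimately show "norm (integral UNIV F) \<le> I + e" using F_le[of "-B" B] h_le[of "-B" B] by linarith
  qed
qed

lemma bounded_bilinear_scaleC: "bounded_bilinear (\<lambda>c (x::'a::complex_banach). c *\<^sub>C x)"
proof
  show "\<exists>K. \<forall>a (b::'a). norm (a *\<^sub>C b) \<le> norm a * norm b * K"
    by (intro exI[of _ 1]) (simp add: norm_scaleC)
qed (simp_all add: scaleC_add_left scaleC_add_right scaleR_scaleC scaleC_scaleC scaleC_complex_def mult.commute)

section \<open>The functional calculus of a non-quasianalytic group\<close>

locale generated_C0_group =
  fixes U :: "real \<Rightarrow> 'a::complex_banach \<Rightarrow> 'a" and D :: "'a set" and A :: "'a \<Rightarrow> 'a"
  assumes C0: "C0_group U" and gen: "generates D (\<lambda>x. \<i> *\<^sub>C A x) U" and nqa: "non_quasianalytic U"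
begin

definition w :: "real \<Rightarrow> real" where "w t = onorm (U t)"

lemma bounded_linear_U: "bounded_linear (U t)"
  using C0 by (simp add: C0_group_def)

lemma U_zero: "U 0 x = x"
  using C0 by (simp add: C0_group_def)

lemma U_add: "U (s + t) x = U s (U t x)"
  using C0 by (simp add: C0_group_def)

lemma U_scaleC: "U t (c *\<^sub>C x) = c *\<^sub>C U t x"
proof -
  interpret l: Vector_Spaces.linear scaleC scaleC "U t" using C0 by (simp add: C0_group_def)
  show ?thesis by (rule l.scale)
qed

lemma continuous_on_U: "continuous_on S (\<lambda>t. U t x)"
  using C0 continuous_on_subset unfolding C0_group_def by blast

lemma norm_U_le: "norm (U t x) \<le> w t * norm x"
  unfolding w_def by (rule onorm[OF bounded_linear_U])

lemma w_nonneg: "0 \<le> w t"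
  unfolding w_def by (rule onorm_pos_le[OF bounded_linear_U])

lemma w_add_le: "w (s + t) \<le> w s * w t"
proof -
  have "U (s + t) = U s \<circ> U t" using C0 by (simp add: C0_group_def)
  then show ?thesis unfolding w_def using onorm_compose[OF bounded_linear_U bounded_linear_U] by simp
qed

text \<open>
  Taking the positive part preserves subadditivity. On the trivial space, where \<open>w\<close> vanishes, \<open>ln 0 = 0\<close> makes
  \<open>\<omega>\<close> vanish too.
\<close>

definition \<omega> :: "real \<Rightarrow> real" where "\<omega> t = max 0 (ln (w t))"

lemma w_le_exp_\<omega>: "w t \<le> exp (\<omega> t)"
  using w_nonneg[of t] ln_ge_iff[of "w t" "ln (w t)"]
  by (cases "w t = 0") (auto simp: \<omega>_def max_def)

lemma \<omega>_add_le: "\<omega> (s + t) \<le> \<omega> s + \<omega> t"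
proof (cases "w (s + t) = 0")
  case False
  then have pos: "0 < w (s + t)" using w_nonneg[of "s + t"] by linarith
  then have "0 < w s * w t" using w_add_le[of s t] by linarith
  then have "w s > 0" "w t > 0" using w_nonneg[of s] w_nonneg[of t] by (auto simp: zero_less_mult_iff)
  moreover have "ln (w (s + t)) \<le> ln (w s * w t)"
    using pos \<open>0 < w s * w t\<close> w_add_le[of s t] by (subst ln_le_cancel_iff)
  ultimately have "ln (w (s + t)) \<le> ln (w s) + ln (w t)" by (simp add: ln_mult)
  then show ?thesis by (auto simp: \<omega>_def)
qed (auto simp: \<omega>_def)

lemma integrable_\<omega>: "integrable lborel (\<lambda>t. \<omega> t / (1 + t\<^sup>2))"
proof -
  have i: "integrable lborel (\<lambda>t. ln (w t) / (1 + t\<^sup>2))"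
    using nqa by (simp add: non_quasianalytic_def w_def)
  have "\<omega> t / (1 + t\<^sup>2) = max 0 (ln (w t) / (1 + t\<^sup>2))" for t
    using add_pos_nonneg[of 1 "t\<^sup>2"] by (auto simp: \<omega>_def max_def divide_le_0_iff zero_le_divide_iff)
  moreover have "integrable lborel (\<lambda>t. max 0 (ln (w t) / (1 + t\<^sup>2)))" using i by (intro integrable_max) auto
  ultimately show ?thesis by simp
qed

lemma w_le_exp_linear: "\<eta> > 0 \<Longrightarrow> \<exists>C>0. \<forall>t. w t \<le> C * exp (\<eta> * \<bar>t\<bar>)"
proof -
  assume \<eta>: "\<eta> > 0"
  obtain B where B: "\<And>k s. \<bar>s\<bar> \<le> 2 ^ k \<Longrightarrow> \<omega> s \<le> B k" "summable (\<lambda>k. B k / 2 ^ k)"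
    using subadditive_dyadic_majorant[OF _ \<omega>_add_le integrable_\<omega>] by (auto simp: \<omega>_def)
  obtain C where C: "\<And>t. \<omega> t \<le> C + \<eta> * \<bar>t\<bar>"
    using dyadic_majorant_sublinear[of \<omega> B \<eta>, OF B \<eta>] by blast
  have "w t \<le> exp C * exp (\<eta> * \<bar>t\<bar>)" for t
    using order_trans[OF w_le_exp_\<omega>[of t] exp_le_cancel_iff[THEN iffD2, OF C]] by (simp add: exp_add)
  then show ?thesis by (intro exI[of _ "exp C"]) simp
qed

lemma w_le_product:
  "\<exists>(a::nat \<Rightarrow> real) C. (\<forall>k. 0 < a k) \<and> summable a \<and> C \<ge> 0 \<and>
    (\<forall>x. \<exists>N. w x \<le> C * (\<Prod>k<N. sqrt (1 + (a k * x)\<^sup>2)))"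
proof -
  obtain B where B: "\<And>k s. \<bar>s\<bar> \<le> 2 ^ k \<Longrightarrow> \<omega> s \<le> B k" "summable (\<lambda>k. B k / 2 ^ k)"
    using subadditive_dyadic_majorant[OF _ \<omega>_add_le integrable_\<omega>] by (auto simp: \<omega>_def)
  have "\<exists>(a::nat \<Rightarrow> real) C. (\<forall>k. 0 < a k) \<and> summable a \<and> C \<ge> 0 \<and>
    (\<forall>x. \<exists>N. exp (\<omega> x) \<le> C * (\<Prod>k<N. sqrt (1 + (a k * x)\<^sup>2)))"
    by (rule dyadic_majorant_product[of \<omega> B, OF B]) (auto simp: \<omega>_def)
  then show ?thesis using w_le_exp_\<omega> by (meson order_trans)
qed

lemma vector_derivative_U:
  assumes x: "x \<in> D"
  shows "((\<lambda>t. U t x) has_vector_derivative U t (\<i> *\<^sub>C A x)) (at t)"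
proof -
  interpret Ut: bounded_linear "U t" by (rule bounded_linear_U)
  define y where "y = \<i> *\<^sub>C A x"
  have "((\<lambda>h. (U h x - x) /\<^sub>R h) \<longlongrightarrow> y) (at 0)"
    using gen x by (auto simp: generates_def y_def)
  then have "((\<lambda>h. U t ((U h x - x) /\<^sub>R h)) \<longlongrightarrow> U t y) (at 0)" by (rule Ut.tendsto)
  then have lim: "((\<lambda>h. norm (U t ((U h x - x) /\<^sub>R h) - U t y)) \<longlongrightarrow> 0) (at 0)"
    by (intro tendsto_norm_zero LIM_zero)
  have quot: "norm (U t ((U h x - x) /\<^sub>R h) - U t y) = norm (U (t + h) x - U t x - h *\<^sub>R U t y) / norm h"
    if "h \<noteq> 0" for h
  proof -
    have "U (t + h) x - U t x - h *\<^sub>R U t y = h *\<^sub>R (U t ((U h x - x) /\<^sub>R h) - U t y)"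
      using that by (simp add: U_add Ut.scaleR Ut.diff scaleR_diff_right)
    then show ?thesis using that by simp
  qed
  from lim have "((\<lambda>h. norm (U (t + h) x - U t x - h *\<^sub>R U t y) / norm h) \<longlongrightarrow> 0) (at 0)"
    by (rule Lim_transform_eventually) (simp add: eventually_at_filter quot)
  then show ?thesis
    unfolding has_vector_derivative_def has_derivative_at y_def[symmetric]
    by (auto intro!: bounded_linear_scaleR_left)
qed

definition dominated :: "(complex \<Rightarrow> complex) \<Rightarrow> (real \<Rightarrow> real) \<Rightarrow> bool"
  where "dominated \<phi> h \<longleftrightarrow> continuous_on UNIV (\<lambda>t::real. \<phi> (of_real t)) \<and> integrable lborel h \<and>
    (\<forall>t. cmod (\<phi> (of_real t)) * w t \<le> h t)"

context
  fixes \<phi> h assumes dom: "dominated \<phi> h"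
begin

lemma continuous_on_P_integrand: "continuous_on UNIV (\<lambda>t::real. \<phi> (of_real t) *\<^sub>C U t x)"
  using dom unfolding dominated_def
  by (intro bounded_bilinear.continuous_on[OF bounded_bilinear_scaleC] continuous_on_U) auto

lemma norm_P_integrand_le: "norm (\<phi> (of_real t) *\<^sub>C U t x) \<le> h t * norm x"
proof -
  have "norm (\<phi> (of_real t) *\<^sub>C U t x) \<le> cmod (\<phi> (of_real t)) * (w t * norm x)"
    unfolding norm_scaleC by (intro mult_left_mono norm_U_le) auto
  also have "\<dots> \<le> h t * norm x"
    using dom unfolding dominated_def mult.assoc[symmetric] by (intro mult_right_mono) auto
  finally show ?thesis .
qed

lemma has_integral_P_op: "((\<lambda>t::real. \<phi> (of_real t) *\<^sub>C U t x) has_integral P_op U \<phi> x) UNIV"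
proof -
  have "integrable lborel (\<lambda>t. h t * norm x)"
    using dom by (intro integrable_mult_left) (simp add: dominated_def)
  from dominated_integral_real_line(1)[OF continuous_on_P_integrand this norm_P_integrand_le]
  show ?thesis unfolding P_op_def by (rule integrable_integral)
qed

lemma norm_P_op_le: "norm (P_op U \<phi> x) \<le> (LBINT t. h t) * norm x"
proof -
  have "integrable lborel (\<lambda>t. h t * norm x)"
    using dom by (intro integrable_mult_left) (simp add: dominated_def)
  from dominated_integral_real_line(2)[OF continuous_on_P_integrand this norm_P_integrand_le]
  show ?thesis unfolding P_op_def by simp
qed

lemma P_op_add: "P_op U \<phi> (x + y) = P_op U \<phi> x + P_op U \<phi> y"
proof -
  have "((\<lambda>t::real. \<phi> (of_real t) *\<^sub>C U t x + \<phi> (of_real t) *\<^sub>C U t y) has_integral P_op U \<phi> x + P_op U \<phi> y) UNIV"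
    by (intro has_integral_add has_integral_P_op)
  moreover have "U t (x + y) = U t x + U t y" for t
    by (rule linear_add) (use bounded_linear_U bounded_linear.linear in blast)
  ultimately show ?thesis
    using has_integral_P_op[of "x + y"] by (auto simp: scaleC_add_right intro: has_integral_unique)
qed

lemma P_op_scaleC: "P_op U \<phi> (c *\<^sub>C x) = c *\<^sub>C P_op U \<phi> x"
proof -
  have "((\<lambda>t::real. c *\<^sub>C (\<phi> (of_real t) *\<^sub>C U t x)) has_integral c *\<^sub>C P_op U \<phi> x) UNIV"
    using has_integral_linear[OF has_integral_P_op bounded_linear_scaleC] by (simp add: o_def)
  then show ?thesis
    using has_integral_P_op[of "c *\<^sub>C x"]
    by (auto simp: U_scaleC scaleC_scaleC mult.commute intro: has_integral_unique)
qed

lemma bounded_linear_P_op: "bounded_linear (P_op U \<phi>)"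
proof (rule bounded_linear_intro)
  show "P_op U \<phi> (r *\<^sub>R x) = r *\<^sub>R P_op U \<phi> x" for r x
    unfolding scaleR_scaleC by (rule P_op_scaleC)
  show "norm (P_op U \<phi> x) \<le> norm x * (LBINT t. h t)" for x
    using norm_P_op_le by (simp add: mult.commute)
qed (rule P_op_add)

lemma closed_fixed_P_op: "closed {x. P_op U \<phi> x = x}"
  by (intro closed_Collect_eq linear_continuous_on[OF bounded_linear_P_op] continuous_on_id)

lemma csubspace_fixed_P_op: "csubspace {x. P_op U \<phi> x = x}"
proof -
  interpret cv: vector_space "scaleC :: complex \<Rightarrow> 'a \<Rightarrow> 'a" by (rule vector_space_scaleC)
  show ?thesis
    by (rule cv.subspaceI)
       (auto simp: P_op_add P_op_scaleC linear_0[OF bounded_linear.linear[OF bounded_linear_P_op]])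
qed

end

lemma C_infinity_funpow:
  assumes "x \<in> C_infinity D A"
  shows "(A ^^ n) x \<in> D"
proof -
  have "x \<in> dom_pow D A (Suc n) \<Longrightarrow> (A ^^ n) x \<in> D" for x
    by (induction n arbitrary: x) (auto simp: funpow_swap1)
  moreover have "x \<in> dom_pow D A (Suc n)" using assms unfolding C_infinity_def by blast
  ultimately show ?thesis .
qed

text \<open>
  If \<open>P_op U \<phi> x\<close> and \<open>x\<close> were different, a functional \<open>\<Lambda>\<close> would tell them apart, contradicting the scalar
  reproducing formula for \<open>f n t = \<Lambda> (U t (A^n x))\<close>.
\<close>

theorem P_op_fixes_exp_vectors:
  assumes dom: "dominated \<phi> h" and hat: "\<And>l. \<bar>l\<bar> < b \<Longrightarrow> fourier \<phi> l = 1"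
    and \<beta>: "0 \<le> \<beta>" "\<beta> < b" and x: "x \<in> exp_vectors D A \<beta>"
  shows "P_op U \<phi> x = x"
proof (rule ccontr)
  assume "P_op U \<phi> x \<noteq> x"
  then have "P_op U \<phi> x - x \<noteq> 0" by simp
  then obtain \<Lambda> :: "'a \<Rightarrow> complex" where \<Lambda>: "bounded_linear \<Lambda>" "\<And>c x. \<Lambda> (c *\<^sub>C x) = c * \<Lambda> x"
    and \<Lambda>_ne: "\<Lambda> (P_op U \<phi> x - x) \<noteq> 0"
    using separating_complex_functional by blast
  interpret \<Lambda>: bounded_linear \<Lambda> by (rule \<Lambda>(1))
  define K where "K = onorm \<Lambda>"
  have K: "cmod (\<Lambda> v) \<le> K * norm v" for v unfolding K_def by (rule onorm[OF \<Lambda>(1)])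
  have K_nn: "K \<ge> 0" unfolding K_def by (rule onorm_pos_le[OF \<Lambda>(1)])
  obtain c where c: "c > 0" "\<And>k. norm ((A ^^ k) x) \<le> c * \<beta> ^ k" and x_inf: "x \<in> C_infinity D A"
    using x by (auto simp: exp_vectors_def)
  define f where "f n t = \<Lambda> (U t ((A ^^ n) x))" for n t
  define \<psi> where "\<psi> t = \<phi> (complex_of_real t)" for t
  have \<psi>f_eq: "\<psi> t * f 0 t = \<Lambda> (\<phi> (of_real t) *\<^sub>C U t x)" for t
    by (simp add: \<psi>_def f_def \<Lambda>(2))
  have fourier_eq: "fourier \<phi> l = (LBINT t. \<psi> t * iexp (l * t))" for l
    by (simp add: fourier_def \<psi>_def mult.assoc)
  have \<psi>_int: "integrable lborel \<psi>"
  proof (rule ccontr)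
    \<comment> \<open>A non-integrable function has integral \<open>0\<close> by convention, whereas this one has integral \<open>1\<close>.\<close>
    assume "\<not> integrable lborel \<psi>"
    then have "(LBINT t. \<psi> t) = 0" by (rule not_integrable_integral_eq)
    then show False using hat[of 0] fourier_eq[of 0] \<beta> by simp
  qed
  have \<psi>f_int: "integrable lborel (\<lambda>t. \<psi> t * f 0 t)"
  proof (rule Bochner_Integration.integrable_bound)
    show "integrable lborel (\<lambda>t. K * (h t * norm x))"
      using dom by (intro integrable_mult_right integrable_mult_left) (simp add: dominated_def)
    have "continuous_on UNIV (\<lambda>t. \<psi> t * f 0 t)"
      unfolding \<psi>f_eq by (rule \<Lambda>.continuous_on[OF continuous_on_P_integrand[OF dom]])
    then show "(\<lambda>t. \<psi> t * f 0 t) \<in> borel_measurable lborel"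
      using borel_measurable_continuous_onI by simp
    show "AE t in lborel. norm (\<psi> t * f 0 t) \<le> norm (K * (h t * norm x))"
    proof (rule AE_I2)
      fix t
      have "norm (\<psi> t * f 0 t) \<le> K * (h t * norm x)"
        unfolding \<psi>f_eq by (rule order_trans[OF K mult_left_mono[OF norm_P_integrand_le[OF dom] K_nn]])
      then show "norm (\<psi> t * f 0 t) \<le> norm (K * (h t * norm x))" by simp
    qed
  qed
  from \<psi>f_int have "((\<lambda>t. \<psi> t * f 0 t) has_integral (LBINT t. \<psi> t * f 0 t)) UNIV"
    by (rule has_integral_integral_lborel)
  moreover have "((\<lambda>t. \<psi> t * f 0 t) has_integral \<Lambda> (P_op U \<phi> x)) UNIV"
    unfolding \<psi>f_eq using has_integral_linear[OF has_integral_P_op[OF dom] \<Lambda>(1)] by (simp add: o_def)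
  ultimately have eq: "(LBINT t. \<psi> t * f 0 t) = \<Lambda> (P_op U \<phi> x)" by (rule has_integral_unique)
  have "(LBINT t. \<psi> t * f 0 t) = f 0 0"
  proof (rule band_limited_reproducing[where \<beta>=\<beta> and b=b])
    show "(f n has_vector_derivative \<i> * f (Suc n) t) (at t)" for n t
    proof -
      have "((\<lambda>t. \<Lambda> (U t ((A ^^ n) x))) has_vector_derivative \<Lambda> (U t (\<i> *\<^sub>C A ((A ^^ n) x)))) (at t)"
        by (rule \<Lambda>.has_vector_derivative[OF vector_derivative_U[OF C_infinity_funpow[OF x_inf]]])
      then show ?thesis by (simp add: f_def[abs_def] U_scaleC \<Lambda>(2))
    qed
    show "\<exists>C. \<forall>n t. cmod (f n t) \<le> C * \<beta> ^ n * exp (\<eta> * \<bar>t\<bar>)" if \<eta>: "\<eta> > 0" for \<eta>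
    proof -
      obtain C where C: "C > 0" "\<And>t. w t \<le> C * exp (\<eta> * \<bar>t\<bar>)" using w_le_exp_linear[OF \<eta>] by blast
      have "cmod (f n t) \<le> (K * C * c) * \<beta> ^ n * exp (\<eta> * \<bar>t\<bar>)" for n t
      proof -
        have "cmod (f n t) \<le> K * norm (U t ((A ^^ n) x))" unfolding f_def by (rule K)
        also have "\<dots> \<le> K * (w t * norm ((A ^^ n) x))" by (intro mult_left_mono norm_U_le K_nn)
        also have "\<dots> \<le> K * ((C * exp (\<eta> * \<bar>t\<bar>)) * (c * \<beta> ^ n))"
          by (intro mult_left_mono mult_mono C(2) c(2) K_nn) (use C(1) in auto)
        finally show ?thesis by (simp add: mult_ac)
      qed
      then show ?thesis by blast
    qed
    show "(LBINT t. \<psi> t * iexp (l * t)) = 1" if "\<bar>l\<bar> < b" for l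
      using hat[OF that] fourier_eq by simp
  qed (use \<beta> \<psi>_int \<psi>f_int in auto)
  then show False using eq \<Lambda>_ne by (simp add: \<Lambda>.diff f_def U_zero)
qed

end

section \<open>Powers of the generator on smoothed vectors\<close>

text \<open>
  A crude form of Stirling's formula; the step is \<open>e \<le> (1 + 1/m)^(m+1)\<close>.
\<close>

lemma fact_times_exp_le: "fact (Suc n) * exp (real (Suc n)) \<le> exp 1 * real (Suc n) * real (Suc n) ^ Suc n"
proof (induction n)
  case (Suc n)
  define m where "m = real (Suc n)"
  have m: "m > 0" by (simp add: m_def)
  have "exp (1 / (m + 1)) \<le> (m + 1) / m"
  proof -
    have "1 + (- (1 / (m + 1))) \<le> exp (- (1 / (m + 1)))" by (rule exp_ge_add_one_self)
    moreover have "1 + (- (1 / (m + 1))) = m / (m + 1)" using m by (simp add: field_simps)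
    ultimately have "exp (1 / (m + 1)) * (m / (m + 1)) \<le> exp (1 / (m + 1)) * exp (- (1 / (m + 1)))"
      by (intro mult_left_mono) auto
    also have "\<dots> = 1" by (simp flip: exp_add)
    finally show ?thesis using m by (simp add: field_simps)
  qed
  then have "exp (1 / (m + 1)) ^ Suc (Suc n) \<le> ((m + 1) / m) ^ Suc (Suc n)"
    by (intro power_mono) auto
  moreover have "exp (1 / (m + 1)) ^ Suc (Suc n) = exp 1"
    using m by (simp add: m_def flip: exp_of_nat_mult del: power_Suc)
  ultimately have e: "exp 1 * m ^ Suc (Suc n) \<le> (m + 1) ^ Suc (Suc n)"
    using m by (simp only: power_divide) (simp add: pos_le_divide_eq)
  have m1: "real (Suc (Suc n)) = m + 1" by (simp add: m_def)
  have "fact (Suc (Suc n)) * exp (real (Suc (Suc n))) = ((m + 1) * exp 1) * (fact (Suc n) * exp (real (Suc n)))"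
    unfolding fact_Suc[of "Suc n"] of_nat_mult m1 exp_add m_def[symmetric] by (simp only: mult_ac)
  also have "\<dots> \<le> ((m + 1) * exp 1) * (exp 1 * m * m ^ Suc n)"
    using Suc.IH m by (intro mult_left_mono) (auto simp: m_def)
  also have "\<dots> = exp 1 * (m + 1) * (exp 1 * m ^ Suc (Suc n))" by simp
  also have "\<dots> \<le> exp 1 * (m + 1) * (m + 1) ^ Suc (Suc n)"
    using m e by (intro mult_left_mono) auto
  finally show ?case unfolding m1 .
qed simp

text \<open>
  The choice of radius in Cauchy's estimate: \<open>n! / R^n * e^(\<mu> R)\<close> is nearly minimal at \<open>R = n / \<mu>\<close>, where
  it is \<open>\<mu>^n\<close> up to polynomial factors. The radius \<open>(n + 1) / \<mu>\<close> is positive also for \<open>n = 0\<close>.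
\<close>

lemma fact_Cauchy_radius_bound:
  assumes \<mu>: "0 < \<mu>" "\<mu> < \<gamma>"
  shows "\<exists>c>0. \<forall>n. fact n / (real (Suc n) / \<mu>) ^ n * (1 + (real (Suc n) / \<mu>)\<^sup>2) * exp (\<mu> * (real (Suc n) / \<mu>)) \<le> c * \<gamma> ^ n"
proof -
  define q where "q = \<mu> / \<gamma>"
  have q: "0 < q" "q < 1" using \<mu> by (auto simp: q_def)
  define s where "s n = exp 1 * (real n + 1) * (1 + ((real n + 1) / \<mu>)\<^sup>2) * q ^ n" for n
  have "s \<longlonglongrightarrow> 0" unfolding s_def using q \<mu>(1) by real_asymp
  then have "Bseq s" by (intro convergent_imp_Bseq convergentI)
  then obtain c where c: "c > 0" "\<And>n. norm (s n) \<le> c" by (auto simp: Bseq_def)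
  have "fact n / (real (Suc n) / \<mu>) ^ n * (1 + (real (Suc n) / \<mu>)\<^sup>2) * exp (\<mu> * (real (Suc n) / \<mu>)) \<le> c * \<gamma> ^ n" for n
  proof -
    define m where "m = real (Suc n)"
    have m: "m > 0" by (simp add: m_def)
    have "fact (Suc n) * exp m \<le> exp 1 * m * m ^ Suc n" using fact_times_exp_le[of n] by (simp add: m_def)
    then have "m * (fact n * exp m) \<le> m * (exp 1 * m * m ^ n)" by (simp add: m_def algebra_simps)
    then have f: "fact n * exp m \<le> exp 1 * m * m ^ n" using m by simp
    have "fact n / (m / \<mu>) ^ n * (1 + (m / \<mu>)\<^sup>2) * exp (\<mu> * (m / \<mu>)) = (fact n * exp m) / m ^ n * ((1 + (m / \<mu>)\<^sup>2) * \<mu> ^ n)"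
      using \<mu> m by (simp add: power_divide)
    also have "\<dots> \<le> (exp 1 * m) * ((1 + (m / \<mu>)\<^sup>2) * \<mu> ^ n)"
      using f m \<mu> by (intro mult_right_mono) (auto simp: pos_divide_le_eq intro!: mult_nonneg_nonneg add_nonneg_nonneg)
    also have "\<dots> = s n * \<gamma> ^ n"
      using \<mu> by (simp add: s_def q_def m_def power_divide add.commute)
    also have "\<dots> \<le> c * \<gamma> ^ n"
      using c(2)[of n] \<mu> by (intro mult_right_mono) auto
    finally show ?thesis by (simp add: m_def)
  qed
  then show ?thesis using c(1) by blast
qed

context generated_C0_group
begin

text \<open>
  The extra factor leaves room for integrability: a kernel that is bounded against \<open>W\<close> is integrable
  against \<open>w\<close>.
\<close>

definition W :: "real \<Rightarrow> real" where "W x = w x * (1 + x\<^sup>2)"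

lemma W_nonneg: "0 \<le> W x"
  by (simp add: W_def w_nonneg)

text \<open>
  The weight changes between two points at most by a factor that depends on their distance, because
  \<open>w\<close> is submultiplicative. This is what allows Cauchy's estimate to be used with weights.
\<close>

lemma W_shift_le: "W x \<le> 2 * w (x - y) * (1 + (x - y)\<^sup>2) * W y"
proof -
  have "w x \<le> w (x - y) * w y" using w_add_le[of "x - y" y] by simp
  moreover have "1 + x\<^sup>2 \<le> 2 * (1 + (x - y)\<^sup>2) * (1 + y\<^sup>2)"
  proof -
    have "x\<^sup>2 \<le> 2 * (x - y)\<^sup>2 + 2 * y\<^sup>2" using zero_le_power2[of "x - 2 * y"] by (simp add: power2_eq_square algebra_simps)
    moreover have "2 * (1 + (x - y)\<^sup>2) * (1 + y\<^sup>2) = 2 + 2 * (x - y)\<^sup>2 + 2 * y\<^sup>2 + 2 * ((x - y)\<^sup>2 * y\<^sup>2)"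
      by (simp add: algebra_simps)
    moreover have "0 \<le> (x - y)\<^sup>2 * y\<^sup>2" by simp
    ultimately show ?thesis by linarith
  qed
  ultimately have "w x * (1 + x\<^sup>2) \<le> (w (x - y) * w y) * (2 * (1 + (x - y)\<^sup>2) * (1 + y\<^sup>2))"
    by (intro mult_mono) (auto simp: w_nonneg)
  then show ?thesis by (simp only: W_def mult_ac)
qed

text \<open>
  Kernels that are of exponential type \<open>\<kappa>\<close> in the vertical direction, with decay against \<open>W\<close> uniformly on
  horizontal lines.
\<close>

definition decays :: "real \<Rightarrow> (complex \<Rightarrow> complex) \<Rightarrow> bool"
  where "decays \<kappa> \<phi> \<longleftrightarrow> \<phi> holomorphic_on UNIV \<and> (\<exists>C. \<forall>z. cmod (\<phi> z) * W (Re z) \<le> C * exp (\<kappa> * \<bar>Im z\<bar>))"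

lemma decays_higher_deriv_bound:
  assumes dec: "decays \<kappa> \<phi>" and \<kappa>: "\<kappa> \<ge> 0" and \<epsilon>: "\<epsilon> > 0"
  shows "\<exists>C\<ge>0. \<forall>n z R. R > 0 \<longrightarrow> cmod ((deriv ^^ n) \<phi> z) * W (Re z)
    \<le> C * (fact n / R ^ n * (1 + R\<^sup>2) * exp ((\<kappa> + \<epsilon>) * R)) * exp (\<kappa> * \<bar>Im z\<bar>)"
proof -
  obtain C where hol: "\<phi> holomorphic_on UNIV" and C: "\<And>z. cmod (\<phi> z) * W (Re z) \<le> C * exp (\<kappa> * \<bar>Im z\<bar>)"
    using dec by (auto simp: decays_def)
  have C_nn: "C \<ge> 0" using order_trans[OF mult_nonneg_nonneg[OF norm_ge_zero W_nonneg] C[of 0]] by simp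
  obtain M where M: "M > 0" "\<And>t. w t \<le> M * exp (\<epsilon> * \<bar>t\<bar>)" using w_le_exp_linear[OF \<epsilon>] by blast
  have "cmod ((deriv ^^ n) \<phi> z) * W (Re z) \<le> (2 * M * C) * (fact n / R ^ n * (1 + R\<^sup>2) * exp ((\<kappa> + \<epsilon>) * R)) * exp (\<kappa> * \<bar>Im z\<bar>)"
    if R: "R > 0" for n z R
  proof (cases "W (Re z) = 0")
    case True
    then show ?thesis using M(1) C_nn R by (auto intro!: mult_nonneg_nonneg divide_nonneg_nonneg)
  next
    case False
    then have Wz: "W (Re z) > 0" using W_nonneg[of "Re z"] by linarith
    define B where "B = (2 * M * C) * ((1 + R\<^sup>2) * exp ((\<kappa> + \<epsilon>) * R)) * exp (\<kappa> * \<bar>Im z\<bar>)"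
    have "norm ((deriv ^^ n) \<phi> z) \<le> fact n * (B / W (Re z)) / R ^ n"
    proof (rule Cauchy_inequality)
      show "\<phi> holomorphic_on ball z R" "continuous_on (cball z R) \<phi>"
        using hol holomorphic_on_subset holomorphic_on_imp_continuous_on by blast+
      show "0 < R" by (rule R)
      fix \<zeta> assume \<zeta>: "norm (z - \<zeta>) = R"
      have re: "\<bar>Re z - Re \<zeta>\<bar> \<le> R" and im: "\<bar>Im \<zeta>\<bar> \<le> \<bar>Im z\<bar> + R"
        using abs_Re_le_cmod[of "z - \<zeta>"] abs_Im_le_cmod[of "z - \<zeta>"] \<zeta> by auto
      have "w (Re z - Re \<zeta>) \<le> M * exp (\<epsilon> * R)"
        using order_trans[OF M(2)[of "Re z - Re \<zeta>"]] re \<epsilon> M(1) by simp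
      moreover have "1 + (Re z - Re \<zeta>)\<^sup>2 \<le> 1 + R\<^sup>2" using re R by (intro add_left_mono power2_le_iff_abs_le[THEN iffD2]) auto
      ultimately have "2 * w (Re z - Re \<zeta>) * (1 + (Re z - Re \<zeta>)\<^sup>2) \<le> 2 * (M * exp (\<epsilon> * R)) * (1 + R\<^sup>2)"
        using M(1) by (intro mult_mono) (auto simp: w_nonneg)
      then have "W (Re z) \<le> 2 * (M * exp (\<epsilon> * R)) * (1 + R\<^sup>2) * W (Re \<zeta>)"
        by (intro order_trans[OF W_shift_le[of "Re z" "Re \<zeta>"]] mult_right_mono W_nonneg)
      then have "cmod (\<phi> \<zeta>) * W (Re z) \<le> cmod (\<phi> \<zeta>) * (2 * (M * exp (\<epsilon> * R)) * (1 + R\<^sup>2) * W (Re \<zeta>))"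
        by (rule mult_left_mono) simp
      also have "\<dots> = 2 * (M * exp (\<epsilon> * R)) * (1 + R\<^sup>2) * (cmod (\<phi> \<zeta>) * W (Re \<zeta>))" by (simp add: mult_ac)
      also have "\<dots> \<le> 2 * (M * exp (\<epsilon> * R)) * (1 + R\<^sup>2) * (C * exp (\<kappa> * (\<bar>Im z\<bar> + R)))"
      proof (rule mult_left_mono)
        have "C * exp (\<kappa> * \<bar>Im \<zeta>\<bar>) \<le> C * exp (\<kappa> * (\<bar>Im z\<bar> + R))"
          using im \<kappa> C_nn by (intro mult_left_mono) (auto intro: mult_left_mono)
        then show "cmod (\<phi> \<zeta>) * W (Re \<zeta>) \<le> C * exp (\<kappa> * (\<bar>Im z\<bar> + R))" using C[of \<zeta>] by linarith
      qed (use M(1) in auto)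
      also have "\<dots> = B" by (simp add: B_def algebra_simps exp_add)
      finally show "norm (\<phi> \<zeta>) \<le> B / W (Re z)" using Wz by (simp add: pos_le_divide_eq)
    qed
    then have "cmod ((deriv ^^ n) \<phi> z) * W (Re z) \<le> fact n * (B / W (Re z)) / R ^ n * W (Re z)"
      using Wz by (intro mult_right_mono) auto
    also have "\<dots> = fact n / R ^ n * B" using Wz by simp
    finally show ?thesis by (simp add: B_def mult_ac)
  qed
  then show ?thesis using M(1) C_nn by (intro exI[of _ "2 * M * C"]) auto
qed

lemma decays_deriv:
  assumes "decays \<kappa> \<phi>" "\<kappa> \<ge> 0"
  shows "decays \<kappa> (deriv \<phi>)"
proof -
  have hol: "deriv \<phi> holomorphic_on UNIV" using assms by (auto simp: decays_def intro: holomorphic_deriv)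
  obtain C where C: "\<And>n z R. R > 0 \<Longrightarrow> cmod ((deriv ^^ n) \<phi> z) * W (Re z)
    \<le> C * (fact n / R ^ n * (1 + R\<^sup>2) * exp ((\<kappa> + 1) * R)) * exp (\<kappa> * \<bar>Im z\<bar>)"
    using decays_higher_deriv_bound[OF assms zero_less_one] by blast
  show ?thesis unfolding decays_def
    using hol C[of 1 1] by (intro conjI exI[of _ "C * (fact 1 / 1 ^ 1 * (1 + 1\<^sup>2) * exp ((\<kappa> + 1) * 1))"]) auto
qed

lemma decays_cmult: "decays \<kappa> \<phi> \<Longrightarrow> decays \<kappa> (\<lambda>z. c * \<phi> z)"
proof -
  assume "decays \<kappa> \<phi>"
  then obtain C where hol: "\<phi> holomorphic_on UNIV" and C: "\<And>z. cmod (\<phi> z) * W (Re z) \<le> C * exp (\<kappa> * \<bar>Im z\<bar>)"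
    by (auto simp: decays_def)
  have "cmod (c * \<phi> z) * W (Re z) \<le> (cmod c * C) * exp (\<kappa> * \<bar>Im z\<bar>)" for z
    using mult_left_mono[OF C[of z] norm_ge_zero[of c]] by (simp add: norm_mult mult.assoc)
  then show ?thesis using hol unfolding decays_def by (intro conjI holomorphic_intros) blast+
qed

lemma dominated_of_W_bound:
  assumes "continuous_on UNIV (\<lambda>t::real. \<phi> (of_real t))" and "\<And>t::real. cmod (\<phi> (of_real t)) * W t \<le> C"
  shows "dominated \<phi> (\<lambda>t. C / (1 + t\<^sup>2))"
  unfolding dominated_def
proof (intro conjI allI assms(1) integrable_inverse_1_plus_square_UNIV)
  show "cmod (\<phi> (of_real t)) * w t \<le> C / (1 + t\<^sup>2)" for t
    using assms(2)[of t] by (subst pos_le_divide_eq) (auto simp: W_def mult.assoc intro: add_pos_nonneg)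
qed

lemma holomorphic_continuous_on_reals:
  assumes "\<phi> holomorphic_on UNIV"
  shows "continuous_on UNIV (\<lambda>t::real. \<phi> (of_real t))"
  by (intro continuous_on_compose2[OF holomorphic_on_imp_continuous_on[OF assms]] continuous_intros) auto

lemma decays_dominated:
  assumes "decays \<kappa> \<phi>"
  shows "\<exists>h. dominated \<phi> h"
proof -
  obtain C where hol: "\<phi> holomorphic_on UNIV" and C: "\<And>z. cmod (\<phi> z) * W (Re z) \<le> C * exp (\<kappa> * \<bar>Im z\<bar>)"
    using assms by (auto simp: decays_def)
  have "dominated \<phi> (\<lambda>t. C / (1 + t\<^sup>2))"
    using C[of "of_real _"] by (intro dominated_of_W_bound holomorphic_continuous_on_reals[OF hol]) simp
  then show ?thesis by blast
qed

text \<open>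
  Translation invariance turns the difference quotient of the orbit into that of the kernel. Its distance
  to \<open>- deriv \<phi>\<close> is, measured against \<open>W\<close>, at most a multiple of \<open>|s|\<close> by Taylor's formula.
\<close>

lemma P_op_difference_quotient:
  assumes dec: "decays \<kappa> \<phi>" and \<kappa>: "\<kappa> \<ge> 0"
  shows "((\<lambda>s. (U s (P_op U \<phi> x) - P_op U \<phi> x) /\<^sub>R s) \<longlongrightarrow> - P_op U (deriv \<phi>) x) (at 0)"
proof -
  have hol: "\<phi> holomorphic_on UNIV" using dec by (simp add: decays_def)
  have dec1: "decays \<kappa> (deriv \<phi>)" by (rule decays_deriv[OF dec \<kappa>])
  have hol1: "deriv \<phi> holomorphic_on UNIV" using dec1 by (simp add: decays_def)
  have "decays \<kappa> (deriv (deriv \<phi>))" by (rule decays_deriv[OF dec1 \<kappa>])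
  then obtain C where "\<And>z. cmod (deriv (deriv \<phi>) z) * W (Re z) \<le> C * exp (\<kappa> * \<bar>Im z\<bar>)"
    by (auto simp: decays_def)
  from this[of "of_real _"] have C: "\<And>t::real. cmod (deriv (deriv \<phi>) (of_real t)) * W t \<le> C" by simp
  have C_nn: "C \<ge> 0" using order_trans[OF mult_nonneg_nonneg[OF norm_ge_zero W_nonneg] C] .
  obtain M where M: "M > 0" "\<And>t. w t \<le> M * exp (1 * \<bar>t\<bar>)" using w_le_exp_linear[OF zero_less_one] by blast
  define K where "K = 4 * M * exp 1 * C"
  have K_nn: "K \<ge> 0" using M(1) C_nn by (simp add: K_def)
  obtain h where dom: "dominated \<phi> h" using decays_dominated[OF dec] by blast
  obtain h1 where dom1: "dominated (deriv \<phi>) h1" using decays_dominated[OF dec1] by blast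
  have main: "norm ((U s (P_op U \<phi> x) - P_op U \<phi> x) /\<^sub>R s + P_op U (deriv \<phi>) x)
      \<le> \<bar>s\<bar> * (K * (LBINT t. 1 / (1 + t\<^sup>2)) * norm x)" if s: "s \<noteq> 0" "\<bar>s\<bar> \<le> 1" for s
  proof -
    \<comment> \<open>The kernel of the difference between the quotient and its limit.\<close>
    define \<rho> where "\<rho> z = (\<phi> (z - of_real s) - \<phi> z) / of_real s + deriv \<phi> z" for z
    have \<rho>_hol: "\<rho> holomorphic_on UNIV"
      unfolding \<rho>_def[abs_def] using s
      by (intro holomorphic_intros hol hol1 holomorphic_on_compose_gen[of "\<lambda>z. z - of_real s" UNIV \<phi> UNIV, unfolded o_def]) auto
    have bound: "cmod (\<rho> (of_real t)) * W t \<le> \<bar>s\<bar> * K" for t :: real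
    proof (cases "W t = 0")
      case True
      then show ?thesis using K_nn by simp
    next
      case False
      then have Wt: "W t > 0" using W_nonneg[of t] by linarith
      define S where "S = closed_segment (complex_of_real t) (complex_of_real (t - s))"
      have "cmod (\<phi> (of_real (t - s)) - (\<Sum>i\<le>1. (deriv ^^ i) \<phi> (of_real t) * (of_real (t - s) - of_real t) ^ i / fact i))
          \<le> K / W t * cmod (of_real (t - s) - of_real t) ^ Suc 1 / fact 1"
      proof (rule complex_Taylor[of S 1 "\<lambda>i. (deriv ^^ i) \<phi>", simplified funpow_0])
        fix i :: nat and u assume "u \<in> S" "i \<le> 1"
        have "(deriv ^^ i) \<phi> holomorphic_on UNIV" using hol by (intro holomorphic_higher_deriv) auto
        then have "((deriv ^^ i) \<phi> has_field_derivative deriv ((deriv ^^ i) \<phi>) u) (at u)"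
          by (intro holomorphic_derivI[of _ UNIV]) auto
        then show "((deriv ^^ i) \<phi> has_field_derivative (deriv ^^ Suc i) \<phi> u) (at u within S)"
          by (auto intro: has_field_derivative_at_within)
      next
        fix u assume "u \<in> S"
        then obtain y where y: "u = of_real y" "\<bar>t - y\<bar> \<le> \<bar>s\<bar>"
          unfolding S_def closed_segment_of_real by (auto simp: closed_segment_eq_real_ivl split: if_splits)
        have "w (t - y) \<le> M * exp 1"
          using order_trans[OF M(2)[of "t - y"]] y(2) s M(1) by simp
        moreover have "1 + (t - y)\<^sup>2 \<le> 2" using y(2) s abs_square_le_1[of "t - y"] by simp
        ultimately have "2 * w (t - y) * (1 + (t - y)\<^sup>2) \<le> 2 * (M * exp 1) * 2"
          using M(1) by (intro mult_mono) (auto simp: w_nonneg)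
        from order_trans[OF W_shift_le[of t y] mult_right_mono[OF this W_nonneg]]
        have "W t \<le> (4 * M * exp 1) * W y" by (simp add: mult_ac)
        then have "cmod (deriv (deriv \<phi>) u) * W t \<le> cmod (deriv (deriv \<phi>) u) * ((4 * M * exp 1) * W y)"
          by (rule mult_left_mono) simp
        also have "\<dots> = (4 * M * exp 1) * (cmod (deriv (deriv \<phi>) (of_real y)) * W y)" by (simp add: y(1) mult_ac)
        also have "\<dots> \<le> K" unfolding K_def using M(1) by (intro mult_left_mono C) auto
        finally show "cmod ((deriv ^^ Suc 1) \<phi> u) \<le> K / W t" using Wt by (simp add: pos_le_divide_eq)
      qed (auto simp: S_def)
      then have taylor: "cmod (\<phi> (of_real (t - s)) - (\<phi> (of_real t) - deriv \<phi> (of_real t) * of_real s)) \<le> K / W t * \<bar>s\<bar> ^ 2"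
        by (simp add: power2_eq_square)
      have \<rho>_eq: "\<rho> (of_real t) = (\<phi> (of_real (t - s)) - (\<phi> (of_real t) - deriv \<phi> (of_real t) * of_real s)) / of_real s"
        using s by (simp add: \<rho>_def field_simps)
      have "cmod (\<rho> (of_real t)) \<le> K / W t * \<bar>s\<bar> ^ 2 / \<bar>s\<bar>"
        unfolding \<rho>_eq norm_divide norm_of_real by (rule divide_right_mono[OF taylor]) simp
      also have "\<dots> = \<bar>s\<bar> * K / W t"
      proof -
        have "K / W t * r ^ 2 / r = r * K / W t" if "r \<noteq> 0" for r :: real
          using that by (simp add: power2_eq_square)
        from this[of "\<bar>s\<bar>"] show ?thesis using s(1) by (simp only: abs_eq_0 not_False_eq_True)
      qed
      finally show ?thesis using Wt by (simp add: pos_le_divide_eq)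
    qed
    have dom\<rho>: "dominated \<rho> (\<lambda>t. \<bar>s\<bar> * K / (1 + t\<^sup>2))"
      by (rule dominated_of_W_bound[OF holomorphic_continuous_on_reals[OF \<rho>_hol] bound])
    have "((\<lambda>t::real. \<phi> (of_real t) *\<^sub>C U (s + t) x) has_integral U s (P_op U \<phi> x)) UNIV"
      using has_integral_linear[OF has_integral_P_op[OF dom] bounded_linear_U[of s]]
      by (simp add: o_def U_scaleC U_add)
    from has_integral_real_line_shift[OF this, of "- s"]
    have i1: "((\<lambda>t::real. \<phi> (of_real t - of_real s) *\<^sub>C U t x) has_integral U s (P_op U \<phi> x)) UNIV" by simp
    have "((\<lambda>t::real. (1/s) *\<^sub>R (\<phi> (of_real t - of_real s) *\<^sub>C U t x - \<phi> (of_real t) *\<^sub>C U t x) + deriv \<phi> (of_real t) *\<^sub>C U t x)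
        has_integral (1/s) *\<^sub>R (U s (P_op U \<phi> x) - P_op U \<phi> x) + P_op U (deriv \<phi>) x) UNIV"
      by (intro has_integral_add has_integral_cmul has_integral_diff i1 has_integral_P_op[OF dom] has_integral_P_op[OF dom1])
    moreover have "(1/s) *\<^sub>R (\<phi> (of_real t - of_real s) *\<^sub>C U t x - \<phi> (of_real t) *\<^sub>C U t x) + deriv \<phi> (of_real t) *\<^sub>C U t x
        = \<rho> (of_real t) *\<^sub>C U t x" for t :: real
    proof -
      have "\<phi> (of_real t - of_real s) *\<^sub>C y - \<phi> (of_real t) *\<^sub>C y = (\<phi> (of_real t - of_real s) - \<phi> (of_real t)) *\<^sub>C y" for y :: 'a
        using scaleC_add_left[of "\<phi> (of_real t - of_real s) - \<phi> (of_real t)" "\<phi> (of_real t)" y] by simp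
      then show ?thesis by (simp add: \<rho>_def scaleR_scaleC scaleC_scaleC scaleC_add_left mult.commute divide_inverse)
    qed
    ultimately have "(1/s) *\<^sub>R (U s (P_op U \<phi> x) - P_op U \<phi> x) + P_op U (deriv \<phi>) x = P_op U \<rho> x"
      using has_integral_P_op[OF dom\<rho>, of x] by (auto intro: has_integral_unique)
    then have "norm ((U s (P_op U \<phi> x) - P_op U \<phi> x) /\<^sub>R s + P_op U (deriv \<phi>) x) = norm (P_op U \<rho> x)"
      by (simp add: divide_inverse_commute)
    also have "\<dots> \<le> (LBINT t. \<bar>s\<bar> * K / (1 + t\<^sup>2)) * norm x" by (rule norm_P_op_le[OF dom\<rho>])
    also have "(LBINT t. \<bar>s\<bar> * K / (1 + t\<^sup>2)) = (LBINT t. (\<bar>s\<bar> * K) * (1 / (1 + t\<^sup>2)))" by simp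
    also have "\<dots> = \<bar>s\<bar> * K * (LBINT t. 1 / (1 + t\<^sup>2))" by (rule integral_mult_right_zero)
    finally show ?thesis by (simp add: mult_ac)
  qed
  have "((\<lambda>s. (U s (P_op U \<phi> x) - P_op U \<phi> x) /\<^sub>R s + P_op U (deriv \<phi>) x) \<longlongrightarrow> 0) (at 0)"
  proof (rule Lim_null_comparison)
    show "\<forall>\<^sub>F s in at 0. norm ((U s (P_op U \<phi> x) - P_op U \<phi> x) /\<^sub>R s + P_op U (deriv \<phi>) x)
      \<le> \<bar>s\<bar> * (K * (LBINT t. 1 / (1 + t\<^sup>2)) * norm x)"
      unfolding eventually_at by (intro exI[of _ 1]) (auto intro!: main)
    have "((\<lambda>s::real. \<bar>s\<bar> * (K * (LBINT t. 1 / (1 + t\<^sup>2)) * norm x)) \<longlongrightarrow> \<bar>0\<bar> * (K * (LBINT t. 1 / (1 + t\<^sup>2)) * norm x)) (at 0)"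
      by (intro tendsto_intros)
    then show "((\<lambda>s::real. \<bar>s\<bar> * (K * (LBINT t. 1 / (1 + t\<^sup>2)) * norm x)) \<longlongrightarrow> 0) (at 0)" by simp
  qed
  then have "((\<lambda>s. (U s (P_op U \<phi> x) - P_op U \<phi> x) /\<^sub>R s + P_op U (deriv \<phi>) x - P_op U (deriv \<phi>) x) \<longlongrightarrow> 0 - P_op U (deriv \<phi>) x) (at 0)"
    by (intro tendsto_intros)
  then show ?thesis by simp
qed

lemma A_P_op:
  assumes dec: "decays \<kappa> \<phi>" and \<kappa>: "\<kappa> \<ge> 0"
  shows "P_op U \<phi> x \<in> D" and "A (P_op U \<phi> x) = P_op U (\<lambda>z. \<i> * deriv \<phi> z) x"
proof -
  note lim = P_op_difference_quotient[OF dec \<kappa>, of x]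
  show D: "P_op U \<phi> x \<in> D" using gen lim by (auto simp: generates_def)
  then have "((\<lambda>t. (U t (P_op U \<phi> x) - P_op U \<phi> x) /\<^sub>R t) \<longlongrightarrow> \<i> *\<^sub>C A (P_op U \<phi> x)) (at 0)"
    using gen by (auto simp: generates_def)
  from tendsto_unique[OF _ this lim] have iA: "\<i> *\<^sub>C A (P_op U \<phi> x) = - P_op U (deriv \<phi>) x" by simp
  have neg: "(- 1) *\<^sub>C y = - y" for y :: 'a
    using scaleR_scaleC[of "- 1" y] by simp
  have "A (P_op U \<phi> x) = (- \<i> * \<i>) *\<^sub>C A (P_op U \<phi> x)" by (simp add: scaleC_one)
  also have "\<dots> = (- \<i>) *\<^sub>C (- P_op U (deriv \<phi>) x)" by (simp only: iA flip: scaleC_scaleC)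
  also have "\<dots> = \<i> *\<^sub>C P_op U (deriv \<phi>) x"
    unfolding neg[symmetric] scaleC_scaleC by simp
  also have "\<dots> = P_op U (\<lambda>z. \<i> * deriv \<phi> z) x"
  proof -
    obtain h1 where dom1: "dominated (deriv \<phi>) h1" using decays_dominated[OF decays_deriv[OF dec \<kappa>]] by blast
    obtain h2 where dom2: "dominated (\<lambda>z. \<i> * deriv \<phi> z) h2"
      using decays_dominated[OF decays_cmult[OF decays_deriv[OF dec \<kappa>]]] by blast
    have "((\<lambda>t::real. \<i> *\<^sub>C (deriv \<phi> (of_real t) *\<^sub>C U t x)) has_integral \<i> *\<^sub>C P_op U (deriv \<phi>) x) UNIV"
      using has_integral_linear[OF has_integral_P_op[OF dom1] bounded_linear_scaleC] by (simp add: o_def)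
    then show ?thesis
      using has_integral_P_op[OF dom2, of x] by (auto simp: scaleC_scaleC intro: has_integral_unique)
  qed
  finally show "A (P_op U \<phi> x) = P_op U (\<lambda>z. \<i> * deriv \<phi> z) x" .
qed

lemma A_pow_P_op:
  assumes "decays \<kappa> \<phi>" "\<kappa> \<ge> 0"
  shows "P_op U \<phi> x \<in> dom_pow D A n \<and> (A ^^ n) (P_op U \<phi> x) = P_op U (\<lambda>z. \<i> ^ n * (deriv ^^ n) \<phi> z) x"
  using assms(1)
proof (induction n arbitrary: \<phi>)
  case (Suc n)
  define \<psi> where "\<psi> z = \<i> * deriv \<phi> z" for z
  have hol: "\<phi> holomorphic_on UNIV" using Suc.prems by (simp add: decays_def)
  have dec: "decays \<kappa> \<psi>" unfolding \<psi>_def by (intro decays_cmult decays_deriv Suc.prems assms(2))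
  have deriv_\<psi>: "(deriv ^^ n) \<psi> z = \<i> * (deriv ^^ Suc n) \<phi> z" for z
  proof -
    have "deriv \<phi> holomorphic_on UNIV" using hol by (rule holomorphic_deriv) simp
    then have "(deriv ^^ n) (\<lambda>z. \<i> * deriv \<phi> z) z = \<i> * (deriv ^^ n) (deriv \<phi>) z"
      by (rule higher_deriv_cmult[of _ UNIV]) auto
    then show ?thesis by (simp add: \<psi>_def[abs_def] funpow_Suc_right del: funpow.simps)
  qed
  have A\<phi>: "A (P_op U \<phi> x) = P_op U \<psi> x" and D: "P_op U \<phi> x \<in> D"
    using A_P_op[OF Suc.prems assms(2), of x] by (auto simp: \<psi>_def[abs_def])
  have "(A ^^ Suc n) (P_op U \<phi> x) = (A ^^ n) (P_op U \<psi> x)" by (simp add: funpow_Suc_right A\<phi> del: funpow.simps)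
  also have "\<dots> = P_op U (\<lambda>z. \<i> ^ n * (deriv ^^ n) \<psi> z) x" using Suc.IH[OF dec] by simp
  also have "\<dots> = P_op U (\<lambda>z. \<i> ^ Suc n * (deriv ^^ Suc n) \<phi> z) x"
    unfolding deriv_\<psi> by (simp add: mult.assoc mult.left_commute)
  finally show ?case using D A\<phi> Suc.IH[OF dec] by simp
qed simp

text \<open>
  The types \<open>\<kappa> < \<mu> < \<gamma>\<close> leave room twice: between \<open>\<kappa>\<close> and \<open>\<mu>\<close> for the subexponential growth of \<open>w\<close> over the
  radius of the circles, between \<open>\<mu>\<close> and \<open>\<gamma>\<close> for the polynomial factors.
\<close>

theorem P_op_in_exp_vectors:
  assumes dec: "decays \<kappa> \<phi>" and \<kappa>: "\<kappa> \<ge> 0" and \<gamma>: "\<kappa> < \<gamma>"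
  shows "P_op U \<phi> x \<in> exp_vectors D A \<gamma>"
proof -
  define \<mu> where "\<mu> = (\<kappa> + \<gamma>) / 2"
  have \<mu>: "0 < \<mu>" "\<mu> < \<gamma>" "\<mu> - \<kappa> > 0" using \<kappa> \<gamma> by (auto simp: \<mu>_def)
  obtain C where C: "C \<ge> 0" "\<And>n z R. R > 0 \<Longrightarrow> cmod ((deriv ^^ n) \<phi> z) * W (Re z)
    \<le> C * (fact n / R ^ n * (1 + R\<^sup>2) * exp ((\<kappa> + (\<mu> - \<kappa>)) * R)) * exp (\<kappa> * \<bar>Im z\<bar>)"
    using decays_higher_deriv_bound[OF dec \<kappa> \<mu>(3)] by blast
  obtain c where c: "c > 0" "\<And>n. fact n / (real (Suc n) / \<mu>) ^ n * (1 + (real (Suc n) / \<mu>)\<^sup>2) * exp (\<mu> * (real (Suc n) / \<mu>)) \<le> c * \<gamma> ^ n"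
    using fact_Cauchy_radius_bound[OF \<mu>(1,2)] by blast
  define I where "I = (LBINT t. 1 / (1 + (t::real)\<^sup>2))"
  have I_nn: "I \<ge> 0" by (simp add: I_def)
  have bound: "norm ((A ^^ n) (P_op U \<phi> x)) \<le> (C * c * I * norm x + 1) * \<gamma> ^ n" for n
  proof -
    define \<phi>n where "\<phi>n z = \<i> ^ n * (deriv ^^ n) \<phi> z" for z
    have hol: "\<phi>n holomorphic_on UNIV"
      unfolding \<phi>n_def[abs_def] using dec by (intro holomorphic_intros holomorphic_higher_deriv) (auto simp: decays_def)
    have "cmod (\<phi>n (of_real t)) * W t \<le> C * (c * \<gamma> ^ n)" for t :: real
    proof -
      have "cmod (\<phi>n (of_real t)) * W t \<le> C * (fact n / (real (Suc n) / \<mu>) ^ n * (1 + (real (Suc n) / \<mu>)\<^sup>2) * exp (\<mu> * (real (Suc n) / \<mu>)))"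
        using C(2)[of "real (Suc n) / \<mu>" n "of_real t"] \<mu>(1) by (simp add: \<phi>n_def norm_mult norm_power)
      also have "\<dots> \<le> C * (c * \<gamma> ^ n)" by (intro mult_left_mono c(2) C(1))
      finally show ?thesis .
    qed
    then have "dominated \<phi>n (\<lambda>t. C * (c * \<gamma> ^ n) / (1 + t\<^sup>2))"
      by (intro dominated_of_W_bound holomorphic_continuous_on_reals[OF hol])
    then have "norm (P_op U \<phi>n x) \<le> (LBINT t. C * (c * \<gamma> ^ n) / (1 + t\<^sup>2)) * norm x"
      by (rule norm_P_op_le)
    also have "(LBINT t. C * (c * \<gamma> ^ n) / (1 + t\<^sup>2)) = (LBINT t. (C * (c * \<gamma> ^ n)) * (1 / (1 + t\<^sup>2)))" by simp
    also have "\<dots> = C * (c * \<gamma> ^ n) * I" unfolding I_def by (rule integral_mult_right_zero)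
    also have "C * (c * \<gamma> ^ n) * I * norm x \<le> (C * c * I * norm x + 1) * \<gamma> ^ n"
      using \<mu> by (simp add: algebra_simps)
    finally show ?thesis using A_pow_P_op[OF dec \<kappa>, of x n] by (simp add: \<phi>n_def[abs_def])
  qed
  moreover have "C * c * I * norm x + 1 > 0"
    using C(1) c(1) I_nn by (intro add_nonneg_pos mult_nonneg_nonneg) auto
  moreover have "P_op U \<phi> x \<in> C_infinity D A"
    using A_pow_P_op[OF dec \<kappa>, of x] by (auto simp: C_infinity_def)
  ultimately show ?thesis by (auto simp: exp_vectors_def)
qed

end

section \<open>Vectors of bounded type and spectral subspaces\<close>

text \<open>
  With \<open>g\<close> of type \<open>\<epsilon>\<close> and \<open>\<beta> = \<alpha> + 2 * \<epsilon>\<close>, the kernel \<open>g z sin (\<beta> z) / (\<pi> z)\<close> has type \<open>\<alpha> + 3 * \<epsilon>\<close> and its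
  transform equals \<open>1\<close> for \<open>|l| < \<beta> - \<epsilon> = \<alpha> + \<epsilon>\<close>.
\<close>

lemma band_limited_kernel:
  fixes a :: "nat \<Rightarrow> real"
  assumes a: "\<And>k. 0 < a k" and sum: "summable a" and \<alpha>: "\<alpha> > 0" and \<epsilon>: "\<epsilon> > 0"
  shows "\<exists>\<phi>. \<phi> holomorphic_on UNIV \<and> (\<forall>l. \<bar>l\<bar> < \<alpha> + \<epsilon> \<longrightarrow> fourier \<phi> l = 1) \<and>
    beats_product a (\<alpha> + 3 * \<epsilon>) \<phi>"
proof -
  obtain g where g: "g holomorphic_on UNIV" "g 0 = 1"
    and bound: "beats_product a \<epsilon> g"
    using entire_function_small_against_product_of_any_type[OF a sum \<epsilon>] by blast
  define \<beta> where "\<beta> = \<alpha> + 2 * \<epsilon>"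
  have \<beta>: "\<beta> > 0" using \<alpha> \<epsilon> by (simp add: \<beta>_def)
  define \<phi> where "\<phi> z = g z * (of_real (\<beta> / pi) * csinc (of_real \<beta> * z))" for z
  have "\<phi> holomorphic_on UNIV" unfolding \<phi>_def[abs_def] by (intro holomorphic_intros g)
  moreover have "fourier \<phi> l = 1" if "\<bar>l\<bar> < \<alpha> + \<epsilon>" for l
  proof -
    obtain C where C: "\<And>z N. (1 + (Re z)\<^sup>2) ^ 1 * (\<Prod>k<N. sqrt (1 + (1 * a k * Re z)\<^sup>2)) * cmod (g z)
        \<le> C * exp (\<epsilon> * \<bar>Im z\<bar>)"
      using beats_productE[OF bound zero_less_one] by blast
    show ?thesis unfolding \<phi>_def
    proof (rule fourier_band_limited_eq_1[OF g])
      show "cmod (g z) * (1 + (Re z)\<^sup>2) \<le> C * exp (\<epsilon> * \<bar>Im z\<bar>)" for z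
        using C[of z 0] by (simp add: mult.commute)
    qed (use that \<epsilon> in \<open>auto simp: \<beta>_def\<close>)
  qed
  moreover have "beats_product a (\<alpha> + 3 * \<epsilon>) \<phi>"
    unfolding beats_product_def
  proof (intro allI impI)
    fix s :: real and m :: nat assume s: "s > 0"
    obtain C where C_nn: "C \<ge> 0" and C: "\<And>z N. (1 + (Re z)\<^sup>2) ^ m
        * (\<Prod>k<N. sqrt (1 + (s * a k * Re z)\<^sup>2)) * cmod (g z) \<le> C * exp (\<epsilon> * \<bar>Im z\<bar>)"
      using beats_productE[OF bound s] by blast
    have "(1 + (Re z)\<^sup>2) ^ m * (\<Prod>k<N. sqrt (1 + (s * a k * Re z)\<^sup>2)) * cmod (\<phi> z)
        \<le> (C * (\<beta> / pi)) * exp ((\<alpha> + 3 * \<epsilon>) * \<bar>Im z\<bar>)" for z N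
    proof -
      have "(1 + (Re z)\<^sup>2) ^ m * (\<Prod>k<N. sqrt (1 + (s * a k * Re z)\<^sup>2)) * cmod (\<phi> z)
         = ((1 + (Re z)\<^sup>2) ^ m * (\<Prod>k<N. sqrt (1 + (s * a k * Re z)\<^sup>2)) * cmod (g z)) * ((\<beta> / pi) * cmod (csinc (of_real \<beta> * z)))"
        using \<beta> by (simp add: \<phi>_def norm_mult norm_divide)
      also have "\<dots> \<le> (C * exp (\<epsilon> * \<bar>Im z\<bar>)) * ((\<beta> / pi) * exp (\<beta> * \<bar>Im z\<bar>))"
        using norm_csinc_le[of "of_real \<beta> * z"] \<beta> C_nn
        by (intro mult_mono C mult_left_mono) (auto simp: abs_mult)
      also have "\<dots> = (C * (\<beta> / pi)) * (exp (\<epsilon> * \<bar>Im z\<bar>) * exp (\<beta> * \<bar>Im z\<bar>))" by (simp only: mult_ac)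
      also have "exp (\<epsilon> * \<bar>Im z\<bar>) * exp (\<beta> * \<bar>Im z\<bar>) = exp ((\<alpha> + 3 * \<epsilon>) * \<bar>Im z\<bar>)"
        unfolding exp_add[symmetric] by (simp add: \<beta>_def algebra_simps)
      finally show ?thesis .
    qed
    moreover have "C * (\<beta> / pi) \<ge> 0" using C_nn \<beta> by simp
    ultimately show "\<exists>C\<ge>0. \<forall>z N. (1 + (Re z)\<^sup>2) ^ m * (\<Prod>k<N. sqrt (1 + (s * a k * Re z)\<^sup>2)) * cmod (\<phi> z)
        \<le> C * exp ((\<alpha> + 3 * \<epsilon>) * \<bar>Im z\<bar>)" by blast
  qed
  ultimately show ?thesis by blast
qed

lemma exp_vectors_mono:
  assumes "0 \<le> \<alpha>" "\<alpha> \<le> \<beta>"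
  shows "exp_vectors D A \<alpha> \<subseteq> exp_vectors D A \<beta>"
proof
  fix x assume "x \<in> exp_vectors D A \<alpha>"
  then obtain c where c: "x \<in> C_infinity D A" "c > 0" "\<And>k. norm ((A ^^ k) x) \<le> c * \<alpha> ^ k"
    by (auto simp: exp_vectors_def)
  have "c * \<alpha> ^ k \<le> c * \<beta> ^ k" for k using assms c(2) by (intro mult_left_mono power_mono) auto
  then have "norm ((A ^^ k) x) \<le> c * \<beta> ^ k" for k using c(3)[of k] by (rule order_trans[rotated])
  then show "x \<in> exp_vectors D A \<beta>" using c by (auto simp: exp_vectors_def)
qed

lemma Xi_iff:
  assumes \<alpha>: "\<alpha> > 0"
  shows "x \<in> Xi D A \<alpha> \<longleftrightarrow> (\<forall>\<gamma>>\<alpha>. x \<in> exp_vectors D A \<gamma>)"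
proof -
  define T where "T = {\<beta>. \<beta> > 0 \<and> x \<in> exp_vectors D A \<beta>}"
  have bdd: "bdd_below T" by (intro bdd_belowI[of _ 0]) (auto simp: T_def)
  have Xi: "x \<in> Xi D A \<alpha> \<longleftrightarrow> T \<noteq> {} \<and> Inf T \<le> \<alpha>"
    by (auto simp: Xi_def all_exp_vectors_def vector_type_def T_def)
  show ?thesis
  proof
    assume "x \<in> Xi D A \<alpha>"
    then have T: "T \<noteq> {}" "Inf T \<le> \<alpha>" using Xi by auto
    show "\<forall>\<gamma>>\<alpha>. x \<in> exp_vectors D A \<gamma>"
    proof (intro allI impI)
      fix \<gamma> assume "\<gamma> > \<alpha>"
      then obtain \<beta> where "\<beta> \<in> T" "\<beta> < \<gamma>" using T cInf_less_iff[OF T(1) bdd, of \<gamma>] by auto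
      then show "x \<in> exp_vectors D A \<gamma>" using exp_vectors_mono[of \<beta> \<gamma> D A] by (auto simp: T_def)
    qed
  next
    assume *: "\<forall>\<gamma>>\<alpha>. x \<in> exp_vectors D A \<gamma>"
    then have T: "\<gamma> \<in> T" if "\<gamma> > \<alpha>" for \<gamma> using that \<alpha> by (auto simp: T_def)
    have "Inf T \<le> \<gamma>" if "\<gamma> > \<alpha>" for \<gamma> by (rule cInf_lower[OF T[OF that] bdd])
    then have "Inf T \<le> \<alpha>" by (rule dense_ge)
    moreover have "T \<noteq> {}" using T[of "\<alpha> + 1"] by auto
    ultimately show "x \<in> Xi D A \<alpha>" using Xi by simp
  qed
qed

text \<open>
  On the real line the modulus of a canonical product with zeros \<open>\<i> \<tau> k\<close> is a product of the form that the
  kernels are built to beat.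
\<close>

lemma theta_product_LIMSEQ:
  fixes \<tau> :: "nat \<Rightarrow> real" and x :: real
  assumes \<tau>: "\<And>k. 0 < \<tau> k" and sum: "summable (\<lambda>k. 1 / \<tau> k)"
  shows "(\<lambda>N. \<Prod>k<N. 1 - of_real x / (\<i> * of_real (\<tau> k))) \<longlonglongrightarrow> (\<Prod>k. 1 - of_real x / (\<i> * complex_of_real (\<tau> k)))"
    and "cmod (\<Prod>k<N. 1 - of_real x / (\<i> * of_real (\<tau> k))) = (\<Prod>k<N. sqrt (1 + (1 / \<tau> k * x)\<^sup>2))"
proof -
  have "summable (\<lambda>k. \<bar>x\<bar> * (1 / \<tau> k))" by (intro summable_mult sum)
  then have "abs_convergent_prod (\<lambda>k. 1 - of_real x / (\<i> * complex_of_real (\<tau> k)))"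
    by (intro summable_imp_abs_convergent_prod) (simp add: norm_divide norm_mult abs_of_pos[OF \<tau>])
  then have "(\<lambda>N. \<Prod>k\<le>N. 1 - of_real x / (\<i> * of_real (\<tau> k))) \<longlonglongrightarrow> (\<Prod>k. 1 - of_real x / (\<i> * complex_of_real (\<tau> k)))"
    by (intro convergent_prod_LIMSEQ abs_convergent_prod_imp_convergent_prod)
  then have "(\<lambda>N. \<Prod>k<Suc N. 1 - of_real x / (\<i> * of_real (\<tau> k))) \<longlonglongrightarrow> (\<Prod>k. 1 - of_real x / (\<i> * complex_of_real (\<tau> k)))"
    by (simp only: lessThan_Suc_atMost)
  then show "(\<lambda>N. \<Prod>k<N. 1 - of_real x / (\<i> * of_real (\<tau> k))) \<longlonglongrightarrow> (\<Prod>k. 1 - of_real x / (\<i> * complex_of_real (\<tau> k)))"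
    by (rule LIMSEQ_imp_Suc)
  have "cmod (1 - of_real x / (\<i> * of_real (\<tau> k))) = sqrt (1 + (1 / \<tau> k * x)\<^sup>2)" for k
  proof -
    have "1 - of_real x / (\<i> * of_real (\<tau> k)) = Complex 1 (x / \<tau> k)"
      by (simp add: complex_eq_iff Re_divide Im_divide power2_eq_square)
    then show ?thesis by (simp add: cmod_def)
  qed
  then show "cmod (\<Prod>k<N. 1 - of_real x / (\<i> * of_real (\<tau> k))) = (\<Prod>k<N. sqrt (1 + (1 / \<tau> k * x)\<^sup>2))"
    by (simp add: prod_norm[symmetric])
qed

context generated_C0_group
begin

lemma decays_of_beats_product:
  assumes \<phi>: "\<phi> holomorphic_on UNIV" and M: "M \<ge> 0" and w: "\<And>x. \<exists>N. w x \<le> M * (\<Prod>k<N. sqrt (1 + (a k * x)\<^sup>2))"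
    and beats: "beats_product a \<kappa> \<phi>"
  shows "decays \<kappa> \<phi>"
proof -
  obtain C where bound: "\<And>z N. (1 + (Re z)\<^sup>2) ^ 1 * (\<Prod>k<N. sqrt (1 + (1 * a k * Re z)\<^sup>2)) * cmod (\<phi> z) \<le> C * exp (\<kappa> * \<bar>Im z\<bar>)"
    using beats_productE[OF beats zero_less_one] by blast
  have "cmod (\<phi> z) * W (Re z) \<le> (M * C) * exp (\<kappa> * \<bar>Im z\<bar>)" for z
  proof -
    obtain N where N: "w (Re z) \<le> M * (\<Prod>k<N. sqrt (1 + (a k * Re z)\<^sup>2))" using w by blast
    have "cmod (\<phi> z) * W (Re z) = w (Re z) * ((1 + (Re z)\<^sup>2) * cmod (\<phi> z))" by (simp add: W_def mult_ac)
    also have "\<dots> \<le> (M * (\<Prod>k<N. sqrt (1 + (a k * Re z)\<^sup>2))) * ((1 + (Re z)\<^sup>2) * cmod (\<phi> z))"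
      by (intro mult_right_mono N) auto
    also have "\<dots> = M * ((1 + (Re z)\<^sup>2) ^ 1 * (\<Prod>k<N. sqrt (1 + (1 * a k * Re z)\<^sup>2)) * cmod (\<phi> z))" by (simp add: mult_ac)
    also have "\<dots> \<le> M * (C * exp (\<kappa> * \<bar>Im z\<bar>))" by (intro mult_left_mono bound M)
    finally show ?thesis by (simp add: mult.assoc)
  qed
  then show ?thesis using \<phi> unfolding decays_def by blast
qed

lemma P_op_fixes_Xi:
  assumes x: "x \<in> Xi D A \<alpha>" and \<alpha>: "\<alpha> > 0" and dom: "dominated \<phi> h"
    and hat: "\<And>l. \<bar>l\<bar> < b \<Longrightarrow> fourier \<phi> l = 1" and b: "\<alpha> < b"
  shows "P_op U \<phi> x = x"
proof -
  define \<beta> where "\<beta> = (\<alpha> + b) / 2"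
  have \<beta>: "\<alpha> < \<beta>" "\<beta> < b" "0 \<le> \<beta>" using \<alpha> b by (auto simp: \<beta>_def)
  have "x \<in> exp_vectors D A \<beta>" using x \<beta> by (simp add: Xi_iff[OF \<alpha>])
  from P_op_fixes_exp_vectors[where b=b, OF dom _ \<beta>(3,2) this] show ?thesis using hat by blast
qed

lemma Xi_of_fixed:
  assumes \<alpha>: "\<alpha> > 0" and fixed: "\<And>\<epsilon>. \<epsilon> > 0 \<Longrightarrow> \<exists>\<phi>. decays (\<alpha> + 3 * \<epsilon>) \<phi> \<and> P_op U \<phi> x = x"
  shows "x \<in> Xi D A \<alpha>"
  unfolding Xi_iff[OF \<alpha>]
proof (intro allI impI)
  fix \<gamma> assume \<gamma>: "\<gamma> > \<alpha>"
  define \<epsilon> where "\<epsilon> = (\<gamma> - \<alpha>) / 6"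
  have \<epsilon>: "\<epsilon> > 0" "\<alpha> + 3 * \<epsilon> < \<gamma>" using \<gamma> by (auto simp: \<epsilon>_def field_simps)
  obtain \<phi> where \<phi>: "decays (\<alpha> + 3 * \<epsilon>) \<phi>" "P_op U \<phi> x = x" using fixed[OF \<epsilon>(1)] by blast
  have "P_op U \<phi> x \<in> exp_vectors D A \<gamma>"
    by (rule P_op_in_exp_vectors[OF \<phi>(1) _ \<epsilon>(2)]) (use \<alpha> \<epsilon>(1) in simp)
  then show "x \<in> exp_vectors D A \<gamma>" by (simp add: \<phi>(2))
qed

text \<open>
  For each \<open>\<epsilon>\<close> choose a kernel built from the product majorant of \<open>w\<close>. Then \<open>Xi D A \<alpha>\<close> is the intersection
  of the fixed spaces of the corresponding operators.
\<close>

lemma Xi_closed_csubspace: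
  assumes \<alpha>: "\<alpha> > 0"
  shows "closed (Xi D A \<alpha>)" and "csubspace (Xi D A \<alpha>)"
proof -
  obtain a :: "nat \<Rightarrow> real" and M where a: "\<And>k. 0 < a k" "summable a" and M: "M \<ge> 0"
    and w: "\<And>x. \<exists>N. w x \<le> M * (\<Prod>k<N. sqrt (1 + (a k * x)\<^sup>2))"
    using w_le_product by blast
  have "\<exists>\<phi>. decays (\<alpha> + 3 * \<epsilon>) \<phi> \<and> (\<forall>l. \<bar>l\<bar> < \<alpha> + \<epsilon> \<longrightarrow> fourier \<phi> l = 1)" if \<epsilon>: "\<epsilon> > 0" for \<epsilon>
  proof -
    obtain \<phi> where \<phi>: "\<phi> holomorphic_on UNIV" "\<forall>l. \<bar>l\<bar> < \<alpha> + \<epsilon> \<longrightarrow> fourier \<phi> l = 1"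
      and beats: "beats_product a (\<alpha> + 3 * \<epsilon>) \<phi>"
      using band_limited_kernel[OF a \<alpha> \<epsilon>] by blast
    have "decays (\<alpha> + 3 * \<epsilon>) \<phi>" by (rule decays_of_beats_product[OF \<phi>(1) M w beats])
    then show ?thesis using \<phi>(2) by blast
  qed
  then obtain \<Phi> where \<Phi>: "\<And>\<epsilon>. \<epsilon> > 0 \<Longrightarrow> decays (\<alpha> + 3 * \<epsilon>) (\<Phi> \<epsilon>)"
    "\<And>\<epsilon> l. \<epsilon> > 0 \<Longrightarrow> \<bar>l\<bar> < \<alpha> + \<epsilon> \<Longrightarrow> fourier (\<Phi> \<epsilon>) l = 1"
    by metis
  have dom: "\<exists>h. dominated (\<Phi> \<epsilon>) h" if "\<epsilon> > 0" for \<epsilon> by (rule decays_dominated[OF \<Phi>(1)[OF that]])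
  have eq: "Xi D A \<alpha> = (\<Inter>\<epsilon>\<in>{0<..}. {x. P_op U (\<Phi> \<epsilon>) x = x})"
  proof (intro equalityI subsetI)
    fix x assume x: "x \<in> Xi D A \<alpha>"
    have "P_op U (\<Phi> \<epsilon>) x = x" if \<epsilon>: "\<epsilon> > 0" for \<epsilon>
    proof -
      obtain h where "dominated (\<Phi> \<epsilon>) h" using dom[OF \<epsilon>] by blast
      then show ?thesis by (rule P_op_fixes_Xi[OF x \<alpha> _ \<Phi>(2)[OF \<epsilon>]]) (use \<epsilon> in auto)
    qed
    then show "x \<in> (\<Inter>\<epsilon>\<in>{0<..}. {x. P_op U (\<Phi> \<epsilon>) x = x})" by simp
  next
    fix x assume "x \<in> (\<Inter>\<epsilon>\<in>{0<..}. {x. P_op U (\<Phi> \<epsilon>) x = x})"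
    then show "x \<in> Xi D A \<alpha>" using \<Phi>(1) by (intro Xi_of_fixed[OF \<alpha>]) auto
  qed
  show "closed (Xi D A \<alpha>)" unfolding eq using dom closed_fixed_P_op by (intro closed_INT) auto
  interpret cv: vector_space "scaleC :: complex \<Rightarrow> 'a \<Rightarrow> 'a" by (rule vector_space_scaleC)
  show "csubspace (Xi D A \<alpha>)"
    unfolding eq using dom csubspace_fixed_P_op by (intro cv.subspace_Inter) auto
qed

text \<open>
  Every \<open>\<phi> \<in> E_theta_on \<theta> {-\<alpha>..\<alpha>}\<close> fixes \<open>Xi D A \<alpha>\<close>, since \<open>\<theta>\<close> dominates \<open>w\<close> and \<open>fourier \<phi> = 1\<close> on a
  symmetric interval around \<open>[-\<alpha>, \<alpha>]\<close>. For the converse, the kernels built from the zeros of \<open>\<theta>\<close> itself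
  belong to \<open>E_theta_on \<theta> {-\<alpha>..\<alpha>}\<close> because they decay faster than \<open>1 / \<theta> (s t)\<close> for every \<open>s\<close>.
\<close>

lemma Xi_eq_spectral_subspace:
  assumes \<alpha>: "\<alpha> > 0" and \<theta>: "theta_majorant U \<theta>"
  shows "Xi D A \<alpha> = spectral_subspace U \<theta> {-\<alpha>..\<alpha>}"
proof (intro equalityI subsetI)
  have w_le: "w t \<le> cmod (\<theta> (of_real t))" for t
    using \<theta> by (simp add: theta_majorant_def w_def)
  fix x assume x: "x \<in> Xi D A \<alpha>"
  have "P_op U \<phi> x = x" if \<phi>: "\<phi> \<in> E_theta_on \<theta> {-\<alpha>..\<alpha>}" for \<phi>
  proof -
    have E: "\<phi> \<in> E_theta \<theta>" using \<phi> by (simp add: E_theta_on_def)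
    obtain p q where pq: "{-\<alpha>..\<alpha>} \<subseteq> {p<..<q}" "\<And>l. l \<in> {p<..<q} \<Longrightarrow> fourier \<phi> l = 1"
      using \<phi> by (auto simp: E_theta_on_def)
    have "-\<alpha> \<in> {p<..<q}" "\<alpha> \<in> {p<..<q}" using \<alpha> subsetD[OF pq(1), of "-\<alpha>"] subsetD[OF pq(1), of \<alpha>] by auto
    then have pq': "p < -\<alpha>" "\<alpha> < q" by auto
    have hol: "\<phi> holomorphic_on UNIV" using E by (simp add: E_theta_def exponential_type_def)
    have "integrable lborel (\<lambda>t::real. cmod (of_real t ^ m * \<theta> (of_real (s * t)) * \<phi> (of_real t)))"
      if "s > 0" for m s
      using E that by (simp add: E_theta_def)
    from this[OF zero_less_one, of 0] have dom: "dominated \<phi> (\<lambda>t. cmod (\<theta> (of_real t)) * cmod (\<phi> (of_real t)))"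
      unfolding dominated_def
      by (intro conjI holomorphic_continuous_on_reals[OF hol] allI)
         (simp_all add: norm_mult mult.commute[of "cmod (\<phi> _)"] mult_right_mono w_le)
    show ?thesis
      by (rule P_op_fixes_Xi[OF x \<alpha> dom, where b="min (- p) q"]) (use pq' in \<open>auto intro!: pq(2)\<close>)
  qed
  then show "x \<in> spectral_subspace U \<theta> {-\<alpha>..\<alpha>}" by (simp add: spectral_subspace_def)
next
  fix x assume x: "x \<in> spectral_subspace U \<theta> {-\<alpha>..\<alpha>}"
  obtain c :: complex and \<tau> :: "nat \<Rightarrow> real" where \<tau>: "\<And>k. 0 < \<tau> k" "summable (\<lambda>k. 1 / \<tau> k)"
    and \<theta>_eq: "\<And>z. \<theta> z = c * (\<Prod>k. 1 - z / (\<i> * complex_of_real (\<tau> k)))"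
    using \<theta> unfolding theta_majorant_def by blast
  have w_le: "w t \<le> cmod (\<theta> (of_real t))" for t
    using \<theta> by (simp add: theta_majorant_def w_def)
  define a where "a k = 1 / \<tau> k" for k
  have a: "\<And>k. 0 < a k" "summable a" using \<tau> by (simp_all add: a_def[abs_def])
  have part_\<theta>: "(\<lambda>N. c * (\<Prod>k<N. 1 - of_real t / (\<i> * of_real (\<tau> k)))) \<longlonglongrightarrow> \<theta> (of_real t)" for t :: real
    unfolding \<theta>_eq by (intro tendsto_intros theta_product_LIMSEQ \<tau>)
  have norm_\<theta>: "(\<lambda>N. cmod c * (\<Prod>k<N. sqrt (1 + (a k * t)\<^sup>2))) \<longlonglongrightarrow> cmod (\<theta> (of_real t))" for t :: real
    using tendsto_norm[OF part_\<theta>[of t]] unfolding norm_mult theta_product_LIMSEQ(2)[OF \<tau>] a_def .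
  \<comment> \<open>The factor \<open>2\<close> allows the infinite product to be replaced by a finite partial product.\<close>
  have w_prod: "\<exists>N. w t \<le> (2 * cmod c) * (\<Prod>k<N. sqrt (1 + (a k * t)\<^sup>2))" for t
  proof (cases "\<theta> (of_real t) = 0")
    case True
    then have "w t \<le> 0" using w_le[of t] by simp
    also have "0 \<le> (2 * cmod c) * (\<Prod>k<0. sqrt (1 + (a k * t)\<^sup>2))" by simp
    finally show ?thesis by blast
  next
    case False
    then have "\<forall>\<^sub>F N in sequentially. cmod (\<theta> (of_real t)) / 2 < cmod c * (\<Prod>k<N. sqrt (1 + (a k * t)\<^sup>2))"
      by (intro order_tendstoD[OF norm_\<theta>]) simp
    then obtain N where "cmod (\<theta> (of_real t)) / 2 < cmod c * (\<Prod>k<N. sqrt (1 + (a k * t)\<^sup>2))"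
      by (auto simp: eventually_sequentially)
    then have "w t \<le> (2 * cmod c) * (\<Prod>k<N. sqrt (1 + (a k * t)\<^sup>2))" using w_le[of t] by simp
    then show ?thesis by blast
  qed
  have meas_\<theta> [measurable]: "(\<lambda>t::real. \<theta> (of_real t)) \<in> borel_measurable borel"
    by (rule borel_measurable_LIMSEQ_metric[OF _ part_\<theta>]) measurable
  show "x \<in> Xi D A \<alpha>"
  proof (rule Xi_of_fixed[OF \<alpha>])
    fix \<epsilon> :: real assume \<epsilon>: "\<epsilon> > 0"
    obtain \<phi> where \<phi>: "\<phi> holomorphic_on UNIV" "\<And>l. \<bar>l\<bar> < \<alpha> + \<epsilon> \<Longrightarrow> fourier \<phi> l = 1"
      and beats: "beats_product a (\<alpha> + 3 * \<epsilon>) \<phi>"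
      using band_limited_kernel[OF a \<alpha> \<epsilon>] by blast
    have dec: "decays (\<alpha> + 3 * \<epsilon>) \<phi>"
      by (rule decays_of_beats_product[OF \<phi>(1) _ w_prod beats]) simp
    have [measurable]: "(\<lambda>t::real. \<phi> (of_real t)) \<in> borel_measurable borel"
      by (rule borel_measurable_continuous_onI[OF holomorphic_continuous_on_reals[OF \<phi>(1)]])
    have int: "integrable lborel (\<lambda>t::real. cmod (of_real t ^ m * \<theta> (of_real (s * t)) * \<phi> (of_real t)))"
      if s: "s > 0" for m s
    proof -
      obtain K where K: "K \<ge> 0" "\<And>z N. (1 + (Re z)\<^sup>2) ^ Suc m * (\<Prod>k<N. sqrt (1 + (s * a k * Re z)\<^sup>2)) * cmod (\<phi> z)
        \<le> K * exp ((\<alpha> + 3 * \<epsilon>) * \<bar>Im z\<bar>)"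
        using beats_productE[OF beats s] by blast
      have b: "cmod (of_real t ^ m * \<theta> (of_real (s * t)) * \<phi> (of_real t)) \<le> cmod c * K / (1 + t\<^sup>2)" for t :: real
      proof -
        have "(1 + t\<^sup>2) ^ Suc m * cmod (\<theta> (of_real (s * t))) * cmod (\<phi> (of_real t)) \<le> cmod c * K"
        proof (rule LIMSEQ_le_const2)
          show "(\<lambda>N. (1 + t\<^sup>2) ^ Suc m * (cmod c * (\<Prod>k<N. sqrt (1 + (a k * (s * t))\<^sup>2))) * cmod (\<phi> (of_real t)))
              \<longlonglongrightarrow> (1 + t\<^sup>2) ^ Suc m * cmod (\<theta> (of_real (s * t))) * cmod (\<phi> (of_real t))"
            by (intro tendsto_mult tendsto_const norm_\<theta>)
          have "(1 + t\<^sup>2) ^ Suc m * (cmod c * (\<Prod>k<N. sqrt (1 + (a k * (s * t))\<^sup>2))) * cmod (\<phi> (of_real t)) \<le> cmod c * K" for N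
          proof -
            have "(1 + t\<^sup>2) ^ Suc m * (cmod c * (\<Prod>k<N. sqrt (1 + (a k * (s * t))\<^sup>2))) * cmod (\<phi> (of_real t))
              = cmod c * ((1 + t\<^sup>2) ^ Suc m * (\<Prod>k<N. sqrt (1 + (s * a k * t)\<^sup>2)) * cmod (\<phi> (of_real t)))"
              by (simp only: mult_ac)
            also have "\<dots> \<le> cmod c * K" using K(2)[of "of_real t" N] by (intro mult_left_mono) auto
            finally show ?thesis .
          qed
          then show "\<exists>N0. \<forall>N\<ge>N0. (1 + t\<^sup>2) ^ Suc m * (cmod c * (\<Prod>k<N. sqrt (1 + (a k * (s * t))\<^sup>2))) * cmod (\<phi> (of_real t)) \<le> cmod c * K"
            by blast
        qed
        moreover have "\<bar>t\<bar> ^ m \<le> (1 + t\<^sup>2) ^ m"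
        proof (rule power_mono)
          show "\<bar>t\<bar> \<le> 1 + t\<^sup>2" using zero_le_power2[of "\<bar>t\<bar> - 1"] by (simp add: power2_eq_square algebra_simps)
        qed simp
        then have "\<bar>t\<bar> ^ m * ((1 + t\<^sup>2) * (cmod (\<theta> (of_real (s * t))) * cmod (\<phi> (of_real t))))
            \<le> (1 + t\<^sup>2) ^ m * ((1 + t\<^sup>2) * (cmod (\<theta> (of_real (s * t))) * cmod (\<phi> (of_real t))))"
          by (rule mult_right_mono) simp
        ultimately have "cmod (of_real t ^ m * \<theta> (of_real (s * t)) * \<phi> (of_real t)) * (1 + t\<^sup>2) \<le> cmod c * K"
          by (simp add: norm_mult norm_power mult_ac)
        then show ?thesis by (subst pos_le_divide_eq) (auto intro: add_pos_nonneg)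
      qed
      show ?thesis
      proof (rule Bochner_Integration.integrable_bound[OF integrable_inverse_1_plus_square_UNIV[of "cmod c * K"]])
        show "AE t in lborel. norm (cmod (of_real t ^ m * \<theta> (of_real (s * t)) * \<phi> (of_real t))) \<le> norm (cmod c * K / (1 + t\<^sup>2))"
          by (intro AE_I2) (simp only: real_norm_def abs_norm_cancel order_trans[OF b abs_ge_self])
        have [measurable]: "(\<lambda>t::real. \<theta> (of_real (s * t))) \<in> borel_measurable borel"
          using measurable_compose[OF _ meas_\<theta>, of "\<lambda>t. s * t" borel] by simp
        show "(\<lambda>t::real. cmod (of_real t ^ m * \<theta> (of_real (s * t)) * \<phi> (of_real t))) \<in> borel_measurable lborel"
          by measurable
      qed
    qed
    have "exponential_type \<phi>"
      unfolding exponential_type_def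
    proof (intro conjI \<phi>(1))
      obtain K where K: "K \<ge> 0" "\<And>z N. (1 + (Re z)\<^sup>2) ^ 0 * (\<Prod>k<N. sqrt (1 + (1 * a k * Re z)\<^sup>2)) * cmod (\<phi> z)
        \<le> K * exp ((\<alpha> + 3 * \<epsilon>) * \<bar>Im z\<bar>)"
        using beats_productE[OF beats zero_less_one] by blast
      have "cmod (\<phi> z) \<le> K * exp ((\<alpha> + 3 * \<epsilon>) * cmod z)" for z
      proof -
        have "cmod (\<phi> z) \<le> K * exp ((\<alpha> + 3 * \<epsilon>) * \<bar>Im z\<bar>)" using K(2)[of z 0] by simp
        also have "\<dots> \<le> K * exp ((\<alpha> + 3 * \<epsilon>) * cmod z)"
          using K(1) \<alpha> \<epsilon> abs_Im_le_cmod[of z] by (intro mult_left_mono) (auto intro: mult_left_mono)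
        finally show ?thesis .
      qed
      then show "\<exists>M B. \<forall>z. cmod (\<phi> z) \<le> M * exp (B * cmod z)" by blast
    qed
    then have "\<phi> \<in> E_theta \<theta>" using int by (simp add: E_theta_def)
    moreover have "{-\<alpha>..\<alpha>} \<subseteq> {-(\<alpha> + \<epsilon>)<..<\<alpha> + \<epsilon>}" using \<epsilon> by auto
    moreover have "\<forall>l\<in>{-(\<alpha> + \<epsilon>)<..<\<alpha> + \<epsilon>}. fourier \<phi> l = 1" by (auto intro!: \<phi>(2))
    ultimately have "\<phi> \<in> E_theta_on \<theta> {-\<alpha>..\<alpha>}" unfolding E_theta_on_def by blast
    then show "\<exists>\<phi>. decays (\<alpha> + 3 * \<epsilon>) \<phi> \<and> P_op U \<phi> x = x"
      using x dec by (auto simp: spectral_subspace_def)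
  qed
qed

end

theorem theorem1:
  fixes U :: "real \<Rightarrow> 'a::complex_banach \<Rightarrow> 'a"
    and D :: "'a set" and A :: "'a \<Rightarrow> 'a" and \<alpha> :: real
  assumes "closed_densely_defined D A"
    and "C0_group U"
    and "generates D (\<lambda>x. \<i> *\<^sub>C A x) U"
    and "non_quasianalytic U"
    and "\<alpha> > 0"
  shows "exp_vectors D A \<alpha> \<subseteq> Xi D A \<alpha> \<and>
    (\<forall>\<theta>. theta_majorant U \<theta> \<longrightarrow> Xi D A \<alpha> = spectral_subspace U \<theta> {-\<alpha>..\<alpha>}) \<and>
    csubspace (Xi D A \<alpha>) \<and> closed (Xi D A \<alpha>)"
proof -
  interpret generated_C0_group U D A by unfold_locales (fact assms)+
  have "exp_vectors D A \<alpha> \<subseteq> Xi D A \<alpha>"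
  proof
    fix x assume "x \<in> exp_vectors D A \<alpha>"
    then show "x \<in> Xi D A \<alpha>"
      unfolding Xi_iff[OF assms(5)] using exp_vectors_mono[of \<alpha>] assms(5) by (meson less_imp_le subsetD)
  qed
  then show ?thesis
    using Xi_eq_spectral_subspace[OF assms(5)] Xi_closed_csubspace[OF assms(5)] by blast
qed

end
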